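(* Assume propositional resizing. Let $n\ge -2$ and let $D$ be an $(n+1)$-type in a universe $\mathcal{U}$. Then $D$ is algebraically $\mathcal{U},\mathcal{U}$-injective if and only if $D$ is a retract of an exponential power of the universe of $n$-types in $\mathcal{U}$, with exponent in $\mathcal{U}$; i.e. if and only if there is a designated $X:\mathcal{U}$ such that $D$ is a retract of $X\to \Sigma(Z:\mathcal{U}),\,(Z\text{ is an }n\text{-type})$. (This is a logical equivalence: constructions in both directions.)
   Context: Foundation: intensional Martin-Löf type theory with $\mathbb{0},\mathbb{1},\mathbb{N},+,\Pi,\Sigma,\mathrm{Id}$ and universes $\mathcal{U},\mathcal{V},\mathcal{W},\mathcal{T}$ (not assumed cumulative), with successor $\mathcal{U}^+$ and least upper bound $\mathcal{U}\sqcup\mathcal{V}$; if $X:\mathcal{U}$ and $A:X\to\mathcal{V}$ then $\Pi A,\Sigma A:\mathcal{U}\sqcup\mathcal{V}$. Univalence (hence function and propositional extensionality) and existence of propositional truncations are assumed. Excluded middle is neither assumed nor rejected. The $n$-types are indexed from $n=-2$: the $(-2)$-types are the singletons (contractible types), and a type is an $(n+1)$-type if all its identity types are $n$-types. A proposition (subsingleton) is a type any two of whose elements are equal. A map $j:X\to Y$ is an embedding if each fiber $j^{-1}(y):=\Sigma(x:X),\,j\,x=y$ is a subsingleton; $X\hookrightarrow Y$ is the type of embeddings. $f\sim g$ means pointwise equality. "$A$ is a retract of $B$" means there are designated $s:A\to B$, $r:B\to A$ and $r\circ s\sim\mathrm{id}$. A type $D$ (in any universe) is algebraically $\mathcal{U},\mathcal{V}$-injective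 if it is equipped with an element of $$\Pi(X:\mathcal{U})\,\Pi(Y:\mathcal{V})\,\Pi(j:X\hookrightarrow Y)\,\Pi(f:X\to D),\ \Sigma(g:Y\to D),\ g\circ j\sim f.$$ Propositional resizing: for any two universes $\mathcal{U},\mathcal{V}$, every proposition in $\mathcal{U}$ has an equivalent copy in $\mathcal{V}$. *)

theory Defs
  imports Main
begin

text \<open>
  The claim is a theorem of univalent type theory, so the object theory is deeply embedded:
  intensional Martin-Loef type theory with typed judgemental equality, following the formal
  presentation in the appendix of the HoTT book, except that the universes are Russell-style
  universes \<open>Univ 0 : Univ 1 : \<dots>\<close> \<^emph>\<open>without\<close> cumulativity, with \<open>i + 1\<close> as successor and \<open>max i j\<close> as
  least upper bound.
  Dependent functions have beta and eta; all other types have their induction principle with the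
  computation rules only.
\<close>

section \<open>Raw syntax\<close>

text \<open>
  Constants stand for the assumptions that extend plain type theory.  They are families indexed by
  universe levels, because a hypothesis about all universes is not a single type.
\<close>

datatype const =
    UA nat            \<comment> \<open>univalence of a universe\<close>
  | Trunc nat         \<comment> \<open>propositional truncation, as an operation on a universe\<close>
  | TruncIn nat
  | TruncProp nat
  | TruncRec nat nat
  | Resize nat nat    \<comment> \<open>propositions of the first universe have copies in the second one\<close>

text \<open>
  De Bruijn terms.  The number of variables bound in each argument is: 1 in the second argument of
  \<open>Pi\<close>, \<open>Lam\<close>, \<open>Sig\<close> and in the first argument of \<open>Tup\<close>;
  \<open>SigE\<close>: 1, 2, 0; \<open>EmptyE\<close>: 1, 0; \<open>UnitE\<close>: 1, 0, 0; \<open>NatE\<close>: 1, 0, 2, 0; \<open>PlusE\<close>: 1, 1, 1, 0;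
  \<open>EqE\<close>: 3, 1, 0, 0, 0.  The first argument of an eliminator is its motive.
  \<open>Tup B a b\<close> is the pair of \<open>a\<close> and \<open>b\<close> in \<open>Sig A B\<close>; \<open>InL B a\<close> and \<open>InR A b\<close> carry the other summand.
\<close>

datatype tm =
    Var nat | Univ nat | Const const
  | Pi tm tm | Lam tm tm | App tm tm
  | Sig tm tm | Tup tm tm tm | SigE tm tm tm
  | EmptyT | EmptyE tm tm
  | UnitT | Star | UnitE tm tm tm
  | NatT | Zero | Succ tm | NatE tm tm tm tm
  | Plus tm tm | InL tm tm | InR tm tm | PlusE tm tm tm tm
  | Eq tm tm tm | Refl tm | EqE tm tm tm tm tm

fun upr :: "(nat \<Rightarrow> nat) \<Rightarrow> nat \<Rightarrow> nat" where
  "upr r 0 = 0"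
| "upr r (Suc n) = Suc (r n)"

primrec ren :: "(nat \<Rightarrow> nat) \<Rightarrow> tm \<Rightarrow> tm" where
  "ren r (Var n) = Var (r n)"
| "ren r (Univ i) = Univ i"
| "ren r (Const c) = Const c"
| "ren r (Pi A B) = Pi (ren r A) (ren (upr r) B)"
| "ren r (Lam A b) = Lam (ren r A) (ren (upr r) b)"
| "ren r (App f a) = App (ren r f) (ren r a)"
| "ren r (Sig A B) = Sig (ren r A) (ren (upr r) B)"
| "ren r (Tup B a b) = Tup (ren (upr r) B) (ren r a) (ren r b)"
| "ren r (SigE C c p) = SigE (ren (upr r) C) (ren (upr (upr r)) c) (ren r p)"
| "ren r EmptyT = EmptyT"
| "ren r (EmptyE C e) = EmptyE (ren (upr r) C) (ren r e)"
| "ren r UnitT = UnitT"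
| "ren r Star = Star"
| "ren r (UnitE C c e) = UnitE (ren (upr r) C) (ren r c) (ren r e)"
| "ren r NatT = NatT"
| "ren r Zero = Zero"
| "ren r (Succ n) = Succ (ren r n)"
| "ren r (NatE C z s n) = NatE (ren (upr r) C) (ren r z) (ren (upr (upr r)) s) (ren r n)"
| "ren r (Plus A B) = Plus (ren r A) (ren r B)"
| "ren r (InL B a) = InL (ren r B) (ren r a)"
| "ren r (InR A b) = InR (ren r A) (ren r b)"
| "ren r (PlusE C c d e) = PlusE (ren (upr r) C) (ren (upr r) c) (ren (upr r) d) (ren r e)"
| "ren r (Eq A a b) = Eq (ren r A) (ren r a) (ren r b)"
| "ren r (Refl a) = Refl (ren r a)"
| "ren r (EqE C d a b p) =
     EqE (ren (upr (upr (upr r))) C) (ren (upr r) d) (ren r a) (ren r b) (ren r p)"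

definition wk :: "nat \<Rightarrow> tm \<Rightarrow> tm" where
  "wk k t = ren (\<lambda>n. n + k) t"

fun scons :: "tm \<Rightarrow> (nat \<Rightarrow> tm) \<Rightarrow> nat \<Rightarrow> tm" (infixr \<open>\<cdot>\<close> 65) where
  "(a \<cdot> s) 0 = a"
| "(a \<cdot> s) (Suc n) = s n"

definition ups :: "(nat \<Rightarrow> tm) \<Rightarrow> nat \<Rightarrow> tm" where
  "ups s = Var 0 \<cdot> (\<lambda>n. wk 1 (s n))"

primrec sub :: "(nat \<Rightarrow> tm) \<Rightarrow> tm \<Rightarrow> tm" where
  "sub s (Var n) = s n"
| "sub s (Univ i) = Univ i"
| "sub s (Const c) = Const c"
| "sub s (Pi A B) = Pi (sub s A) (sub (ups s) B)"
| "sub s (Lam A b) = Lam (sub s A) (sub (ups s) b)"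
| "sub s (App f a) = App (sub s f) (sub s a)"
| "sub s (Sig A B) = Sig (sub s A) (sub (ups s) B)"
| "sub s (Tup B a b) = Tup (sub (ups s) B) (sub s a) (sub s b)"
| "sub s (SigE C c p) = SigE (sub (ups s) C) (sub (ups (ups s)) c) (sub s p)"
| "sub s EmptyT = EmptyT"
| "sub s (EmptyE C e) = EmptyE (sub (ups s) C) (sub s e)"
| "sub s UnitT = UnitT"
| "sub s Star = Star"
| "sub s (UnitE C c e) = UnitE (sub (ups s) C) (sub s c) (sub s e)"
| "sub s NatT = NatT"
| "sub s Zero = Zero"
| "sub s (Succ n) = Succ (sub s n)"
| "sub s (NatE C z t n) = NatE (sub (ups s) C) (sub s z) (sub (ups (ups s)) t) (sub s n)"
| "sub s (Plus A B) = Plus (sub s A) (sub s B)"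
| "sub s (InL B a) = InL (sub s B) (sub s a)"
| "sub s (InR A b) = InR (sub s A) (sub s b)"
| "sub s (PlusE C c d e) = PlusE (sub (ups s) C) (sub (ups s) c) (sub (ups s) d) (sub s e)"
| "sub s (Eq A a b) = Eq (sub s A) (sub s a) (sub s b)"
| "sub s (Refl a) = Refl (sub s a)"
| "sub s (EqE C d a b p) =
     EqE (sub (ups (ups (ups s))) C) (sub (ups s) d) (sub s a) (sub s b) (sub s p)"

text \<open>
  Substitution for the most recent variable, and substitution for the most recent variable by a
  term that lives in a context with \<open>k\<close> further variables instead.
\<close>

definition inst :: "tm \<Rightarrow> tm \<Rightarrow> tm" (\<open>_\<langle>_\<rangle>\<close> [1000, 0] 1000) where
  "t\<langle>a\<rangle> = sub (a \<cdot> Var) t"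

definition inst_wk :: "nat \<Rightarrow> tm \<Rightarrow> tm \<Rightarrow> tm" where
  "inst_wk k a t = sub (a \<cdot> (\<lambda>n. Var (n + k))) t"


section \<open>Vocabulary inside the type theory\<close>

text \<open>
  The functions below build terms of the object theory; their arguments live in the ambient
  context and are weakened where they pass under binders.
\<close>

definition Arr :: "tm \<Rightarrow> tm \<Rightarrow> tm" where
  "Arr A B = Pi A (wk 1 B)"

definition Times :: "tm \<Rightarrow> tm \<Rightarrow> tm" where
  "Times A B = Sig A (wk 1 B)"

definition Iff :: "tm \<Rightarrow> tm \<Rightarrow> tm" where
  "Iff A B = Times (Arr A B) (Arr B A)"

text \<open>First projection of \<open>p : Sig A B\<close>.\<close>

definition pr1 :: "tm \<Rightarrow> tm \<Rightarrow> tm" where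
  "pr1 A p = SigE (wk 1 A) (Var 1) p"

definition idfun :: "tm \<Rightarrow> tm" where
  "idfun X = Lam X (Var 0)"

text \<open>Composition \<open>g \<circ> f\<close> of \<open>f : X \<rightarrow> Y\<close> and \<open>g : Y \<rightarrow> Z\<close>.\<close>

definition cmp :: "tm \<Rightarrow> tm \<Rightarrow> tm \<Rightarrow> tm" where
  "cmp X g f = Lam X (App (wk 1 g) (App (wk 1 f) (Var 0)))"

text \<open>Pointwise equality of \<open>f, g : X \<rightarrow> Y\<close>.\<close>

definition Htpy :: "tm \<Rightarrow> tm \<Rightarrow> tm \<Rightarrow> tm \<Rightarrow> tm" where
  "Htpy X Y f g = Pi X (Eq (wk 1 Y) (App (wk 1 f) (Var 0)) (App (wk 1 g) (Var 0)))"

definition isContr :: "tm \<Rightarrow> tm" where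
  "isContr A = Sig A (Pi (wk 1 A) (Eq (wk 2 A) (Var 1) (Var 0)))"

definition isProp :: "tm \<Rightarrow> tm" where
  "isProp A = Pi A (Pi (wk 1 A) (Eq (wk 2 A) (Var 1) (Var 0)))"

definition fib :: "tm \<Rightarrow> tm \<Rightarrow> tm \<Rightarrow> tm \<Rightarrow> tm" where
  "fib X Y f y = Sig X (Eq (wk 1 Y) (App (wk 1 f) (Var 0)) (wk 1 y))"

definition fibTup :: "tm \<Rightarrow> tm \<Rightarrow> tm \<Rightarrow> tm \<Rightarrow> tm \<Rightarrow> tm" where
  "fibTup Y f y x p = Tup (Eq (wk 1 Y) (App (wk 1 f) (Var 0)) (wk 1 y)) x p"

definition isEmb :: "tm \<Rightarrow> tm \<Rightarrow> tm \<Rightarrow> tm" where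
  "isEmb X Y f = Pi Y (isProp (fib (wk 1 X) (wk 1 Y) (wk 1 f) (Var 0)))"

definition Emb :: "tm \<Rightarrow> tm \<Rightarrow> tm" where
  "Emb X Y = Sig (Arr X Y) (isEmb (wk 1 X) (wk 1 Y) (Var 0))"

definition isEquiv :: "tm \<Rightarrow> tm \<Rightarrow> tm \<Rightarrow> tm" where
  "isEquiv X Y f = Pi Y (isContr (fib (wk 1 X) (wk 1 Y) (wk 1 f) (Var 0)))"

definition Equiv :: "tm \<Rightarrow> tm \<Rightarrow> tm" where
  "Equiv X Y = Sig (Arr X Y) (isEquiv (wk 1 X) (wk 1 Y) (Var 0))"

text \<open>
  The identity equivalence, of type \<open>Equiv X X\<close>.  In the body, the fiber over \<open>y\<close> has centre
  \<open>(y, refl)\<close>, and a point \<open>(x, p)\<close> of it is identified with the centre by induction on \<open>p\<close>.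
\<close>

definition idEquiv :: "tm \<Rightarrow> tm" where
  "idEquiv X =
    (let F = fib (wk 1 X) (wk 1 X) (idfun (wk 1 X)) (Var 0);
         c = fibTup (wk 1 X) (idfun (wk 1 X)) (Var 0) (Var 0) (Refl (Var 0))
     in Tup (isEquiv (wk 1 X) (wk 1 X) (Var 0)) (idfun X)
         (Lam X
           (Tup (Pi (wk 1 F) (Eq (wk 2 F) (Var 1) (Var 0))) c
             (Lam F
               (SigE (Eq (wk 2 F) (wk 2 c) (Var 0))
                 (EqE
                   (Eq (fib (wk 7 X) (wk 7 X) (idfun (wk 7 X)) (Var 1))
                     (fibTup (wk 7 X) (idfun (wk 7 X)) (Var 1) (Var 1) (Refl (Var 1)))
                     (fibTup (wk 7 X) (idfun (wk 7 X)) (Var 1) (Var 2) (Var 0)))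
                   (Refl (fibTup (wk 5 X) (idfun (wk 5 X)) (Var 0) (Var 0) (Refl (Var 0))))
                   (Var 1) (Var 3) (Var 0))
                 (Var 0))))))"

text \<open>The canonical map from \<open>X = Y\<close> to \<open>Equiv X Y\<close>, for \<open>X, Y : Univ i\<close>.\<close>

definition idtoequiv :: "nat \<Rightarrow> tm \<Rightarrow> tm \<Rightarrow> tm" where
  "idtoequiv i X Y =
    Lam (Eq (Univ i) X Y)
      (EqE (Equiv (Var 2) (Var 1)) (idEquiv (Var 0)) (wk 1 X) (wk 1 Y) (Var 0))"

text \<open>
  \<open>isTrunc i m X\<close> says that \<open>X : Univ i\<close> is an \<open>(m - 2)\<close>-type, for a term \<open>m : NatT\<close>.  It is defined
  by recursion inside the object theory, and \<open>m = 0\<close> is the case of the \<open>(-2)\<close>-types.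
\<close>

definition isTrunc :: "nat \<Rightarrow> tm \<Rightarrow> tm \<Rightarrow> tm" where
  "isTrunc i m X =
    App
      (NatE (Arr (Univ i) (Univ i))
        (Lam (Univ i) (isContr (Var 0)))
        (Lam (Univ i) (Pi (Var 0) (Pi (Var 1) (App (Var 3) (Eq (Var 2) (Var 1) (Var 0))))))
        m)
      X"

definition TruncatedTypes :: "nat \<Rightarrow> tm \<Rightarrow> tm" where
  "TruncatedTypes i m = Sig (Univ i) (isTrunc i (wk 1 m) (Var 0))"

text \<open>
  \<open>A\<close> is a retract of \<open>B\<close>: in the body, variable 1 is the section and variable 0 the retraction.
\<close>

definition Retract :: "tm \<Rightarrow> tm \<Rightarrow> tm" where
  "Retract A B =
    Sig (Arr A B) (Sig (Arr (wk 1 B) (wk 1 A))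
      (Htpy (wk 2 A) (wk 2 A) (cmp (wk 2 A) (Var 0) (Var 1)) (idfun (wk 2 A))))"

text \<open>Algebraic injectivity of \<open>D\<close>: the bound variables are \<open>X\<close>, \<open>Y\<close>, \<open>j\<close>, \<open>f\<close> and \<open>g\<close>.\<close>

definition AInj :: "nat \<Rightarrow> nat \<Rightarrow> tm \<Rightarrow> tm" where
  "AInj i j D =
    Pi (Univ i) (Pi (Univ j) (Pi (Emb (Var 1) (Var 0)) (Pi (Arr (Var 2) (wk 3 D))
      (Sig (Arr (Var 2) (wk 4 D))
        (Htpy (Var 4) (wk 5 D)
          (cmp (Var 4) (Var 0) (pr1 (Arr (Var 4) (Var 3)) (Var 2)))
          (Var 1))))))"


section \<open>The assumed constants\<close>

fun const_type :: "const \<Rightarrow> tm" where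
  "const_type (UA i) =
     Pi (Univ i) (Pi (Univ i)
       (isEquiv (Eq (Univ i) (Var 1) (Var 0)) (Equiv (Var 1) (Var 0))
         (idtoequiv i (Var 1) (Var 0))))"
| "const_type (Trunc i) = Arr (Univ i) (Univ i)"
| "const_type (TruncIn i) = Pi (Univ i) (Arr (Var 0) (App (Const (Trunc i)) (Var 0)))"
| "const_type (TruncProp i) = Pi (Univ i) (isProp (App (Const (Trunc i)) (Var 0)))"
| "const_type (TruncRec i j) =
     Pi (Univ i) (Pi (Univ j) (Arr (isProp (Var 0)) (Arr (Arr (Var 1) (Var 0))
       (Arr (App (Const (Trunc i)) (Var 1)) (Var 0)))))"
| "const_type (Resize i j) =
     Pi (Univ i) (Arr (isProp (Var 0)) (Sig (Univ j) (Equiv (Var 0) (Var 1))))"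

definition univalence :: "const set" where
  "univalence = range UA"

definition propositional_truncations :: "const set" where
  "propositional_truncations =
    range Trunc \<union> range TruncIn \<union> range TruncProp \<union> {TruncRec i j | i j. True}"

definition propositional_resizing :: "const set" where
  "propositional_resizing = {Resize i j | i j. True}"


section \<open>Judgements\<close>

text \<open>
  The parameter \<open>S\<close> is the set of assumed constants.  Contexts are lists whose head is the most
  recently introduced variable.  Being a type means being an element of some \<open>Univ i\<close>;
  \<open>S \<parallel> \<Gamma> \<turnstile>\<close> says that \<open>\<Gamma>\<close> is a well-formed context.
\<close>

inductive
  ctx :: "const set \<Rightarrow> tm list \<Rightarrow> bool" (\<open>_ \<parallel> _ \<turnstile>\<close> [51, 51] 50) and
  typing :: "const set \<Rightarrow> tm list \<Rightarrow> tm \<Rightarrow> tm \<Rightarrow> bool"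
    (\<open>_ \<parallel> _ \<turnstile> _ \<Ztypecolon> _\<close> [51, 51, 51, 51] 50) and
  jeq :: "const set \<Rightarrow> tm list \<Rightarrow> tm \<Rightarrow> tm \<Rightarrow> tm \<Rightarrow> bool"
    (\<open>_ \<parallel> _ \<turnstile> _ \<simeq> _ \<Ztypecolon> _\<close> [51, 51, 51, 51, 51] 50)
  for S :: "const set"
where
  ctx_nil: "S \<parallel> [] \<turnstile>"
| ctx_cons: "\<lbrakk>S \<parallel> \<Gamma> \<turnstile>; S \<parallel> \<Gamma> \<turnstile> A \<Ztypecolon> Univ i\<rbrakk> \<Longrightarrow> S \<parallel> A # \<Gamma> \<turnstile>"

| ty_conv: "\<lbrakk>S \<parallel> \<Gamma> \<turnstile> a \<Ztypecolon> A; S \<parallel> \<Gamma> \<turnstile> A \<simeq> B \<Ztypecolon> Univ i\<rbrakk> \<Longrightarrow> S \<parallel> \<Gamma> \<turnstile> a \<Ztypecolon> B"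
| ty_Var: "\<lbrakk>S \<parallel> \<Gamma> \<turnstile>; n < length \<Gamma>\<rbrakk> \<Longrightarrow> S \<parallel> \<Gamma> \<turnstile> Var n \<Ztypecolon> wk (Suc n) (\<Gamma> ! n)"
| ty_Univ: "S \<parallel> \<Gamma> \<turnstile> \<Longrightarrow> S \<parallel> \<Gamma> \<turnstile> Univ i \<Ztypecolon> Univ (Suc i)"
| ty_Const: "\<lbrakk>c \<in> S; S \<parallel> \<Gamma> \<turnstile> const_type c \<Ztypecolon> Univ i\<rbrakk> \<Longrightarrow> S \<parallel> \<Gamma> \<turnstile> Const c \<Ztypecolon> const_type c"

| ty_Pi: "\<lbrakk>S \<parallel> \<Gamma> \<turnstile> A \<Ztypecolon> Univ i; S \<parallel> A # \<Gamma> \<turnstile> B \<Ztypecolon> Univ j\<rbrakk> \<Longrightarrow> S \<parallel> \<Gamma> \<turnstile> Pi A B \<Ztypecolon> Univ (max i j)"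
| ty_Lam: "\<lbrakk>S \<parallel> \<Gamma> \<turnstile> A \<Ztypecolon> Univ i; S \<parallel> A # \<Gamma> \<turnstile> b \<Ztypecolon> B\<rbrakk> \<Longrightarrow> S \<parallel> \<Gamma> \<turnstile> Lam A b \<Ztypecolon> Pi A B"
| ty_App: "\<lbrakk>S \<parallel> \<Gamma> \<turnstile> f \<Ztypecolon> Pi A B; S \<parallel> \<Gamma> \<turnstile> a \<Ztypecolon> A\<rbrakk> \<Longrightarrow> S \<parallel> \<Gamma> \<turnstile> App f a \<Ztypecolon> B\<langle>a\<rangle>"

| ty_Sig: "\<lbrakk>S \<parallel> \<Gamma> \<turnstile> A \<Ztypecolon> Univ i; S \<parallel> A # \<Gamma> \<turnstile> B \<Ztypecolon> Univ j\<rbrakk> \<Longrightarrow> S \<parallel> \<Gamma> \<turnstile> Sig A B \<Ztypecolon> Univ (max i j)"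
| ty_Tup: "\<lbrakk>S \<parallel> A # \<Gamma> \<turnstile> B \<Ztypecolon> Univ j; S \<parallel> \<Gamma> \<turnstile> a \<Ztypecolon> A; S \<parallel> \<Gamma> \<turnstile> b \<Ztypecolon> B\<langle>a\<rangle>\<rbrakk>
    \<Longrightarrow> S \<parallel> \<Gamma> \<turnstile> Tup B a b \<Ztypecolon> Sig A B"
| ty_SigE: "\<lbrakk>S \<parallel> Sig A B # \<Gamma> \<turnstile> C \<Ztypecolon> Univ k;
     S \<parallel> B # A # \<Gamma> \<turnstile> c \<Ztypecolon> inst_wk 2 (Tup (ren (upr (\<lambda>n. n + 2)) B) (Var 1) (Var 0)) C;
     S \<parallel> \<Gamma> \<turnstile> p \<Ztypecolon> Sig A B\<rbrakk> \<Longrightarrow> S \<parallel> \<Gamma> \<turnstile> SigE C c p \<Ztypecolon> C\<langle>p\<rangle>"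

| ty_EmptyT: "S \<parallel> \<Gamma> \<turnstile> \<Longrightarrow> S \<parallel> \<Gamma> \<turnstile> EmptyT \<Ztypecolon> Univ 0"
| ty_EmptyE: "\<lbrakk>S \<parallel> EmptyT # \<Gamma> \<turnstile> C \<Ztypecolon> Univ k; S \<parallel> \<Gamma> \<turnstile> e \<Ztypecolon> EmptyT\<rbrakk> \<Longrightarrow> S \<parallel> \<Gamma> \<turnstile> EmptyE C e \<Ztypecolon> C\<langle>e\<rangle>"

| ty_UnitT: "S \<parallel> \<Gamma> \<turnstile> \<Longrightarrow> S \<parallel> \<Gamma> \<turnstile> UnitT \<Ztypecolon> Univ 0"
| ty_Star: "S \<parallel> \<Gamma> \<turnstile> \<Longrightarrow> S \<parallel> \<Gamma> \<turnstile> Star \<Ztypecolon> UnitT"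
| ty_UnitE: "\<lbrakk>S \<parallel> UnitT # \<Gamma> \<turnstile> C \<Ztypecolon> Univ k; S \<parallel> \<Gamma> \<turnstile> c \<Ztypecolon> C\<langle>Star\<rangle>; S \<parallel> \<Gamma> \<turnstile> e \<Ztypecolon> UnitT\<rbrakk>
    \<Longrightarrow> S \<parallel> \<Gamma> \<turnstile> UnitE C c e \<Ztypecolon> C\<langle>e\<rangle>"

| ty_NatT: "S \<parallel> \<Gamma> \<turnstile> \<Longrightarrow> S \<parallel> \<Gamma> \<turnstile> NatT \<Ztypecolon> Univ 0"
| ty_Zero: "S \<parallel> \<Gamma> \<turnstile> \<Longrightarrow> S \<parallel> \<Gamma> \<turnstile> Zero \<Ztypecolon> NatT"
| ty_Succ: "S \<parallel> \<Gamma> \<turnstile> n \<Ztypecolon> NatT \<Longrightarrow> S \<parallel> \<Gamma> \<turnstile> Succ n \<Ztypecolon> NatT"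
| ty_NatE: "\<lbrakk>S \<parallel> NatT # \<Gamma> \<turnstile> C \<Ztypecolon> Univ k; S \<parallel> \<Gamma> \<turnstile> z \<Ztypecolon> C\<langle>Zero\<rangle>;
     S \<parallel> C # NatT # \<Gamma> \<turnstile> s \<Ztypecolon> inst_wk 2 (Succ (Var 1)) C; S \<parallel> \<Gamma> \<turnstile> n \<Ztypecolon> NatT\<rbrakk>
    \<Longrightarrow> S \<parallel> \<Gamma> \<turnstile> NatE C z s n \<Ztypecolon> C\<langle>n\<rangle>"

| ty_Plus: "\<lbrakk>S \<parallel> \<Gamma> \<turnstile> A \<Ztypecolon> Univ i; S \<parallel> \<Gamma> \<turnstile> B \<Ztypecolon> Univ j\<rbrakk> \<Longrightarrow> S \<parallel> \<Gamma> \<turnstile> Plus A B \<Ztypecolon> Univ (max i j)"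
| ty_InL: "\<lbrakk>S \<parallel> \<Gamma> \<turnstile> a \<Ztypecolon> A; S \<parallel> \<Gamma> \<turnstile> B \<Ztypecolon> Univ j\<rbrakk> \<Longrightarrow> S \<parallel> \<Gamma> \<turnstile> InL B a \<Ztypecolon> Plus A B"
| ty_InR: "\<lbrakk>S \<parallel> \<Gamma> \<turnstile> A \<Ztypecolon> Univ i; S \<parallel> \<Gamma> \<turnstile> b \<Ztypecolon> B\<rbrakk> \<Longrightarrow> S \<parallel> \<Gamma> \<turnstile> InR A b \<Ztypecolon> Plus A B"
| ty_PlusE: "\<lbrakk>S \<parallel> Plus A B # \<Gamma> \<turnstile> C \<Ztypecolon> Univ k;
     S \<parallel> A # \<Gamma> \<turnstile> c \<Ztypecolon> inst_wk 1 (InL (wk 1 B) (Var 0)) C;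
     S \<parallel> B # \<Gamma> \<turnstile> d \<Ztypecolon> inst_wk 1 (InR (wk 1 A) (Var 0)) C;
     S \<parallel> \<Gamma> \<turnstile> e \<Ztypecolon> Plus A B\<rbrakk> \<Longrightarrow> S \<parallel> \<Gamma> \<turnstile> PlusE C c d e \<Ztypecolon> C\<langle>e\<rangle>"

| ty_Eq: "\<lbrakk>S \<parallel> \<Gamma> \<turnstile> A \<Ztypecolon> Univ i; S \<parallel> \<Gamma> \<turnstile> a \<Ztypecolon> A; S \<parallel> \<Gamma> \<turnstile> b \<Ztypecolon> A\<rbrakk> \<Longrightarrow> S \<parallel> \<Gamma> \<turnstile> Eq A a b \<Ztypecolon> Univ i"
| ty_Refl: "S \<parallel> \<Gamma> \<turnstile> a \<Ztypecolon> A \<Longrightarrow> S \<parallel> \<Gamma> \<turnstile> Refl a \<Ztypecolon> Eq A a a"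
| ty_EqE: "\<lbrakk>S \<parallel> Eq (wk 2 A) (Var 1) (Var 0) # wk 1 A # A # \<Gamma> \<turnstile> C \<Ztypecolon> Univ k;
     S \<parallel> A # \<Gamma> \<turnstile> d \<Ztypecolon> sub (Refl (Var 0) \<cdot> Var 0 \<cdot> Var 0 \<cdot> (\<lambda>n. Var (n + 1))) C;
     S \<parallel> \<Gamma> \<turnstile> a \<Ztypecolon> A; S \<parallel> \<Gamma> \<turnstile> b \<Ztypecolon> A; S \<parallel> \<Gamma> \<turnstile> p \<Ztypecolon> Eq A a b\<rbrakk>
    \<Longrightarrow> S \<parallel> \<Gamma> \<turnstile> EqE C d a b p \<Ztypecolon> sub (p \<cdot> b \<cdot> a \<cdot> Var) C"

| eq_refl: "S \<parallel> \<Gamma> \<turnstile> a \<Ztypecolon> A \<Longrightarrow> S \<parallel> \<Gamma> \<turnstile> a \<simeq> a \<Ztypecolon> A"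
| eq_sym: "S \<parallel> \<Gamma> \<turnstile> a \<simeq> b \<Ztypecolon> A \<Longrightarrow> S \<parallel> \<Gamma> \<turnstile> b \<simeq> a \<Ztypecolon> A"
| eq_trans: "\<lbrakk>S \<parallel> \<Gamma> \<turnstile> a \<simeq> b \<Ztypecolon> A; S \<parallel> \<Gamma> \<turnstile> b \<simeq> c \<Ztypecolon> A\<rbrakk> \<Longrightarrow> S \<parallel> \<Gamma> \<turnstile> a \<simeq> c \<Ztypecolon> A"
| eq_conv: "\<lbrakk>S \<parallel> \<Gamma> \<turnstile> a \<simeq> b \<Ztypecolon> A; S \<parallel> \<Gamma> \<turnstile> A \<simeq> B \<Ztypecolon> Univ i\<rbrakk> \<Longrightarrow> S \<parallel> \<Gamma> \<turnstile> a \<simeq> b \<Ztypecolon> B"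

| beta_Pi: "\<lbrakk>S \<parallel> A # \<Gamma> \<turnstile> b \<Ztypecolon> B; S \<parallel> \<Gamma> \<turnstile> a \<Ztypecolon> A\<rbrakk> \<Longrightarrow> S \<parallel> \<Gamma> \<turnstile> App (Lam A b) a \<simeq> b\<langle>a\<rangle> \<Ztypecolon> B\<langle>a\<rangle>"
| eta_Pi: "S \<parallel> \<Gamma> \<turnstile> f \<Ztypecolon> Pi A B \<Longrightarrow> S \<parallel> \<Gamma> \<turnstile> f \<simeq> Lam A (App (wk 1 f) (Var 0)) \<Ztypecolon> Pi A B"
| beta_Sig: "\<lbrakk>S \<parallel> Sig A B # \<Gamma> \<turnstile> C \<Ztypecolon> Univ k;
     S \<parallel> B # A # \<Gamma> \<turnstile> c \<Ztypecolon> inst_wk 2 (Tup (ren (upr (\<lambda>n. n + 2)) B) (Var 1) (Var 0)) C;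
     S \<parallel> \<Gamma> \<turnstile> a \<Ztypecolon> A; S \<parallel> \<Gamma> \<turnstile> b \<Ztypecolon> B\<langle>a\<rangle>\<rbrakk>
    \<Longrightarrow> S \<parallel> \<Gamma> \<turnstile> SigE C c (Tup B a b) \<simeq> sub (b \<cdot> a \<cdot> Var) c \<Ztypecolon> C\<langle>Tup B a b\<rangle>"
| beta_Unit: "\<lbrakk>S \<parallel> UnitT # \<Gamma> \<turnstile> C \<Ztypecolon> Univ k; S \<parallel> \<Gamma> \<turnstile> c \<Ztypecolon> C\<langle>Star\<rangle>\<rbrakk>
    \<Longrightarrow> S \<parallel> \<Gamma> \<turnstile> UnitE C c Star \<simeq> c \<Ztypecolon> C\<langle>Star\<rangle>"
| beta_Zero: "\<lbrakk>S \<parallel> NatT # \<Gamma> \<turnstile> C \<Ztypecolon> Univ k; S \<parallel> \<Gamma> \<turnstile> z \<Ztypecolon> C\<langle>Zero\<rangle>;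
     S \<parallel> C # NatT # \<Gamma> \<turnstile> s \<Ztypecolon> inst_wk 2 (Succ (Var 1)) C\<rbrakk>
    \<Longrightarrow> S \<parallel> \<Gamma> \<turnstile> NatE C z s Zero \<simeq> z \<Ztypecolon> C\<langle>Zero\<rangle>"
| beta_Succ: "\<lbrakk>S \<parallel> NatT # \<Gamma> \<turnstile> C \<Ztypecolon> Univ k; S \<parallel> \<Gamma> \<turnstile> z \<Ztypecolon> C\<langle>Zero\<rangle>;
     S \<parallel> C # NatT # \<Gamma> \<turnstile> s \<Ztypecolon> inst_wk 2 (Succ (Var 1)) C; S \<parallel> \<Gamma> \<turnstile> n \<Ztypecolon> NatT\<rbrakk>
    \<Longrightarrow> S \<parallel> \<Gamma> \<turnstile> NatE C z s (Succ n) \<simeq> sub (NatE C z s n \<cdot> n \<cdot> Var) s \<Ztypecolon> C\<langle>Succ n\<rangle>"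
| beta_InL: "\<lbrakk>S \<parallel> Plus A B # \<Gamma> \<turnstile> C \<Ztypecolon> Univ k;
     S \<parallel> A # \<Gamma> \<turnstile> c \<Ztypecolon> inst_wk 1 (InL (wk 1 B) (Var 0)) C;
     S \<parallel> B # \<Gamma> \<turnstile> d \<Ztypecolon> inst_wk 1 (InR (wk 1 A) (Var 0)) C;
     S \<parallel> \<Gamma> \<turnstile> a \<Ztypecolon> A\<rbrakk> \<Longrightarrow> S \<parallel> \<Gamma> \<turnstile> PlusE C c d (InL B a) \<simeq> c\<langle>a\<rangle> \<Ztypecolon> C\<langle>InL B a\<rangle>"
| beta_InR: "\<lbrakk>S \<parallel> Plus A B # \<Gamma> \<turnstile> C \<Ztypecolon> Univ k;
     S \<parallel> A # \<Gamma> \<turnstile> c \<Ztypecolon> inst_wk 1 (InL (wk 1 B) (Var 0)) C;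
     S \<parallel> B # \<Gamma> \<turnstile> d \<Ztypecolon> inst_wk 1 (InR (wk 1 A) (Var 0)) C;
     S \<parallel> \<Gamma> \<turnstile> b \<Ztypecolon> B\<rbrakk> \<Longrightarrow> S \<parallel> \<Gamma> \<turnstile> PlusE C c d (InR A b) \<simeq> d\<langle>b\<rangle> \<Ztypecolon> C\<langle>InR A b\<rangle>"
| beta_Eq: "\<lbrakk>S \<parallel> Eq (wk 2 A) (Var 1) (Var 0) # wk 1 A # A # \<Gamma> \<turnstile> C \<Ztypecolon> Univ k;
     S \<parallel> A # \<Gamma> \<turnstile> d \<Ztypecolon> sub (Refl (Var 0) \<cdot> Var 0 \<cdot> Var 0 \<cdot> (\<lambda>n. Var (n + 1))) C;
     S \<parallel> \<Gamma> \<turnstile> a \<Ztypecolon> A\<rbrakk>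
    \<Longrightarrow> S \<parallel> \<Gamma> \<turnstile> EqE C d a a (Refl a) \<simeq> d\<langle>a\<rangle> \<Ztypecolon> sub (Refl a \<cdot> a \<cdot> a \<cdot> Var) C"

| cong_Pi: "\<lbrakk>S \<parallel> \<Gamma> \<turnstile> A \<simeq> A' \<Ztypecolon> Univ i; S \<parallel> A # \<Gamma> \<turnstile> B \<simeq> B' \<Ztypecolon> Univ j\<rbrakk>
    \<Longrightarrow> S \<parallel> \<Gamma> \<turnstile> Pi A B \<simeq> Pi A' B' \<Ztypecolon> Univ (max i j)"
| cong_Lam: "\<lbrakk>S \<parallel> \<Gamma> \<turnstile> A \<simeq> A' \<Ztypecolon> Univ i; S \<parallel> A # \<Gamma> \<turnstile> b \<simeq> b' \<Ztypecolon> B\<rbrakk>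
    \<Longrightarrow> S \<parallel> \<Gamma> \<turnstile> Lam A b \<simeq> Lam A' b' \<Ztypecolon> Pi A B"
| cong_App: "\<lbrakk>S \<parallel> \<Gamma> \<turnstile> f \<simeq> f' \<Ztypecolon> Pi A B; S \<parallel> \<Gamma> \<turnstile> a \<simeq> a' \<Ztypecolon> A\<rbrakk>
    \<Longrightarrow> S \<parallel> \<Gamma> \<turnstile> App f a \<simeq> App f' a' \<Ztypecolon> B\<langle>a\<rangle>"
| cong_Sig: "\<lbrakk>S \<parallel> \<Gamma> \<turnstile> A \<simeq> A' \<Ztypecolon> Univ i; S \<parallel> A # \<Gamma> \<turnstile> B \<simeq> B' \<Ztypecolon> Univ j\<rbrakk>
    \<Longrightarrow> S \<parallel> \<Gamma> \<turnstile> Sig A B \<simeq> Sig A' B' \<Ztypecolon> Univ (max i j)"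
| cong_Tup: "\<lbrakk>S \<parallel> A # \<Gamma> \<turnstile> B \<simeq> B' \<Ztypecolon> Univ j; S \<parallel> \<Gamma> \<turnstile> a \<simeq> a' \<Ztypecolon> A; S \<parallel> \<Gamma> \<turnstile> b \<simeq> b' \<Ztypecolon> B\<langle>a\<rangle>\<rbrakk>
    \<Longrightarrow> S \<parallel> \<Gamma> \<turnstile> Tup B a b \<simeq> Tup B' a' b' \<Ztypecolon> Sig A B"
| cong_SigE: "\<lbrakk>S \<parallel> Sig A B # \<Gamma> \<turnstile> C \<simeq> C' \<Ztypecolon> Univ k;
     S \<parallel> B # A # \<Gamma> \<turnstile> c \<simeq> c' \<Ztypecolon> inst_wk 2 (Tup (ren (upr (\<lambda>n. n + 2)) B) (Var 1) (Var 0)) C;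
     S \<parallel> \<Gamma> \<turnstile> p \<simeq> p' \<Ztypecolon> Sig A B\<rbrakk> \<Longrightarrow> S \<parallel> \<Gamma> \<turnstile> SigE C c p \<simeq> SigE C' c' p' \<Ztypecolon> C\<langle>p\<rangle>"
| cong_EmptyE: "\<lbrakk>S \<parallel> EmptyT # \<Gamma> \<turnstile> C \<simeq> C' \<Ztypecolon> Univ k; S \<parallel> \<Gamma> \<turnstile> e \<simeq> e' \<Ztypecolon> EmptyT\<rbrakk>
    \<Longrightarrow> S \<parallel> \<Gamma> \<turnstile> EmptyE C e \<simeq> EmptyE C' e' \<Ztypecolon> C\<langle>e\<rangle>"
| cong_UnitE: "\<lbrakk>S \<parallel> UnitT # \<Gamma> \<turnstile> C \<simeq> C' \<Ztypecolon> Univ k; S \<parallel> \<Gamma> \<turnstile> c \<simeq> c' \<Ztypecolon> C\<langle>Star\<rangle>;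
     S \<parallel> \<Gamma> \<turnstile> e \<simeq> e' \<Ztypecolon> UnitT\<rbrakk> \<Longrightarrow> S \<parallel> \<Gamma> \<turnstile> UnitE C c e \<simeq> UnitE C' c' e' \<Ztypecolon> C\<langle>e\<rangle>"
| cong_Succ: "S \<parallel> \<Gamma> \<turnstile> n \<simeq> n' \<Ztypecolon> NatT \<Longrightarrow> S \<parallel> \<Gamma> \<turnstile> Succ n \<simeq> Succ n' \<Ztypecolon> NatT"
| cong_NatE: "\<lbrakk>S \<parallel> NatT # \<Gamma> \<turnstile> C \<simeq> C' \<Ztypecolon> Univ k; S \<parallel> \<Gamma> \<turnstile> z \<simeq> z' \<Ztypecolon> C\<langle>Zero\<rangle>;
     S \<parallel> C # NatT # \<Gamma> \<turnstile> s \<simeq> s' \<Ztypecolon> inst_wk 2 (Succ (Var 1)) C; S \<parallel> \<Gamma> \<turnstile> n \<simeq> n' \<Ztypecolon> NatT\<rbrakk>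
    \<Longrightarrow> S \<parallel> \<Gamma> \<turnstile> NatE C z s n \<simeq> NatE C' z' s' n' \<Ztypecolon> C\<langle>n\<rangle>"
| cong_Plus: "\<lbrakk>S \<parallel> \<Gamma> \<turnstile> A \<simeq> A' \<Ztypecolon> Univ i; S \<parallel> \<Gamma> \<turnstile> B \<simeq> B' \<Ztypecolon> Univ j\<rbrakk>
    \<Longrightarrow> S \<parallel> \<Gamma> \<turnstile> Plus A B \<simeq> Plus A' B' \<Ztypecolon> Univ (max i j)"
| cong_InL: "\<lbrakk>S \<parallel> \<Gamma> \<turnstile> a \<simeq> a' \<Ztypecolon> A; S \<parallel> \<Gamma> \<turnstile> B \<simeq> B' \<Ztypecolon> Univ j\<rbrakk>
    \<Longrightarrow> S \<parallel> \<Gamma> \<turnstile> InL B a \<simeq> InL B' a' \<Ztypecolon> Plus A B"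
| cong_InR: "\<lbrakk>S \<parallel> \<Gamma> \<turnstile> A \<simeq> A' \<Ztypecolon> Univ i; S \<parallel> \<Gamma> \<turnstile> b \<simeq> b' \<Ztypecolon> B\<rbrakk>
    \<Longrightarrow> S \<parallel> \<Gamma> \<turnstile> InR A b \<simeq> InR A' b' \<Ztypecolon> Plus A B"
| cong_PlusE: "\<lbrakk>S \<parallel> Plus A B # \<Gamma> \<turnstile> C \<simeq> C' \<Ztypecolon> Univ k;
     S \<parallel> A # \<Gamma> \<turnstile> c \<simeq> c' \<Ztypecolon> inst_wk 1 (InL (wk 1 B) (Var 0)) C;
     S \<parallel> B # \<Gamma> \<turnstile> d \<simeq> d' \<Ztypecolon> inst_wk 1 (InR (wk 1 A) (Var 0)) C;
     S \<parallel> \<Gamma> \<turnstile> e \<simeq> e' \<Ztypecolon> Plus A B\<rbrakk> \<Longrightarrow> S \<parallel> \<Gamma> \<turnstile> PlusE C c d e \<simeq> PlusE C' c' d' e' \<Ztypecolon> C\<langle>e\<rangle>"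
| cong_Eq: "\<lbrakk>S \<parallel> \<Gamma> \<turnstile> A \<simeq> A' \<Ztypecolon> Univ i; S \<parallel> \<Gamma> \<turnstile> a \<simeq> a' \<Ztypecolon> A; S \<parallel> \<Gamma> \<turnstile> b \<simeq> b' \<Ztypecolon> A\<rbrakk>
    \<Longrightarrow> S \<parallel> \<Gamma> \<turnstile> Eq A a b \<simeq> Eq A' a' b' \<Ztypecolon> Univ i"
| cong_Refl: "S \<parallel> \<Gamma> \<turnstile> a \<simeq> a' \<Ztypecolon> A \<Longrightarrow> S \<parallel> \<Gamma> \<turnstile> Refl a \<simeq> Refl a' \<Ztypecolon> Eq A a a"
| cong_EqE: "\<lbrakk>S \<parallel> Eq (wk 2 A) (Var 1) (Var 0) # wk 1 A # A # \<Gamma> \<turnstile> C \<simeq> C' \<Ztypecolon> Univ k;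
     S \<parallel> A # \<Gamma> \<turnstile> d \<simeq> d' \<Ztypecolon> sub (Refl (Var 0) \<cdot> Var 0 \<cdot> Var 0 \<cdot> (\<lambda>n. Var (n + 1))) C;
     S \<parallel> \<Gamma> \<turnstile> a \<simeq> a' \<Ztypecolon> A; S \<parallel> \<Gamma> \<turnstile> b \<simeq> b' \<Ztypecolon> A; S \<parallel> \<Gamma> \<turnstile> p \<simeq> p' \<Ztypecolon> Eq A a b\<rbrakk>
    \<Longrightarrow> S \<parallel> \<Gamma> \<turnstile> EqE C d a b p \<simeq> EqE C' d' a' b' p' \<Ztypecolon> sub (p \<cdot> b \<cdot> a \<cdot> Var) C"

end

theory Submission
  imports Defs "HOL-Library.Monad_Syntax"
begin

text \<open>
  Left to right: let \<open>D\<close> be injective and an \<open>(n+1)\<close>-type, and take \<open>X = D\<close>.  The section sends \<open>d\<close> to the family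
  \<open>x \<mapsto> (d = x)\<close> of \<open>n\<close>-types.  For a family \<open>\<phi>\<close>, the type \<open>Q = isContr (\<Sigma> x. \<phi> x)\<close> is a proposition of the same
  universe, and taking centres is a map \<open>Q \<rightarrow> D\<close>; the retraction sends \<open>\<phi>\<close> to the value at the identity of an
  extension of this map along the embedding of \<open>Q\<close> into the contractible type \<open>Q \<rightarrow> Q\<close>.  As \<open>\<Sigma> x. d = x\<close> is
  contractible with centre \<open>d\<close>, the retraction sends the family of \<open>d\<close> back to \<open>d\<close>.

  Right to left: retracts and powers of injective types are injective, so it suffices to extend a family \<open>F\<close>
  of \<open>n\<close>-types on \<open>A\<close> along an embedding \<open>j : A \<rightarrow> B\<close>.  The extension is \<open>b \<mapsto> \<Pi> w : fib j b. F (pr\<^sub>1 w)\<close>; at \<open>j a\<close> it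
  is a product over a proposition with an element over \<open>a\<close>, hence equal to \<open>F a\<close> by univalence.

  The terms that carry out these constructions are certified by a type checker that is sound for the
  judgements and is run by the simplifier.
\<close>

section \<open>Substitution\<close>

text \<open>The universe level \<open>u\<close> is arbitrary, so terms are not checked level by
  level: the checker computes with levels \<open>u + k\<close> for an unspecified \<open>u\<close>,
  and one successful run is a proof at every \<open>u\<close>. Its soundness rests on the
  substitution lemma, inversion of type formers, and the fact that a type respects judgemental
  equality of the terms substituted into it; metatheorems such as unique typing or injectivity of
  \<open>Pi\<close> are avoided. The object proof is cut into lemmas that later terms cite as opaque
  constants. This keeps normal forms small, but a cited proof never computes, which decides where a
  construction is spelled out instead of cited. Function extensionality is not a constant here and
  is derived from univalence. As the universe of truncated types lies one level above the exponent
  and there is no cumulativity, extensionality is also needed across two levels. The index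
  \<open>n\<close> is a variable of the object theory, so every argument about truncation levels is
  an induction carried out inside that theory.\<close>

lemma upr_comp: "upr (r \<circ> s) = upr r \<circ> upr s"
proof
  show "upr (r \<circ> s) n = (upr r \<circ> upr s) n" for n by (cases n) auto
qed

lemma ren_ren: "ren r (ren s t) = ren (r \<circ> s) t"
  by (induction t arbitrary: r s) (simp_all add: upr_comp)

lemma scons_eqI: "\<lbrakk>f 0 = a; \<And>n. f (Suc n) = s n\<rbrakk> \<Longrightarrow> f = a \<cdot> s"
proof
  show "\<lbrakk>f 0 = a; \<And>n. f (Suc n) = s n\<rbrakk> \<Longrightarrow> f n = (a \<cdot> s) n" for n by (cases n) auto
qed

lemma ups_upr: "ups s \<circ> upr r = ups (s \<circ> r)"
  unfolding ups_def by (rule scons_eqI) auto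

lemma sub_ren: "sub s (ren r t) = sub (s \<circ> r) t"
  by (induction t arbitrary: r s) (simp_all add: ups_upr)

lemma ren_ups: "ren (upr r) \<circ> ups s = ups (ren r \<circ> s)"
  unfolding ups_def by (rule scons_eqI) (auto simp: wk_def ren_ren comp_def)

lemma ren_sub: "ren r (sub s t) = sub (ren r \<circ> s) t"
  by (induction t arbitrary: r s) (simp_all add: ren_ups)

lemma sub_ups: "sub (ups s) \<circ> ups t = ups (sub s \<circ> t)"
  unfolding ups_def by (rule scons_eqI) (auto simp: wk_def ren_sub sub_ren comp_def)

lemma sub_sub: "sub s (sub t x) = sub (sub s \<circ> t) x"
  by (induction x arbitrary: s t) (simp_all add: sub_ups)

lemma ups_Var: "ups Var = Var"
  unfolding ups_def by (rule scons_eqI[symmetric]) (auto simp: wk_def)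

lemma sub_Var [simp]: "sub Var t = t"
  by (induction t) (simp_all add: ups_Var)

lemma ren_as_sub: "ren r t = sub (Var \<circ> r) t"
  using sub_ren[of Var r t] by simp

lemma ups_simps [simp]: "ups s 0 = Var 0" "ups s (Suc n) = wk 1 (s n)"
  by (simp_all add: ups_def)

lemma ups_ren: "ups (Var \<circ> r) = Var \<circ> upr r"
proof
  show "ups (Var \<circ> r) n = (Var \<circ> upr r) n" for n by (cases n) (auto simp: wk_def)
qed

lemma sub_cong: "(\<And>n. s n = s' n) \<Longrightarrow> sub s t = sub s' t"
  by (metis ext)

lemma sub_inst: "sub s (t\<langle>a\<rangle>) = (sub (ups s) t)\<langle>sub s a\<rangle>"
  unfolding inst_def sub_sub
proof (rule sub_cong)
  show "(sub s \<circ> a \<cdot> Var) n = (sub (sub s a \<cdot> Var) \<circ> ups s) n" for n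
    by (cases n) (auto simp: wk_def sub_ren comp_def)
qed

lemma sub_wk: "sub s (wk k t) = sub (\<lambda>n. s (n + k)) t"
  by (simp add: wk_def sub_ren comp_def)

lemma wk_sub: "wk k (sub s t) = sub (\<lambda>n. wk k (s n)) t"
  by (simp add: wk_def ren_sub comp_def)

lemma wk_wk: "wk k (wk l t) = wk (l + k) t"
  by (simp add: wk_def ren_ren comp_def add.assoc)

lemma wk_Var [simp]: "wk k (Var n) = Var (n + k)"
  by (simp add: wk_def)

lemma wk_0 [simp]: "wk 0 t = t"
  by (simp add: wk_def ren_as_sub comp_def)

lemma sub_ups_wk1: "sub (ups s) (wk 1 t) = wk 1 (sub s t)"
  by (simp add: sub_wk wk_sub)

lemma sub_ups_wk2: "sub (ups (ups s)) (wk 2 t) = wk 2 (sub s t)"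
  by (simp add: sub_wk wk_sub numeral_2_eq_2 wk_wk)

lemma sub_inst_wk1: "sub (ups s) (inst_wk 1 a t) = inst_wk 1 (sub (ups s) a) (sub (ups s) t)"
  unfolding inst_wk_def sub_sub
proof (rule sub_cong)
  show "(sub (ups s) \<circ> a \<cdot> (\<lambda>n. Var (n + 1))) n =
      (sub (sub (ups s) a \<cdot> (\<lambda>n. Var (n + 1))) \<circ> ups s) n" for n
    by (cases n) (auto simp: sub_wk, auto simp: wk_def ren_as_sub comp_def)
qed

lemma sub_inst_wk2:
  "sub (ups (ups s)) (inst_wk 2 a t) = inst_wk 2 (sub (ups (ups s)) a) (sub (ups s) t)"
  unfolding inst_wk_def sub_sub
proof (rule sub_cong)
  show "(sub (ups (ups s)) \<circ> a \<cdot> (\<lambda>n. Var (n + 2))) n =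
      (sub (sub (ups (ups s)) a \<cdot> (\<lambda>n. Var (n + 2))) \<circ> ups s) n" for n
    by (cases n) (auto simp: sub_wk numeral_2_eq_2 wk_wk, auto simp: wk_def ren_as_sub comp_def)
qed

lemma sub_ups_ren_upr:
  "sub (ups (ups (ups s))) (ren (upr (\<lambda>n. n + 2)) B) = ren (upr (\<lambda>n. n + 2)) (sub (ups s) B)"
  unfolding sub_ren ren_sub
proof (rule sub_cong)
  show "(ups (ups (ups s)) \<circ> upr (\<lambda>n. n + 2)) n = (ren (upr (\<lambda>n. n + 2)) \<circ> ups s) n" for n
    by (cases n) (auto simp: wk_def ren_ren comp_def)
qed

lemma sub_inst2:
  "sub s (sub (b \<cdot> a \<cdot> Var) t) = sub (sub s b \<cdot> sub s a \<cdot> Var) (sub (ups (ups s)) t)"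
  unfolding sub_sub
proof (rule sub_cong)
  show "(sub s \<circ> b \<cdot> a \<cdot> Var) n = (sub (sub s b \<cdot> sub s a \<cdot> Var) \<circ> ups (ups s)) n" for n
    by (cases n; cases "n - 1") (auto simp: sub_wk)
qed

lemma sub_inst3:
  "sub s (sub (p \<cdot> b \<cdot> a \<cdot> Var) t) =
    sub (sub s p \<cdot> sub s b \<cdot> sub s a \<cdot> Var) (sub (ups (ups (ups s))) t)"
  unfolding sub_sub
proof (rule sub_cong)
  show "(sub s \<circ> p \<cdot> b \<cdot> a \<cdot> Var) n =
      (sub (sub s p \<cdot> sub s b \<cdot> sub s a \<cdot> Var) \<circ> ups (ups (ups s))) n" for n
    by (cases n; cases "n - 1"; cases "n - 2") (auto simp: sub_wk)
qed

lemma sub_refl3: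
  "sub (ups s) (sub (Refl (Var 0) \<cdot> Var 0 \<cdot> Var 0 \<cdot> (\<lambda>n. Var (n + 1))) t) =
    sub (Refl (Var 0) \<cdot> Var 0 \<cdot> Var 0 \<cdot> (\<lambda>n. Var (n + 1))) (sub (ups (ups (ups s))) t)"
  unfolding sub_sub
proof (rule sub_cong)
  show "(sub (ups s) \<circ> Refl (Var 0) \<cdot> Var 0 \<cdot> Var 0 \<cdot> (\<lambda>n. Var (n + 1))) n =
      (sub (Refl (Var 0) \<cdot> Var 0 \<cdot> Var 0 \<cdot> (\<lambda>n. Var (n + 1))) \<circ> ups (ups (ups s))) n" for n
    by (cases n; cases "n - 1"; cases "n - 2") (auto simp: sub_wk, auto simp: wk_def ren_as_sub comp_def)
qed

text \<open>Unfolding \<open>sub\<close> alone leaves the bound variables that the eliminator rules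
  mention in these two forms.\<close>

lemma ups_vars: "ups s 0 = Var 0" "ups (ups s) 1 = Var 1"
  by simp_all

text \<open>One equation for each shape of instantiation that occurs in the rules. Rewriting with
  them turns the substituted conclusion of a rule back into an instance of the same rule.\<close>

lemmas sub_push = sub_inst sub_ups_wk1 sub_ups_wk2 sub_inst_wk1 sub_inst_wk2 sub_ups_ren_upr
  sub_inst2 sub_inst3 sub_refl3

lemma sub_const_type [simp]: "sub s (const_type c) = const_type c"
  by (cases c) (simp_all add: Arr_def isProp_def isEquiv_def isContr_def fib_def fibTup_def Equiv_def
    idtoequiv_def idEquiv_def idfun_def Let_def wk_def numeral_eq_Suc)

section \<open>The substitution lemma\<close>

text \<open>The induction on derivations is done once, for any relation \<open>K\<close> that types
  variables and passes under binders. The first instance is renaming, whose extension under a binder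
  is purely syntactic; it yields weakening, which is what the second instance, typed substitution,
  needs in order to pass under binders.\<close>

locale stable =
  fixes S :: "const set" and K :: "tm list \<Rightarrow> (nat \<Rightarrow> tm) \<Rightarrow> tm list \<Rightarrow> bool"
  assumes K_var: "\<lbrakk>K \<Delta> s \<Gamma>; S \<parallel> \<Delta> \<turnstile>; n < length \<Gamma>\<rbrakk> \<Longrightarrow> S \<parallel> \<Delta> \<turnstile> s n \<Ztypecolon> sub s (wk (Suc n) (\<Gamma> ! n))"
    and K_ups: "\<lbrakk>K \<Delta> s \<Gamma>; S \<parallel> sub s A # \<Delta> \<turnstile>\<rbrakk> \<Longrightarrow> K (sub s A # \<Delta>) (ups s) (A # \<Gamma>)"
begin

text \<open>
  Some rules, such as \<open>beta_Pi\<close>, have a premise in an extended context but no premise that types the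
  extension; \<open>okc\<close> carries the missing induction hypothesis.
\<close>

primrec okc :: "tm list \<Rightarrow> bool" where
  "okc [] = True"
| "okc (A # \<Gamma>) = (okc \<Gamma> \<and> (\<forall>\<Delta> s. K \<Delta> s \<Gamma> \<longrightarrow> S \<parallel> \<Delta> \<turnstile> \<longrightarrow> (\<exists>i. S \<parallel> \<Delta> \<turnstile> sub s A \<Ztypecolon> Univ i)))"

definition jty where
  "jty \<Gamma> t T \<longleftrightarrow> okc \<Gamma> \<and> (\<forall>\<Delta> s. K \<Delta> s \<Gamma> \<longrightarrow> S \<parallel> \<Delta> \<turnstile> \<longrightarrow> S \<parallel> \<Delta> \<turnstile> sub s t \<Ztypecolon> sub s T)"

definition jq where
  "jq \<Gamma> t t' T \<longleftrightarrow> okc \<Gamma> \<and>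
    (\<forall>\<Delta> s. K \<Delta> s \<Gamma> \<longrightarrow> S \<parallel> \<Delta> \<turnstile> \<longrightarrow> S \<parallel> \<Delta> \<turnstile> sub s t \<simeq> sub s t' \<Ztypecolon> sub s T)"

lemma jty_D: "\<lbrakk>jty \<Gamma> t T; K \<Delta> s \<Gamma>; S \<parallel> \<Delta> \<turnstile>\<rbrakk> \<Longrightarrow> S \<parallel> \<Delta> \<turnstile> sub s t \<Ztypecolon> sub s T"
  by (simp add: jty_def)

lemma jq_D: "\<lbrakk>jq \<Gamma> t t' T; K \<Delta> s \<Gamma>; S \<parallel> \<Delta> \<turnstile>\<rbrakk> \<Longrightarrow> S \<parallel> \<Delta> \<turnstile> sub s t \<simeq> sub s t' \<Ztypecolon> sub s T"
  by (simp add: jq_def)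

lemma okc_lift: "\<lbrakk>okc (A # \<Gamma>); K \<Delta> s \<Gamma>; S \<parallel> \<Delta> \<turnstile>\<rbrakk> \<Longrightarrow> K (sub s A # \<Delta>) (ups s) (A # \<Gamma>) \<and> S \<parallel> sub s A # \<Delta> \<turnstile>"
  by (metis K_ups ctx_cons okc.simps(2))

lemma jty_lift:
  assumes "jty (A # \<Gamma>) t T" "K \<Delta> s \<Gamma>" "S \<parallel> \<Delta> \<turnstile>"
  shows "S \<parallel> sub s A # \<Delta> \<turnstile> sub (ups s) t \<Ztypecolon> sub (ups s) T"
  using okc_lift[of A \<Gamma> \<Delta> s] assms by (auto simp: jty_def)

lemma jq_lift:
  assumes "jq (A # \<Gamma>) t t' T" "K \<Delta> s \<Gamma>" "S \<parallel> \<Delta> \<turnstile>"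
  shows "S \<parallel> sub s A # \<Delta> \<turnstile> sub (ups s) t \<simeq> sub (ups s) t' \<Ztypecolon> sub (ups s) T"
  using okc_lift[of A \<Gamma> \<Delta> s] assms by (auto simp: jq_def)

lemma jty_lift2:
  assumes "jty (B # A # \<Gamma>) t T" "K \<Delta> s \<Gamma>" "S \<parallel> \<Delta> \<turnstile>"
  shows "S \<parallel> sub (ups s) B # sub s A # \<Delta> \<turnstile> sub (ups (ups s)) t \<Ztypecolon> sub (ups (ups s)) T"
  using okc_lift[of A \<Gamma> \<Delta> s] jty_lift[OF assms(1)] assms by (auto simp: jty_def)

lemma jq_lift2:
  assumes "jq (B # A # \<Gamma>) t t' T" "K \<Delta> s \<Gamma>" "S \<parallel> \<Delta> \<turnstile>"
  shows "S \<parallel> sub (ups s) B # sub s A # \<Delta> \<turnstile>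
    sub (ups (ups s)) t \<simeq> sub (ups (ups s)) t' \<Ztypecolon> sub (ups (ups s)) T"
  using okc_lift[of A \<Gamma> \<Delta> s] jq_lift[OF assms(1)] assms by (auto simp: jq_def)

lemma jty_lift3:
  assumes "jty (C # B # A # \<Gamma>) t T" "K \<Delta> s \<Gamma>" "S \<parallel> \<Delta> \<turnstile>"
  shows "S \<parallel> sub (ups (ups s)) C # sub (ups s) B # sub s A # \<Delta> \<turnstile>
    sub (ups (ups (ups s))) t \<Ztypecolon> sub (ups (ups (ups s))) T"
  using okc_lift[of A \<Gamma> \<Delta> s] jty_lift2[OF assms(1)] assms by (auto simp: jty_def)

lemma jq_lift3:
  assumes "jq (C # B # A # \<Gamma>) t t' T" "K \<Delta> s \<Gamma>" "S \<parallel> \<Delta> \<turnstile>"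
  shows "S \<parallel> sub (ups (ups s)) C # sub (ups s) B # sub s A # \<Delta> \<turnstile>
    sub (ups (ups (ups s))) t \<simeq> sub (ups (ups (ups s))) t' \<Ztypecolon> sub (ups (ups (ups s))) T"
  using okc_lift[of A \<Gamma> \<Delta> s] jq_lift2[OF assms(1)] assms by (auto simp: jq_def)

lemma jtyI: "\<lbrakk>okc \<Gamma>; \<And>\<Delta> s. \<lbrakk>K \<Delta> s \<Gamma>; S \<parallel> \<Delta> \<turnstile>\<rbrakk> \<Longrightarrow> S \<parallel> \<Delta> \<turnstile> sub s t \<Ztypecolon> sub s T\<rbrakk> \<Longrightarrow> jty \<Gamma> t T"
  by (simp add: jty_def)

lemma jqI: "\<lbrakk>okc \<Gamma>; \<And>\<Delta> s. \<lbrakk>K \<Delta> s \<Gamma>; S \<parallel> \<Delta> \<turnstile>\<rbrakk> \<Longrightarrow> S \<parallel> \<Delta> \<turnstile> sub s t \<simeq> sub s t' \<Ztypecolon> sub s T\<rbrakk> \<Longrightarrow> jq \<Gamma> t t' T"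
  by (simp add: jq_def)

lemma jty_okc: "jty \<Gamma> t T \<Longrightarrow> okc \<Gamma>" and jq_okc: "jq \<Gamma> t t' T \<Longrightarrow> okc \<Gamma>"
  by (simp_all add: jty_def jq_def)



text \<open>Conversion, reflexivity, symmetry and transitivity are absent from both lists: their
  conclusions match every judgement, so their cases are treated one by one.\<close>

lemmas struct_ty = ty_Var ty_Univ ty_Const ty_Pi ty_Lam ty_App ty_Sig ty_Tup ty_SigE ty_EmptyT ty_EmptyE
  ty_UnitT ty_Star ty_UnitE ty_NatT ty_Zero ty_Succ ty_NatE ty_Plus ty_InL ty_InR ty_PlusE ty_Eq ty_Refl ty_EqE
lemmas struct_eq = beta_Pi eta_Pi beta_Sig beta_Unit beta_Zero beta_Succ beta_InL beta_InR beta_Eq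
  cong_Pi cong_Lam cong_App cong_Sig cong_Tup cong_SigE cong_EmptyE cong_UnitE cong_Succ cong_NatE
  cong_Plus cong_InL cong_InR cong_PlusE cong_Eq cong_Refl cong_EqE

text \<open>In a structural case the substitution is pushed inward, the rule is applied again, and
  each premise comes from its induction hypothesis, lifted under the variables that the premise
  binds. Three liftings suffice because the motive of \<open>EqE\<close> binds the most
  variables.\<close>

lemma substitution_gen:
  "S \<parallel> \<Gamma> \<turnstile> \<Longrightarrow> okc \<Gamma>"
  "S \<parallel> \<Gamma> \<turnstile> t \<Ztypecolon> T \<Longrightarrow> jty \<Gamma> t T"
  "S \<parallel> \<Gamma> \<turnstile> t \<simeq> t' \<Ztypecolon> T \<Longrightarrow> jq \<Gamma> t t' T"
  apply (induction rule: ctx_typing_jeq.inducts)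
  apply simp
  apply (auto simp: jty_def)[1]
  apply (rule jtyI, erule jty_okc, rule ty_conv, erule (2) jty_D, drule (2) jq_D, simp)
  apply (rule jtyI, assumption, simp, erule (2) K_var)
  apply (rule jtyI, assumption, simp, rule ty_Univ, assumption)
  apply (rule jtyI, erule jty_okc, simp, rule ty_Const, assumption, drule (2) jty_D, simp)
  apply ((rule jtyI, blast intro: jty_okc jq_okc, simp only: sub.simps sub_push ups_vars, rule struct_ty,
    ((assumption | (drule (2) jty_D, (assumption | (simp only: sub.simps sub_push ups_vars; assumption)))
      | (drule (2) jty_lift, (assumption | (simp only: sub.simps sub_push ups_vars; assumption)))
      | (drule (2) jty_lift2, (assumption | (simp only: sub.simps sub_push ups_vars; assumption)))
      | (drule (2) jty_lift3, (assumption | (simp only: sub.simps sub_push ups_vars; assumption)))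
      | (drule (2) jq_D, (assumption | (simp only: sub.simps sub_push ups_vars; assumption)))
      | (drule (2) jq_lift, (assumption | (simp only: sub.simps sub_push ups_vars; assumption)))
      | (drule (2) jq_lift2, (assumption | (simp only: sub.simps sub_push ups_vars; assumption)))
      | (drule (2) jq_lift3, (assumption | (simp only: sub.simps sub_push ups_vars; assumption))))+)?)[1])+
  apply (rule jqI, erule jty_okc, rule eq_refl, erule (2) jty_D)
  apply (rule jqI, erule jq_okc, rule eq_sym, erule (2) jq_D)
  apply (rule jqI, erule jq_okc, rule eq_trans, erule (2) jq_D, erule (2) jq_D)
  apply (rule jqI, erule jq_okc, rule eq_conv, erule (2) jq_D, drule (2) jq_D, simp)
  apply ((rule jqI, blast intro: jty_okc jq_okc, simp only: sub.simps sub_push ups_vars, rule struct_eq,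
    ((assumption | (drule (2) jty_D, (assumption | (simp only: sub.simps sub_push ups_vars; assumption)))
      | (drule (2) jty_lift, (assumption | (simp only: sub.simps sub_push ups_vars; assumption)))
      | (drule (2) jty_lift2, (assumption | (simp only: sub.simps sub_push ups_vars; assumption)))
      | (drule (2) jty_lift3, (assumption | (simp only: sub.simps sub_push ups_vars; assumption)))
      | (drule (2) jq_D, (assumption | (simp only: sub.simps sub_push ups_vars; assumption)))
      | (drule (2) jq_lift, (assumption | (simp only: sub.simps sub_push ups_vars; assumption)))
      | (drule (2) jq_lift2, (assumption | (simp only: sub.simps sub_push ups_vars; assumption)))
      | (drule (2) jq_lift3, (assumption | (simp only: sub.simps sub_push ups_vars; assumption))))+)?)[1])+
done

end

section \<open>Weakening and typed substitution\<close>

lemma typing_ctx: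
  "S \<parallel> \<Gamma> \<turnstile> \<Longrightarrow> True"
  "S \<parallel> \<Gamma> \<turnstile> t \<Ztypecolon> T \<Longrightarrow> S \<parallel> \<Gamma> \<turnstile>"
  "S \<parallel> \<Gamma> \<turnstile> t \<simeq> t' \<Ztypecolon> T \<Longrightarrow> S \<parallel> \<Gamma> \<turnstile>"
  by (induction rule: ctx_typing_jeq.inducts) auto

lemma ctx_ConsD: "S \<parallel> A # \<Gamma> \<turnstile> \<Longrightarrow> S \<parallel> \<Gamma> \<turnstile> \<and> (\<exists>i. S \<parallel> \<Gamma> \<turnstile> A \<Ztypecolon> Univ i)"
  by (erule ctx.cases) auto

text \<open>Renamings appear as substitutions so that they fit \<open>stable\<close>. The condition
  compares type expressions and mentions no derivation, so passing under a binder does not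
  presuppose weakening.\<close>

definition wren :: "tm list \<Rightarrow> (nat \<Rightarrow> tm) \<Rightarrow> tm list \<Rightarrow> bool" where
  "wren \<Delta> s \<Gamma> \<longleftrightarrow> (\<exists>r. s = Var \<circ> r \<and> (\<forall>n < length \<Gamma>. r n < length \<Delta> \<and>
     wk (Suc (r n)) (\<Delta> ! r n) = ren r (wk (Suc n) (\<Gamma> ! n))))"

lemma ren_upr_wk: "ren (upr r) (wk (Suc n) t) = wk 1 (ren r (wk n t))"
  by (simp add: wk_def ren_ren comp_def)

interpretation ren: stable S wren for S
proof
  fix \<Delta> \<Gamma> s n
  assume "wren \<Delta> s \<Gamma>" "S \<parallel> \<Delta> \<turnstile>" "n < length \<Gamma>"
  then show "S \<parallel> \<Delta> \<turnstile> s n \<Ztypecolon> sub s (wk (Suc n) (\<Gamma> ! n))"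
    unfolding wren_def using ty_Var[of S \<Delta>] by (auto simp flip: ren_as_sub) metis
next
  fix \<Delta> \<Gamma> s A
  assume "wren \<Delta> s \<Gamma>" "S \<parallel> sub s A # \<Delta> \<turnstile>"
  then obtain r where r: "s = Var \<circ> r" "\<And>n. n < length \<Gamma> \<Longrightarrow> r n < length \<Delta> \<and>
     wk (Suc (r n)) (\<Delta> ! r n) = ren r (wk (Suc n) (\<Gamma> ! n))"
    unfolding wren_def by auto
  have "upr r n < length (sub s A # \<Delta>) \<and>
     wk (Suc (upr r n)) ((sub s A # \<Delta>) ! upr r n) = ren (upr r) (wk (Suc n) ((A # \<Gamma>) ! n))"
    if n: "n < length (A # \<Gamma>)" for n
  proof (cases n)
    case 0
    then show ?thesis using ren_upr_wk[of r 0 A] by (simp add: r(1) ren_as_sub[symmetric])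
  next
    case (Suc m)
    then show ?thesis using r(2)[of m] n wk_wk[of 1 "Suc (r m)" "\<Delta> ! r m"]
      by (simp add: ren_upr_wk)
  qed
  then show "wren (sub s A # \<Delta>) (ups s) (A # \<Gamma>)"
    unfolding wren_def r(1) ups_ren by blast
qed

lemma weakening:
  assumes "S \<parallel> A # \<Gamma> \<turnstile>" "S \<parallel> \<Gamma> \<turnstile> t \<Ztypecolon> T"
  shows "S \<parallel> A # \<Gamma> \<turnstile> wk 1 t \<Ztypecolon> wk 1 T"
proof -
  have "wren (A # \<Gamma>) (Var \<circ> (\<lambda>n. n + 1)) \<Gamma>"
    unfolding wren_def by (rule exI[of _ "\<lambda>n. n + 1"]) (simp add: wk_def ren_ren comp_def)
  from ren.jty_D[OF ren.substitution_gen(2)[OF assms(2)] this assms(1)] show ?thesis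
    by (simp add: wk_def ren_as_sub)
qed

text \<open>Passing under a binder moves every \<open>s n\<close> into a longer context, which is
  where \<open>weakening\<close> enters.\<close>

definition wsub :: "const set \<Rightarrow> tm list \<Rightarrow> (nat \<Rightarrow> tm) \<Rightarrow> tm list \<Rightarrow> bool" where
  "wsub S \<Delta> s \<Gamma> \<longleftrightarrow> (\<forall>n < length \<Gamma>. S \<parallel> \<Delta> \<turnstile> s n \<Ztypecolon> sub s (wk (Suc n) (\<Gamma> ! n)))"

lemma sub_ups_wk_Suc: "sub (ups s) (wk (Suc n) t) = wk 1 (sub s (wk n t))"
  by (simp add: sub_wk wk_sub)

interpretation sub: stable S "wsub S" for S
proof
  fix \<Delta> \<Gamma> s n
  assume "wsub S \<Delta> s \<Gamma>" "S \<parallel> \<Delta> \<turnstile>" "n < length \<Gamma>"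
  then show "S \<parallel> \<Delta> \<turnstile> s n \<Ztypecolon> sub s (wk (Suc n) (\<Gamma> ! n))"
    unfolding wsub_def by auto
next
  fix \<Delta> \<Gamma> s A
  assume w: "wsub S \<Delta> s \<Gamma>" and c: "S \<parallel> sub s A # \<Delta> \<turnstile>"
  have "S \<parallel> sub s A # \<Delta> \<turnstile> ups s n \<Ztypecolon> sub (ups s) (wk (Suc n) ((A # \<Gamma>) ! n))"
    if n: "n < length (A # \<Gamma>)" for n
  proof (cases n)
    case 0
    then show ?thesis using ty_Var[OF c, of 0] sub_ups_wk_Suc[of s 0 A] by simp
  next
    case (Suc m)
    then show ?thesis using n weakening[OF c, of "s m"] w
      unfolding wsub_def by (simp add: sub_ups_wk_Suc)
  qed
  then show "wsub S (sub s A # \<Delta>) (ups s) (A # \<Gamma>)"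
    unfolding wsub_def by blast
qed

lemma substitution:
  assumes "wsub S \<Delta> s \<Gamma>" "S \<parallel> \<Delta> \<turnstile>"
  shows "S \<parallel> \<Gamma> \<turnstile> t \<Ztypecolon> T \<Longrightarrow> S \<parallel> \<Delta> \<turnstile> sub s t \<Ztypecolon> sub s T"
  using sub.jty_D[OF sub.substitution_gen(2) assms] .

lemma wsub_Nil: "wsub S \<Delta> s []"
  by (simp add: wsub_def)

lemma wsub_Var: "S \<parallel> \<Gamma> \<turnstile> \<Longrightarrow> wsub S \<Gamma> Var \<Gamma>"
  by (simp add: wsub_def ty_Var)

lemma wsub_Cons:
  assumes "wsub S \<Delta> s \<Gamma>" "S \<parallel> \<Delta> \<turnstile> a \<Ztypecolon> sub s A"
  shows "wsub S \<Delta> (a \<cdot> s) (A # \<Gamma>)"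
  unfolding wsub_def
proof (intro allI impI)
  fix n assume "n < length (A # \<Gamma>)"
  then show "S \<parallel> \<Delta> \<turnstile> (a \<cdot> s) n \<Ztypecolon> sub (a \<cdot> s) (wk (Suc n) ((A # \<Gamma>) ! n))"
    using assms by (cases n) (auto simp: sub_wk wsub_def)
qed

lemma inst_typing:
  assumes "S \<parallel> A # \<Gamma> \<turnstile> t \<Ztypecolon> T" "S \<parallel> \<Gamma> \<turnstile> a \<Ztypecolon> A"
  shows "S \<parallel> \<Gamma> \<turnstile> t\<langle>a\<rangle> \<Ztypecolon> T\<langle>a\<rangle>"
  unfolding inst_def using assms
  by (intro substitution[OF wsub_Cons[OF wsub_Var]]) (auto dest: typing_ctx)

text \<open>Every substitution is well typed for the empty context, so the identity carries a closed
  derivation into any context.\<close>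

lemma weaken_closed:
  assumes "S \<parallel> \<Gamma> \<turnstile>" "S \<parallel> [] \<turnstile> t \<Ztypecolon> T"
  shows "S \<parallel> \<Gamma> \<turnstile> t \<Ztypecolon> T"
  using substitution[OF wsub_Nil assms, of Var] by simp

section \<open>Inversion of type formers, and congruence of types in their variables\<close>

lemma inv_Pi_aux:
  "S \<parallel> \<Gamma> \<turnstile> \<Longrightarrow> True"
  "S \<parallel> \<Gamma> \<turnstile> t \<Ztypecolon> T \<Longrightarrow> \<forall>A B. t = Pi A B \<longrightarrow>
    (\<exists>i j. S \<parallel> \<Gamma> \<turnstile> A \<Ztypecolon> Univ i \<and> S \<parallel> A # \<Gamma> \<turnstile> B \<Ztypecolon> Univ j)"
  "S \<parallel> \<Gamma> \<turnstile> t \<simeq> t' \<Ztypecolon> T \<Longrightarrow> True"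
  by (induction rule: ctx_typing_jeq.inducts) blast+

lemma inv_Sig_aux:
  "S \<parallel> \<Gamma> \<turnstile> \<Longrightarrow> True"
  "S \<parallel> \<Gamma> \<turnstile> t \<Ztypecolon> T \<Longrightarrow> \<forall>A B. t = Sig A B \<longrightarrow>
    (\<exists>i j. S \<parallel> \<Gamma> \<turnstile> A \<Ztypecolon> Univ i \<and> S \<parallel> A # \<Gamma> \<turnstile> B \<Ztypecolon> Univ j)"
  "S \<parallel> \<Gamma> \<turnstile> t \<simeq> t' \<Ztypecolon> T \<Longrightarrow> True"
  by (induction rule: ctx_typing_jeq.inducts) blast+

lemma inv_Eq_aux:
  "S \<parallel> \<Gamma> \<turnstile> \<Longrightarrow> True"
  "S \<parallel> \<Gamma> \<turnstile> t \<Ztypecolon> T \<Longrightarrow> \<forall>A a b. t = Eq A a b \<longrightarrow>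
    (\<exists>i. S \<parallel> \<Gamma> \<turnstile> A \<Ztypecolon> Univ i \<and> S \<parallel> \<Gamma> \<turnstile> a \<Ztypecolon> A \<and> S \<parallel> \<Gamma> \<turnstile> b \<Ztypecolon> A)"
  "S \<parallel> \<Gamma> \<turnstile> t \<simeq> t' \<Ztypecolon> T \<Longrightarrow> True"
  by (induction rule: ctx_typing_jeq.inducts) blast+

text \<open>The inductions behind these assert nothing about the type \<open>T\<close> of the type
  former, so conversion steps pass through them.\<close>

lemmas inv_Pi = inv_Pi_aux(2)[rule_format, OF _ refl]
lemmas inv_Sig = inv_Sig_aux(2)[rule_format, OF _ refl]
lemmas inv_Eq = inv_Eq_aux(2)[rule_format, OF _ refl]

text \<open>
  A type that depends on a variable is the beta reduct of an application, so congruence of application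
  makes it respect judgemental equality.
\<close>

lemma functionality:
  assumes "S \<parallel> A # \<Gamma> \<turnstile> B \<Ztypecolon> Univ j" "S \<parallel> \<Gamma> \<turnstile> a \<simeq> a' \<Ztypecolon> A" "S \<parallel> \<Gamma> \<turnstile> a \<Ztypecolon> A" "S \<parallel> \<Gamma> \<turnstile> a' \<Ztypecolon> A"
  shows "S \<parallel> \<Gamma> \<turnstile> B\<langle>a\<rangle> \<simeq> B\<langle>a'\<rangle> \<Ztypecolon> Univ j"
proof -
  obtain i where "S \<parallel> \<Gamma> \<turnstile> A \<Ztypecolon> Univ i"
    using assms(1) by (meson typing_ctx(2) ctx_ConsD)
  then have "S \<parallel> \<Gamma> \<turnstile> App (Lam A B) a \<simeq> App (Lam A B) a' \<Ztypecolon> (Univ j)\<langle>a\<rangle>"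
    using assms by (blast intro: cong_App eq_refl ty_Lam)
  moreover note beta_Pi[OF assms(1,3)] beta_Pi[OF assms(1,4)]
  ultimately show ?thesis
    by (simp add: inst_def) (meson eq_sym eq_trans)
qed

lemma ctx_lookup: "\<lbrakk>S \<parallel> \<Gamma> \<turnstile>; n < length \<Gamma>\<rbrakk> \<Longrightarrow> \<exists>i. S \<parallel> \<Gamma> \<turnstile> wk (Suc n) (\<Gamma> ! n) \<Ztypecolon> Univ i"
proof (induction \<Gamma> arbitrary: n)
  case (Cons A \<Gamma>)
  note c = ctx_ConsD[OF Cons.prems(1)]
  show ?case
  proof (cases n)
    case 0
    then show ?thesis using c weakening[OF Cons.prems(1)] by (fastforce simp: wk_def)
  next
    case (Suc m)
    then obtain i where "S \<parallel> \<Gamma> \<turnstile> wk (Suc m) (\<Gamma> ! m) \<Ztypecolon> Univ i"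
      using Cons c by auto
    then have "S \<parallel> A # \<Gamma> \<turnstile> wk 1 (wk (Suc m) (\<Gamma> ! m)) \<Ztypecolon> wk 1 (Univ i)"
      by (rule weakening[OF Cons.prems(1)])
    then show ?thesis using Suc by (auto simp: wk_wk, auto simp: wk_def)
  qed
qed simp

lemma eq_ctx:
  assumes "S \<parallel> \<Gamma> \<turnstile> A \<Ztypecolon> Univ i"
  shows "S \<parallel> A # \<Gamma> \<turnstile>" "S \<parallel> wk 1 A # A # \<Gamma> \<turnstile>" "S \<parallel> Eq (wk 2 A) (Var 1) (Var 0) # wk 1 A # A # \<Gamma> \<turnstile>"
proof -
  show 1: "S \<parallel> A # \<Gamma> \<turnstile>"
    using assms by (meson ctx_cons typing_ctx(2))
  have A1: "S \<parallel> A # \<Gamma> \<turnstile> wk 1 A \<Ztypecolon> Univ i"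
    using weakening[OF 1 assms] by (simp add: wk_def)
  then show 2: "S \<parallel> wk 1 A # A # \<Gamma> \<turnstile>"
    by (meson ctx_cons typing_ctx(2))
  have "S \<parallel> wk 1 A # A # \<Gamma> \<turnstile> wk 2 A \<Ztypecolon> Univ i"
    using weakening[OF 2 A1] by (simp add: wk_wk) (simp add: wk_def)
  moreover have "S \<parallel> wk 1 A # A # \<Gamma> \<turnstile> Var 1 \<Ztypecolon> wk 2 A"
    using ty_Var[OF 2, of 1] by (simp add: numeral_2_eq_2)
  moreover have "S \<parallel> wk 1 A # A # \<Gamma> \<turnstile> Var 0 \<Ztypecolon> wk 2 A"
    using ty_Var[OF 2, of 0] by (simp add: wk_wk numeral_2_eq_2)
  ultimately show "S \<parallel> Eq (wk 2 A) (Var 1) (Var 0) # wk 1 A # A # \<Gamma> \<turnstile>"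
    by (meson ctx_cons ty_Eq 2)
qed

lemma wsub_eq:
  assumes "S \<parallel> \<Gamma> \<turnstile> a \<Ztypecolon> A" "S \<parallel> \<Gamma> \<turnstile> b \<Ztypecolon> A" "S \<parallel> \<Gamma> \<turnstile> p \<Ztypecolon> Eq A a b"
  shows "wsub S \<Gamma> (p \<cdot> b \<cdot> a \<cdot> Var) (Eq (wk 2 A) (Var 1) (Var 0) # wk 1 A # A # \<Gamma>)"
proof (intro wsub_Cons)
  show "wsub S \<Gamma> Var \<Gamma>" using assms(1) by (intro wsub_Var) (rule typing_ctx(2))
qed (use assms in \<open>simp_all add: sub_wk numeral_2_eq_2\<close>)

lemma inst3_typing:
  assumes "S \<parallel> Eq (wk 2 A) (Var 1) (Var 0) # wk 1 A # A # \<Gamma> \<turnstile> C \<Ztypecolon> Univ k"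
    "S \<parallel> \<Gamma> \<turnstile> a \<Ztypecolon> A" "S \<parallel> \<Gamma> \<turnstile> b \<Ztypecolon> A" "S \<parallel> \<Gamma> \<turnstile> p \<Ztypecolon> Eq A a b"
  shows "S \<parallel> \<Gamma> \<turnstile> sub (p \<cdot> b \<cdot> a \<cdot> Var) C \<Ztypecolon> Univ k"
  using substitution[OF wsub_eq[OF assms(2-4)] _ assms(1)] typing_ctx(2)[OF assms(2)] by simp

text \<open>The motive of \<open>EqE\<close> depends on two end points and a path between them.
  Abstracting all three variables turns the simultaneous substitution into iterated application; the
  price is three beta steps whose intermediate types must be derived under one and two
  binders.\<close>

lemma abs3_beta:
  fixes A C
  defines "E \<equiv> Eq (wk 2 A) (Var 1) (Var 0)"
  assumes A: "S \<parallel> \<Gamma> \<turnstile> A \<Ztypecolon> Univ i" and C: "S \<parallel> E # wk 1 A # A # \<Gamma> \<turnstile> C \<Ztypecolon> Univ k"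
    and a: "S \<parallel> \<Gamma> \<turnstile> a \<Ztypecolon> A" and b: "S \<parallel> \<Gamma> \<turnstile> b \<Ztypecolon> A" and p: "S \<parallel> \<Gamma> \<turnstile> p \<Ztypecolon> Eq A a b"
  shows "S \<parallel> \<Gamma> \<turnstile> App (App (App (Lam A (Lam (wk 1 A) (Lam E C))) a) b) p \<simeq> sub (p \<cdot> b \<cdot> a \<cdot> Var) C \<Ztypecolon> Univ k"
proof -
  note ctx = eq_ctx[OF A, folded E_def]
  have wA: "S \<parallel> A # \<Gamma> \<turnstile> wk 1 A \<Ztypecolon> Univ i"
    using ctx(1) A weakening[OF ctx(1) A] by (simp add: wk_def)
  obtain e where e: "S \<parallel> wk 1 A # A # \<Gamma> \<turnstile> E \<Ztypecolon> Univ e"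
    using ctx(3) ctx_ConsD by blast
  have l2: "S \<parallel> wk 1 A # A # \<Gamma> \<turnstile> Lam E C \<Ztypecolon> Pi E (Univ k)"
    using e C by (rule ty_Lam)
  have l1: "S \<parallel> A # \<Gamma> \<turnstile> Lam (wk 1 A) (Lam E C) \<Ztypecolon> Pi (wk 1 A) (Pi E (Univ k))"
    using wA l2 by (rule ty_Lam)
  have g: "S \<parallel> \<Gamma> \<turnstile>" using a by (rule typing_ctx(2))
  let ?s = "a \<cdot> Var"
  have s: "wsub S \<Gamma> ?s (A # \<Gamma>)" using a by (intro wsub_Cons wsub_Var g) simp
  have sA: "sub ?s (wk 1 A) = A" by (simp add: sub_wk)
  have s1: "wsub S (A # \<Gamma>) (ups ?s) (wk 1 A # A # \<Gamma>)"
    using sub.K_ups[OF s, of "wk 1 A"] ctx(1) unfolding sA by blast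
  let ?E1 = "sub (ups ?s) E" and ?C1 = "sub (ups (ups ?s)) C"
  have E1: "S \<parallel> A # \<Gamma> \<turnstile> ?E1 \<Ztypecolon> Univ e" using substitution[OF s1 ctx(1) e] by simp
  have c1: "S \<parallel> ?E1 # A # \<Gamma> \<turnstile>" using ctx(1) E1 by (rule ctx_cons)
  have s2: "wsub S (?E1 # A # \<Gamma>) (ups (ups ?s)) (E # wk 1 A # A # \<Gamma>)"
    using sub.K_ups[OF s1 c1] .
  have C1: "S \<parallel> ?E1 # A # \<Gamma> \<turnstile> ?C1 \<Ztypecolon> Univ k" using substitution[OF s2 c1 C] by simp
  let ?t = "b \<cdot> Var"
  have t: "wsub S \<Gamma> ?t (A # \<Gamma>)" using b by (intro wsub_Cons wsub_Var g) simp
  have tE: "sub ?t ?E1 = Eq A a b"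
    by (simp add: E_def sub_wk numeral_2_eq_2 sub_sub comp_def)
  have E2: "S \<parallel> \<Gamma> \<turnstile> Eq A a b \<Ztypecolon> Univ e" using substitution[OF t g E1] by (simp add: tE)
  have c2: "S \<parallel> Eq A a b # \<Gamma> \<turnstile>" using g E2 by (rule ctx_cons)
  have t1: "wsub S (Eq A a b # \<Gamma>) (ups ?t) (?E1 # A # \<Gamma>)"
    using sub.K_ups[OF t, of ?E1] c2 unfolding tE by blast
  let ?C2 = "sub (ups ?t) ?C1"
  have C2: "S \<parallel> Eq A a b # \<Gamma> \<turnstile> ?C2 \<Ztypecolon> Univ k" using substitution[OF t1 c2 C1] by simp
  have eqC: "?C2\<langle>p\<rangle> = sub (p \<cdot> b \<cdot> a \<cdot> Var) C"
    unfolding inst_def sub_sub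
    by (rule sub_cong, rename_tac n, case_tac n; case_tac "n - 1"; case_tac "n - 2") (auto simp: sub_wk sub_sub comp_def)
  have "S \<parallel> \<Gamma> \<turnstile> App (Lam A (Lam (wk 1 A) (Lam E C))) a \<simeq> Lam A (Lam ?E1 ?C1) \<Ztypecolon> Pi A (Pi ?E1 (Univ k))"
    using beta_Pi[OF l1 a] by (simp add: inst_def sA[simplified])
  from cong_App[OF this eq_refl[OF b]]
  have 1: "S \<parallel> \<Gamma> \<turnstile> App (App (Lam A (Lam (wk 1 A) (Lam E C))) a) b \<simeq> App (Lam A (Lam ?E1 ?C1)) b \<Ztypecolon> Pi (Eq A a b) (Univ k)"
    by (simp add: inst_def tE)
  have "S \<parallel> \<Gamma> \<turnstile> App (Lam A (Lam ?E1 ?C1)) b \<simeq> Lam (Eq A a b) ?C2 \<Ztypecolon> Pi (Eq A a b) (Univ k)"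
    using beta_Pi[OF ty_Lam[OF E1 C1] b] by (simp add: inst_def tE)
  from cong_App[OF eq_trans[OF 1 this] eq_refl[OF p]]
  have "S \<parallel> \<Gamma> \<turnstile> App (App (App (Lam A (Lam (wk 1 A) (Lam E C))) a) b) p \<simeq> App (Lam (Eq A a b) ?C2) p \<Ztypecolon> Univ k"
    by (simp add: inst_def)
  moreover have "S \<parallel> \<Gamma> \<turnstile> App (Lam (Eq A a b) ?C2) p \<simeq> ?C2\<langle>p\<rangle> \<Ztypecolon> Univ k"
    using beta_Pi[OF C2 p] by (simp add: inst_def)
  ultimately show ?thesis
    by (metis eq_trans eqC)
qed

text \<open>Congruence of application, once per argument, gives the equality before beta reduction.
  Note that \<open>p'\<close> is typed over \<open>a'\<close> and \<open>b'\<close> but compared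
  with \<open>p\<close> over \<open>a\<close> and \<open>b\<close>. This is how the type of an
  \<open>EqE\<close> term survives a change of its arguments.\<close>

lemma functionality3:
  assumes A: "S \<parallel> \<Gamma> \<turnstile> A \<Ztypecolon> Univ i"
    and C: "S \<parallel> Eq (wk 2 A) (Var 1) (Var 0) # wk 1 A # A # \<Gamma> \<turnstile> C \<Ztypecolon> Univ k"
    and t: "S \<parallel> \<Gamma> \<turnstile> a \<Ztypecolon> A" "S \<parallel> \<Gamma> \<turnstile> b \<Ztypecolon> A" "S \<parallel> \<Gamma> \<turnstile> p \<Ztypecolon> Eq A a b"
    and t': "S \<parallel> \<Gamma> \<turnstile> a' \<Ztypecolon> A" "S \<parallel> \<Gamma> \<turnstile> b' \<Ztypecolon> A" "S \<parallel> \<Gamma> \<turnstile> p' \<Ztypecolon> Eq A a' b'"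
    and q: "S \<parallel> \<Gamma> \<turnstile> a \<simeq> a' \<Ztypecolon> A" "S \<parallel> \<Gamma> \<turnstile> b \<simeq> b' \<Ztypecolon> A" "S \<parallel> \<Gamma> \<turnstile> p \<simeq> p' \<Ztypecolon> Eq A a b"
  shows "S \<parallel> \<Gamma> \<turnstile> sub (p \<cdot> b \<cdot> a \<cdot> Var) C \<simeq> sub (p' \<cdot> b' \<cdot> a' \<cdot> Var) C \<Ztypecolon> Univ k"
proof -
  let ?E = "Eq (wk 2 A) (Var 1) (Var 0)" let ?F = "Lam A (Lam (wk 1 A) (Lam ?E C))"
  note ctx = eq_ctx[OF A]
  have wA: "S \<parallel> A # \<Gamma> \<turnstile> wk 1 A \<Ztypecolon> Univ i"
    using ctx(1) A weakening[OF ctx(1) A] by (simp add: wk_def)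
  obtain e where e: "S \<parallel> wk 1 A # A # \<Gamma> \<turnstile> ?E \<Ztypecolon> Univ e"
    using ctx(3) ctx_ConsD by blast
  have "S \<parallel> \<Gamma> \<turnstile> ?F \<simeq> ?F \<Ztypecolon> Pi A (Pi (wk 1 A) (Pi ?E (Univ k)))"
    by (intro eq_refl ty_Lam[OF A] ty_Lam[OF wA] ty_Lam[OF e] C)
  from cong_App[OF this q(1)]
  have "S \<parallel> \<Gamma> \<turnstile> App ?F a \<simeq> App ?F a' \<Ztypecolon> Pi A (Pi (Eq (wk 1 A) (wk 1 a) (Var 0)) (Univ k))"
    by (simp add: inst_def sub_wk numeral_2_eq_2) (simp add: wk_def ren_as_sub comp_def)
  from cong_App[OF this q(2)]
  have "S \<parallel> \<Gamma> \<turnstile> App (App ?F a) b \<simeq> App (App ?F a') b' \<Ztypecolon> Pi (Eq A a b) (Univ k)"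
    by (simp add: inst_def sub_wk)
  from cong_App[OF this q(3)]
  have "S \<parallel> \<Gamma> \<turnstile> App (App (App ?F a) b) p \<simeq> App (App (App ?F a') b') p' \<Ztypecolon> Univ k"
    by (simp add: inst_def)
  with abs3_beta[OF A C t] abs3_beta[OF A C t'] show ?thesis
    by (meson eq_sym eq_trans)
qed

section \<open>A type checker\<close>

text \<open>Levels are symbolic: \<open>LU k\<close> stands for \<open>u + k\<close> and
  \<open>L0\<close> for level 0, the home of the natural numbers. The maximum of \<open>L0\<close>
  and any level is that level for every \<open>u\<close>. The successor of \<open>L0\<close> is not
  expressible, which is why \<open>infer_step\<close> gives \<open>CU L0\<close> no type.\<close>

datatype lvl = L0 | LU nat

fun lmax :: "lvl \<Rightarrow> lvl \<Rightarrow> lvl" where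
  "lmax L0 l = l"
| "lmax (LU i) L0 = LU i"
| "lmax (LU i) (LU j) = LU (max i j)"

text \<open>The part of the syntax that the object proofs use. \<open>CG g l\<close> cites the
  \<open>g\<close>-th earlier statement with all levels raised by \<open>l\<close>; being opaque, it
  keeps proof terms from being unfolded.\<close>

datatype ctm =
    CV nat | CU lvl | CG nat nat
  | CPi ctm ctm | CLam ctm ctm | CApp ctm ctm
  | CSig ctm ctm | CTup ctm ctm ctm | CSigE ctm ctm ctm
  | CNat | CZero | CSucc ctm | CNatE ctm ctm ctm ctm
  | CEq ctm ctm ctm | CRefl ctm | CEqE ctm ctm ctm ctm ctm

primrec lift :: "nat \<Rightarrow> nat \<Rightarrow> ctm \<Rightarrow> ctm" where
  "lift c k (CV n) = CV (if n < c then n else n + k)"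
| "lift c k (CU l) = CU l"
| "lift c k (CG g l) = CG g l"
| "lift c k (CPi A B) = CPi (lift c k A) (lift (Suc c) k B)"
| "lift c k (CLam A b) = CLam (lift c k A) (lift (Suc c) k b)"
| "lift c k (CApp f a) = CApp (lift c k f) (lift c k a)"
| "lift c k (CSig A B) = CSig (lift c k A) (lift (Suc c) k B)"
| "lift c k (CTup B a b) = CTup (lift (Suc c) k B) (lift c k a) (lift c k b)"
| "lift c k (CSigE C t p) = CSigE (lift (Suc c) k C) (lift (Suc (Suc c)) k t) (lift c k p)"
| "lift c k CNat = CNat"
| "lift c k CZero = CZero"
| "lift c k (CSucc n) = CSucc (lift c k n)"
| "lift c k (CNatE C z s n) = CNatE (lift (Suc c) k C) (lift c k z) (lift (Suc (Suc c)) k s) (lift c k n)"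
| "lift c k (CEq A a b) = CEq (lift c k A) (lift c k a) (lift c k b)"
| "lift c k (CRefl a) = CRefl (lift c k a)"
| "lift c k (CEqE C d a b p) = CEqE (lift (Suc (Suc (Suc c))) k C) (lift (Suc c) k d) (lift c k a) (lift c k b) (lift c k p)"

text \<open>\<open>ts\<close> is the finite part of a substitution, innermost variable first,
  \<open>w\<close> the shift of all other variables, and \<open>d\<close> the number of binders
  crossed. Lists and numbers can be evaluated by rewriting, unlike the functions built with
  \<open>scons\<close>. Depth 0 has its own equation to avoid a lift by zero.\<close>

fun pick :: "nat \<Rightarrow> ctm list \<Rightarrow> nat \<Rightarrow> nat \<Rightarrow> ctm" where
  "pick d [] w m = CV (m + w + d)"
| "pick 0 (t # ts) w 0 = t"
| "pick (Suc d) (t # ts) w 0 = lift 0 (Suc d) t"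
| "pick d (t # ts) w (Suc m) = pick d ts w m"

primrec cs :: "nat \<Rightarrow> ctm list \<Rightarrow> nat \<Rightarrow> ctm \<Rightarrow> ctm" where
  "cs d ts w (CV n) = (if n < d then CV n else pick d ts w (n - d))"
| "cs d ts w (CU l) = CU l"
| "cs d ts w (CG g l) = CG g l"
| "cs d ts w (CPi A B) = CPi (cs d ts w A) (cs (Suc d) ts w B)"
| "cs d ts w (CLam A b) = CLam (cs d ts w A) (cs (Suc d) ts w b)"
| "cs d ts w (CApp f a) = CApp (cs d ts w f) (cs d ts w a)"
| "cs d ts w (CSig A B) = CSig (cs d ts w A) (cs (Suc d) ts w B)"
| "cs d ts w (CTup B a b) = CTup (cs (Suc d) ts w B) (cs d ts w a) (cs d ts w b)"
| "cs d ts w (CSigE C t p) = CSigE (cs (Suc d) ts w C) (cs (Suc (Suc d)) ts w t) (cs d ts w p)"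
| "cs d ts w CNat = CNat"
| "cs d ts w CZero = CZero"
| "cs d ts w (CSucc n) = CSucc (cs d ts w n)"
| "cs d ts w (CNatE C z s n) = CNatE (cs (Suc d) ts w C) (cs d ts w z) (cs (Suc (Suc d)) ts w s) (cs d ts w n)"
| "cs d ts w (CEq A a b) = CEq (cs d ts w A) (cs d ts w a) (cs d ts w b)"
| "cs d ts w (CRefl a) = CRefl (cs d ts w a)"
| "cs d ts w (CEqE C e a b p) = CEqE (cs (Suc (Suc (Suc d))) ts w C) (cs (Suc d) ts w e) (cs d ts w a) (cs d ts w b) (cs d ts w p)"

text \<open>\<open>k\<close> grows with each entry passed, so the type found is lifted over its own
  entry and all newer ones; hence the initial value 1.\<close>

fun vty :: "ctm list \<Rightarrow> nat \<Rightarrow> nat \<Rightarrow> ctm option" where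
  "vty [] n k = None"
| "vty (A # \<Gamma>) 0 k = Some (lift 0 k A)"
| "vty (A # \<Gamma>) (Suc n) k = vty \<Gamma> n (Suc k)"

text \<open>\<open>L0\<close> is absolute while \<open>LU i\<close> is relative to the base level,
  so raising by \<open>k\<close> amounts to replacing the base \<open>u\<close> by
  \<open>u + k\<close>.\<close>

fun lup :: "nat \<Rightarrow> lvl \<Rightarrow> lvl" where
  "lup k L0 = L0"
| "lup k (LU i) = LU (i + k)"

primrec shl :: "nat \<Rightarrow> ctm \<Rightarrow> ctm" where
  "shl k (CV n) = CV n"
| "shl k (CU l) = CU (lup k l)"
| "shl k (CG g l) = CG g (l + k)"
| "shl k (CPi A B) = CPi (shl k A) (shl k B)"
| "shl k (CLam A b) = CLam (shl k A) (shl k b)"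
| "shl k (CApp f a) = CApp (shl k f) (shl k a)"
| "shl k (CSig A B) = CSig (shl k A) (shl k B)"
| "shl k (CTup B a b) = CTup (shl k B) (shl k a) (shl k b)"
| "shl k (CSigE C t p) = CSigE (shl k C) (shl k t) (shl k p)"
| "shl k CNat = CNat"
| "shl k CZero = CZero"
| "shl k (CSucc n) = CSucc (shl k n)"
| "shl k (CNatE C z s n) = CNatE (shl k C) (shl k z) (shl k s) (shl k n)"
| "shl k (CEq A a b) = CEq (shl k A) (shl k a) (shl k b)"
| "shl k (CRefl a) = CRefl (shl k a)"
| "shl k (CEqE C d a b p) = CEqE (shl k C) (shl k d) (shl k a) (shl k b) (shl k p)"

fun gty :: "ctm list \<Rightarrow> nat \<Rightarrow> nat \<Rightarrow> ctm option" where
  "gty [] n l = None"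
| "gty (A # L) 0 l = Some (shl l A)"
| "gty (A # L) (Suc n) l = gty L n l"

definition grd :: "bool \<Rightarrow> 'a option \<Rightarrow> 'a option" where
  "grd b x = (if b then x else None)"

fun asU :: "ctm \<Rightarrow> lvl option" where
  "asU (CU l) = Some l"
| "asU _ = None"

fun asPi :: "ctm \<Rightarrow> (ctm \<times> ctm) option" where
  "asPi (CPi A B) = Some (A, B)"
| "asPi _ = None"

fun asSig :: "ctm \<Rightarrow> (ctm \<times> ctm) option" where
  "asSig (CSig A B) = Some (A, B)"
| "asSig _ = None"

fun asEq :: "ctm \<Rightarrow> (ctm \<times> ctm \<times> ctm) option" where
  "asEq (CEq A a b) = Some (A, a, b)"
| "asEq _ = None"

text \<open>
  No subject reduction theorem is available, so a contraction is accepted only after the redex has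
  been checked again, and every function returns the type at which its result holds.
\<close>

datatype ops = Ops
  (infer: "ctm list \<Rightarrow> ctm \<Rightarrow> ctm option")
  (whnf: "ctm list \<Rightarrow> ctm \<Rightarrow> ctm")
  (red: "ctm list \<Rightarrow> ctm \<Rightarrow> (ctm \<times> ctm) option")
  (conv: "ctm list \<Rightarrow> ctm \<Rightarrow> ctm \<Rightarrow> ctm option")

section \<open>One round of inference, reduction and conversion\<close>

definition same :: "ops \<Rightarrow> ctm list \<Rightarrow> ctm \<Rightarrow> ctm \<Rightarrow> bool" where
  "same k \<Gamma> T T' = (if T = T' then True else Option.bind (conv k \<Gamma> T T') asU \<noteq> None)"

definition check :: "ops \<Rightarrow> ctm list \<Rightarrow> ctm \<Rightarrow> ctm \<Rightarrow> bool" where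
  "check k \<Gamma> t T = (Option.bind (infer k \<Gamma> t) (\<lambda>T'. grd (same k \<Gamma> T' T) (Some T)) \<noteq> None)"

definition level :: "ops \<Rightarrow> ctm list \<Rightarrow> ctm \<Rightarrow> lvl option" where
  "level k \<Gamma> A = Option.bind (infer k \<Gamma> A) (\<lambda>K. asU (whnf k \<Gamma> K))"

definition sigOK where
  "sigOK k \<Gamma> A B C c = (level k (CSig A B # \<Gamma>) C \<noteq> None \<and>
      check k (B # A # \<Gamma>) c (cs 0 [CTup (lift 1 2 B) (CV 1) (CV 0)] 2 C))"

definition natOK where
  "natOK k \<Gamma> C z s = (level k (CNat # \<Gamma>) C \<noteq> None \<and> check k \<Gamma> z (cs 0 [CZero] 0 C) \<and>
      check k (C # CNat # \<Gamma>) s (cs 0 [CSucc (CV 1)] 2 C))"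

definition eqOK where
  "eqOK k \<Gamma> A C d = (level k (CEq (lift 0 2 A) (CV 1) (CV 0) # lift 0 1 A # A # \<Gamma>) C \<noteq> None \<and>
      check k (A # \<Gamma>) d (cs 0 [CRefl (CV 0), CV 0, CV 0] 1 C))"

text \<open>\<open>EqE\<close> stores its end points, and the type of the path brings its own; the
  two pairs have to agree up to conversion.\<close>

definition eqAt where
  "eqAt k \<Gamma> A a b a' b' = (if a = a' \<and> b = b' then True else
      check k \<Gamma> a A \<and> check k \<Gamma> b A \<and> same k \<Gamma> (CEq A a' b') (CEq A a b))"

definition infer_step :: "ctm list \<Rightarrow> ops \<Rightarrow> ctm list \<Rightarrow> ctm \<Rightarrow> ctm option" where
  "infer_step L k \<Gamma> t = (case t of
      CV m \<Rightarrow> vty \<Gamma> m 1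
    | CU l \<Rightarrow> (case l of L0 \<Rightarrow> None | LU i \<Rightarrow> Some (CU (LU (Suc i))))
    | CG g l \<Rightarrow> gty L g l
    | CPi A B \<Rightarrow> do {i \<leftarrow> level k \<Gamma> A; j \<leftarrow> level k (A # \<Gamma>) B; Some (CU (lmax i j))}
    | CLam A b \<Rightarrow> do {i \<leftarrow> level k \<Gamma> A; B \<leftarrow> infer k (A # \<Gamma>) b; Some (CPi A B)}
    | CApp f a \<Rightarrow> do {F \<leftarrow> infer k \<Gamma> f; (A, B) \<leftarrow> asPi (whnf k \<Gamma> F);
        grd (check k \<Gamma> a A) (Some (cs 0 [a] 0 B))}
    | CSig A B \<Rightarrow> do {i \<leftarrow> level k \<Gamma> A; j \<leftarrow> level k (A # \<Gamma>) B; Some (CU (lmax i j))}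
    | CTup B a b \<Rightarrow> do {A \<leftarrow> infer k \<Gamma> a; j \<leftarrow> level k (A # \<Gamma>) B;
        grd (check k \<Gamma> b (cs 0 [a] 0 B)) (Some (CSig A B))}
    | CSigE C c p \<Rightarrow> do {P \<leftarrow> infer k \<Gamma> p; (A, B) \<leftarrow> asSig (whnf k \<Gamma> P);
        grd (sigOK k \<Gamma> A B C c) (Some (cs 0 [p] 0 C))}
    | CNat \<Rightarrow> Some (CU L0)
    | CZero \<Rightarrow> Some CNat
    | CSucc m \<Rightarrow> grd (check k \<Gamma> m CNat) (Some CNat)
    | CNatE C z s m \<Rightarrow> grd (natOK k \<Gamma> C z s) (grd (check k \<Gamma> m CNat) (Some (cs 0 [m] 0 C)))
    | CEq A a b \<Rightarrow> do {i \<leftarrow> level k \<Gamma> A; grd (check k \<Gamma> a A) (grd (check k \<Gamma> b A) (Some (CU i)))}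
    | CRefl a \<Rightarrow> do {A \<leftarrow> infer k \<Gamma> a; Some (CEq A a a)}
    | CEqE C d a b p \<Rightarrow> do {P \<leftarrow> infer k \<Gamma> p; (A, a', b') \<leftarrow> asEq (whnf k \<Gamma> P);
        grd (eqAt k \<Gamma> A a b a' b')
         (grd (eqOK k \<Gamma> A C d) (Some (cs 0 [p, b, a] 0 C)))})"

text \<open>A contraction is followed only if it holds at a literal universe, since that is what
  makes it an equality of types. Stopping early costs at most completeness.\<close>

definition whnf_step :: "ops \<Rightarrow> ctm list \<Rightarrow> ctm \<Rightarrow> ctm" where
  "whnf_step k \<Gamma> T = (case red k \<Gamma> T of None \<Rightarrow> T | Some x \<Rightarrow>
      (case asU (snd x) of None \<Rightarrow> T | Some _ \<Rightarrow> whnf k \<Gamma> (fst x)))"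

definition red_app where
  "red_app k \<Gamma> f a = do {(f', F) \<leftarrow> red k \<Gamma> f; (A, B) \<leftarrow> asPi (whnf k \<Gamma> F);
      grd (check k \<Gamma> a A) (Some (CApp f' a, cs 0 [a] 0 B))}"

definition red_sig where
  "red_sig k \<Gamma> C c p = do {(p', P) \<leftarrow> red k \<Gamma> p; (A, B) \<leftarrow> asSig (whnf k \<Gamma> P);
      grd (sigOK k \<Gamma> A B C c) (Some (CSigE C c p', cs 0 [p] 0 C))}"

definition red_eq where
  "red_eq k \<Gamma> C d a b p = do {(p', P) \<leftarrow> red k \<Gamma> p; (A, a', b') \<leftarrow> asEq (whnf k \<Gamma> P);
      grd (eqAt k \<Gamma> A a b a' b') (grd (eqOK k \<Gamma> A C d) (Some (CEqE C d a b p', cs 0 [p, b, a] 0 C)))}"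

definition sameAt where
  "sameAt k \<Gamma> a x A = (if a = x then True else
      Option.bind (conv k \<Gamma> a x) (\<lambda>T. grd (same k \<Gamma> T A) (Some T)) \<noteq> None)"

definition red_step :: "ops \<Rightarrow> ctm list \<Rightarrow> ctm \<Rightarrow> (ctm \<times> ctm) option" where
  "red_step k \<Gamma> t = (case t of
      CApp f a \<Rightarrow> (case f of
          CLam A b \<Rightarrow> do {i \<leftarrow> level k \<Gamma> A; B \<leftarrow> infer k (A # \<Gamma>) b;
            grd (check k \<Gamma> a A) (Some (cs 0 [a] 0 b, cs 0 [a] 0 B))}
        | _ \<Rightarrow> red_app k \<Gamma> f a)
    | CSigE C c p \<Rightarrow> (case p of
          CTup B a b \<Rightarrow> do {A \<leftarrow> infer k \<Gamma> a; j \<leftarrow> level k (A # \<Gamma>) B;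
            grd (check k \<Gamma> b (cs 0 [a] 0 B)) (grd (sigOK k \<Gamma> A B C c)
              (Some (cs 0 [b, a] 0 c, cs 0 [p] 0 C)))}
        | _ \<Rightarrow> red_sig k \<Gamma> C c p)
    | CNatE C z s m \<Rightarrow> (case m of
          CZero \<Rightarrow> grd (natOK k \<Gamma> C z s) (Some (z, cs 0 [m] 0 C))
        | CSucc m' \<Rightarrow> grd (natOK k \<Gamma> C z s) (grd (check k \<Gamma> m' CNat)
            (Some (cs 0 [CNatE C z s m', m'] 0 s, cs 0 [m] 0 C)))
        | _ \<Rightarrow> None)
    | CEqE C d a b p \<Rightarrow> (case p of
          CRefl x \<Rightarrow> do {A \<leftarrow> infer k \<Gamma> x; grd (eqOK k \<Gamma> A C d) (grd (sameAt k \<Gamma> a x A) (grd (sameAt k \<Gamma> b x A)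
            (Some (cs 0 [x] 0 d, cs 0 [p, b, a] 0 C))))}
        | _ \<Rightarrow> red_eq k \<Gamma> C d a b p)
    | _ \<Rightarrow> None)"

text \<open>The type that a conversion returns must be a type of the left-hand term. So expanding
  the right-hand term, as here, takes the type from the recursive call, while expanding the
  left-hand term in \<open>eta'\<close> takes it from inference.\<close>

definition eta where
  "eta k \<Gamma> t t' = do {F \<leftarrow> infer k \<Gamma> t'; (A, B) \<leftarrow> asPi F;
      T \<leftarrow> conv k \<Gamma> t (CLam A (CApp (lift 0 1 t') (CV 0)));
      grd (same k \<Gamma> F T) (Some T)}"

definition eta' where
  "eta' k \<Gamma> t t' = do {F \<leftarrow> infer k \<Gamma> t; (A, B) \<leftarrow> asPi F;
      T \<leftarrow> conv k \<Gamma> (CLam A (CApp (lift 0 1 t) (CV 0))) t';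
      grd (same k \<Gamma> T F) (Some F)}"

definition cong1 :: "ops \<Rightarrow> ctm list \<Rightarrow> ctm \<Rightarrow> ctm \<Rightarrow> ctm option" where
  "cong1 k \<Gamma> t t' = (case t of
      CPi A B \<Rightarrow> (case t' of
        CPi A' B' \<Rightarrow> do {K \<leftarrow> conv k \<Gamma> A A'; i \<leftarrow> asU K; K' \<leftarrow> conv k (A # \<Gamma>) B B'; j \<leftarrow> asU K';
          Some (CU (lmax i j))}
      | _ \<Rightarrow> None)
    | CSig A B \<Rightarrow> (case t' of
        CSig A' B' \<Rightarrow> do {K \<leftarrow> conv k \<Gamma> A A'; i \<leftarrow> asU K; K' \<leftarrow> conv k (A # \<Gamma>) B B'; j \<leftarrow> asU K';
          Some (CU (lmax i j))}
      | _ \<Rightarrow> None)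
    | CLam A b \<Rightarrow> (case t' of
        CLam A' b' \<Rightarrow> do {K \<leftarrow> conv k \<Gamma> A A'; i \<leftarrow> asU K; B \<leftarrow> conv k (A # \<Gamma>) b b'; Some (CPi A B)}
      | _ \<Rightarrow> eta k \<Gamma> t t')
    | CApp f a \<Rightarrow> (case t' of
        CApp f' a' \<Rightarrow> do {F \<leftarrow> conv k \<Gamma> f f'; (A, B) \<leftarrow> asPi (whnf k \<Gamma> F); A' \<leftarrow> conv k \<Gamma> a a';
          grd (same k \<Gamma> A' A) (Some (cs 0 [a] 0 B))}
      | _ \<Rightarrow> None)
    | CTup B a b \<Rightarrow> (case t' of
        CTup B' a' b' \<Rightarrow> do {A \<leftarrow> conv k \<Gamma> a a'; K \<leftarrow> conv k (A # \<Gamma>) B B'; j \<leftarrow> asU K;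
          T \<leftarrow> conv k \<Gamma> b b'; grd (same k \<Gamma> T (cs 0 [a] 0 B)) (Some (CSig A B))}
      | _ \<Rightarrow> None)
    | CSigE C c p \<Rightarrow> (case t' of
        CSigE C' c' p' \<Rightarrow> do {P \<leftarrow> conv k \<Gamma> p p'; (A, B) \<leftarrow> asSig (whnf k \<Gamma> P);
          K \<leftarrow> conv k (CSig A B # \<Gamma>) C C'; j \<leftarrow> asU K; T \<leftarrow> conv k (B # A # \<Gamma>) c c';
          grd (same k (B # A # \<Gamma>) T (cs 0 [CTup (lift 1 2 B) (CV 1) (CV 0)] 2 C))
            (Some (cs 0 [p] 0 C))}
      | _ \<Rightarrow> None)
    | CEq A a b \<Rightarrow> (case t' of
        CEq A' a' b' \<Rightarrow> do {K \<leftarrow> conv k \<Gamma> A A'; i \<leftarrow> asU K; T \<leftarrow> conv k \<Gamma> a a'; T' \<leftarrow> conv k \<Gamma> b b';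
          grd (same k \<Gamma> T A) (grd (same k \<Gamma> T' A) (Some (CU i)))}
      | _ \<Rightarrow> None)
    | CRefl a \<Rightarrow> (case t' of
        CRefl a' \<Rightarrow> do {A \<leftarrow> conv k \<Gamma> a a'; Some (CEq A a a)}
      | _ \<Rightarrow> None)
    | CEqE C d a b p \<Rightarrow> (case t' of
        CEqE C' d' a' b' p' \<Rightarrow> do {P \<leftarrow> conv k \<Gamma> p p'; (A, x, y) \<leftarrow> asEq (whnf k \<Gamma> P);
          grd (eqAt k \<Gamma> A a b x y) (grd (sameAt k \<Gamma> a a' A) (grd (sameAt k \<Gamma> b b' A)
            (do {K \<leftarrow> conv k (CEq (lift 0 2 A) (CV 1) (CV 0) # lift 0 1 A # A # \<Gamma>) C C'; j \<leftarrow> asU K;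
              T \<leftarrow> conv k (A # \<Gamma>) d d';
              grd (same k (A # \<Gamma>) T (cs 0 [CRefl (CV 0), CV 0, CV 0] 1 C)) (Some (cs 0 [p, b, a] 0 C))})))}
      | _ \<Rightarrow> None)
    | _ \<Rightarrow> None)"

definition cong :: "ops \<Rightarrow> ctm list \<Rightarrow> ctm \<Rightarrow> ctm \<Rightarrow> ctm option" where
  "cong k \<Gamma> t t' = (case t' of
      CLam A' b' \<Rightarrow> (case t of CLam A b \<Rightarrow> cong1 k \<Gamma> t t' | _ \<Rightarrow> eta' k \<Gamma> t t')
    | _ \<Rightarrow> cong1 k \<Gamma> t t')"

definition conv_step :: "ops \<Rightarrow> ctm list \<Rightarrow> ctm \<Rightarrow> ctm \<Rightarrow> ctm option" where
  "conv_step k \<Gamma> t t' = (if t = t' then infer k \<Gamma> t else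
      (case red k \<Gamma> t of
        Some x \<Rightarrow> do {T \<leftarrow> conv k \<Gamma> (fst x) t'; grd (same k \<Gamma> T (snd x)) (Some (snd x))}
      | None \<Rightarrow> (case red k \<Gamma> t' of
          Some x \<Rightarrow> do {T \<leftarrow> conv k \<Gamma> t (fst x); grd (same k \<Gamma> (snd x) T) (Some T)}
        | None \<Rightarrow> cong k \<Gamma> t t')))"

text \<open>Fuel ties the mutual recursion together: each round calls only the operations of the
  round before. With no fuel left the answer is failure, or for \<open>whnf\<close> the unchanged
  type, so soundness is not affected.\<close>

primrec iter :: "ctm list \<Rightarrow> nat \<Rightarrow> ops" where
  "iter L 0 = Ops (\<lambda>_ _. None) (\<lambda>_ T. T) (\<lambda>_ _. None) (\<lambda>_ _ _. None)"
| "iter L (Suc n) = (let k = iter L n in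
     Ops (infer_step L k) (whnf_step k) (red_step k) (conv_step k))"

section \<open>Soundness\<close>

primrec lv :: "nat \<Rightarrow> lvl \<Rightarrow> nat" where
  "lv u L0 = 0"
| "lv u (LU k) = u + k"

text \<open>\<open>\<rho> g v\<close> is a proof of the \<open>g\<close>-th earlier statement at
  base level \<open>v\<close>; a citation raised by \<open>l\<close> therefore reads it at
  \<open>u + l\<close>.\<close>

primrec I :: "(nat \<Rightarrow> nat \<Rightarrow> tm) \<Rightarrow> nat \<Rightarrow> ctm \<Rightarrow> tm" where
  "I \<rho> u (CV n) = Var n"
| "I \<rho> u (CU l) = Univ (lv u l)"
| "I \<rho> u (CG g l) = \<rho> g (u + l)"
| "I \<rho> u (CPi A B) = Pi (I \<rho> u A) (I \<rho> u B)"
| "I \<rho> u (CLam A b) = Lam (I \<rho> u A) (I \<rho> u b)"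
| "I \<rho> u (CApp f a) = App (I \<rho> u f) (I \<rho> u a)"
| "I \<rho> u (CSig A B) = Sig (I \<rho> u A) (I \<rho> u B)"
| "I \<rho> u (CTup B a b) = Tup (I \<rho> u B) (I \<rho> u a) (I \<rho> u b)"
| "I \<rho> u (CSigE C c p) = SigE (I \<rho> u C) (I \<rho> u c) (I \<rho> u p)"
| "I \<rho> u CNat = NatT"
| "I \<rho> u CZero = Zero"
| "I \<rho> u (CSucc n) = Succ (I \<rho> u n)"
| "I \<rho> u (CNatE C z s n) = NatE (I \<rho> u C) (I \<rho> u z) (I \<rho> u s) (I \<rho> u n)"
| "I \<rho> u (CEq A a b) = Eq (I \<rho> u A) (I \<rho> u a) (I \<rho> u b)"
| "I \<rho> u (CRefl a) = Refl (I \<rho> u a)"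
| "I \<rho> u (CEqE C d a b p) = EqE (I \<rho> u C) (I \<rho> u d) (I \<rho> u a) (I \<rho> u b) (I \<rho> u p)"

section \<open>Interpretation of checker terms\<close>

lemma I_shl: "I \<rho> u (shl l t) = I \<rho> (u + l) t"
proof (induction t)
  case (CU x)
  then show ?case by (cases x) auto
qed (auto simp: add.commute add.left_commute)

lemma lv_lmax: "lv u (lmax i j) = max (lv u i) (lv u j)"
  by (cases "(i, j)" rule: lmax.cases) auto

lemma gty_Some: "gty L g l = Some T \<Longrightarrow> g < length L \<and> T = shl l (L ! g)"
  by (induction L g l rule: gty.induct) auto

lemma vty_Some: "vty \<Gamma> n k = Some T \<Longrightarrow> n < length \<Gamma> \<and> T = lift 0 (n + k) (\<Gamma> ! n)"
  by (induction \<Gamma> n k rule: vty.induct) auto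

lemma upr_pow: "(upr ^^ c) r n = (if n < c then n else r (n - c) + c)"
proof (induction c arbitrary: n)
  case (Suc c)
  then show ?case by (cases n) auto
qed simp

lemma ups_pow: "(ups ^^ d) s n = (if n < d then Var n else wk d (s (n - d)))"
proof (induction d arbitrary: n)
  case (Suc d)
  then show ?case by (cases n) (auto simp: wk_wk)
qed simp

text \<open>Lifting and substitution leave a citation alone, so the cited proofs must be literally
  closed. \<open>default\<close> extends this to positions outside \<open>L\<close>, which makes
  \<open>sub_\<rho>\<close> unconditional.\<close>

locale model =
  fixes S :: "const set" and L :: "ctm list" and \<rho> :: "nat \<Rightarrow> nat \<Rightarrow> tm"
  assumes closed: "g < length L \<Longrightarrow> sub s (\<rho> g v) = \<rho> g v"
    and default: "g \<ge> length L \<Longrightarrow> \<rho> g v = Star"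
    and typed: "g < length L \<Longrightarrow> S \<parallel> [] \<turnstile> \<rho> g v \<Ztypecolon> I \<rho> v (L ! g)"
    and typed': "g < length L \<Longrightarrow> \<exists>i. S \<parallel> [] \<turnstile> I \<rho> v (L ! g) \<Ztypecolon> Univ i"
begin

lemma sub_\<rho> [simp]: "sub s (\<rho> g v) = \<rho> g v"
  using closed default by (cases "g < length L") auto

lemma ren_\<rho> [simp]: "ren r (\<rho> g v) = \<rho> g v"
  by (simp add: ren_as_sub)

lemma I_lift: "I \<rho> u (lift c k t) = ren ((upr ^^ c) (\<lambda>n. n + k)) (I \<rho> u t)"
  by (induction t arbitrary: c) (simp_all add: upr_pow)

primrec sc :: "nat \<Rightarrow> ctm list \<Rightarrow> nat \<Rightarrow> nat \<Rightarrow> tm" where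
  "sc u [] w = (\<lambda>n. Var (n + w))"
| "sc u (t # ts) w = I \<rho> u t \<cdot> sc u ts w"

lemma I_lift0: "I \<rho> u (lift 0 k t) = wk k (I \<rho> u t)"
  by (simp add: I_lift wk_def)

lemma I_pick: "I \<rho> u (pick d ts w m) = wk d (sc u ts w m)"
  by (induction d ts w m rule: pick.induct) (auto simp: I_lift0)

lemma I_cs: "I \<rho> u (cs d ts w t) = sub ((ups ^^ d) (sc u ts w)) (I \<rho> u t)"
  by (induction t arbitrary: d) (simp_all add: ups_pow I_pick)

lemma I_inst: "I \<rho> u (cs 0 [a] 0 t) = (I \<rho> u t)\<langle>I \<rho> u a\<rangle>"
  by (simp add: I_cs inst_def)

lemma I_inst_wk: "I \<rho> u (cs 0 [a] 2 t) = inst_wk 2 (I \<rho> u a) (I \<rho> u t)"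
  by (simp add: I_cs inst_wk_def)

lemma I_simps: "I \<rho> u (cs 0 [b, a] 0 t) = sub (I \<rho> u b \<cdot> I \<rho> u a \<cdot> Var) (I \<rho> u t)"
  "I \<rho> u (cs 0 [p, b, a] 0 t) = sub (I \<rho> u p \<cdot> I \<rho> u b \<cdot> I \<rho> u a \<cdot> Var) (I \<rho> u t)"
  "I \<rho> u (cs 0 [CRefl (CV 0), CV 0, CV 0] 1 t) =
     sub (Refl (Var 0) \<cdot> Var 0 \<cdot> Var 0 \<cdot> (\<lambda>n. Var (n + 1))) (I \<rho> u t)"
  "I \<rho> u (lift 1 2 t) = ren (upr (\<lambda>n. n + 2)) (I \<rho> u t)"
  by (simp_all add: I_cs I_lift)

lemmas I_simps' = I_inst I_inst_wk I_simps I_simps[unfolded One_nat_def]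

end

locale model_at = model + fixes u :: nat
begin

abbreviation J :: "ctm \<Rightarrow> tm" where "J \<equiv> I \<rho> u"
abbreviation wf :: "ctm list \<Rightarrow> bool" where "wf \<Gamma> \<equiv> S \<parallel> map J \<Gamma> \<turnstile>"
abbreviation has :: "ctm list \<Rightarrow> ctm \<Rightarrow> ctm \<Rightarrow> bool" where "has \<Gamma> t T \<equiv> S \<parallel> map J \<Gamma> \<turnstile> J t \<Ztypecolon> J T"
abbreviation jeqs :: "ctm list \<Rightarrow> ctm \<Rightarrow> ctm \<Rightarrow> ctm \<Rightarrow> bool" where
  "jeqs \<Gamma> t t' T \<equiv> S \<parallel> map J \<Gamma> \<turnstile> J t \<simeq> J t' \<Ztypecolon> J T"
definition isT where "isT \<Gamma> T \<longleftrightarrow> (\<exists>i. S \<parallel> map J \<Gamma> \<turnstile> J T \<Ztypecolon> Univ i)"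
text \<open>
  The reflexive transitive closure is needed because equalities at different universe levels do not compose.
\<close>

definition teq where
  "teq \<Gamma> T T' \<longleftrightarrow> (\<lambda>X Y. \<exists>i. S \<parallel> map J \<Gamma> \<turnstile> X \<simeq> Y \<Ztypecolon> Univ i)\<^sup>*\<^sup>* (J T) (J T')"

section \<open>Invariants of the checker\<close>

definition good_infer where
  "good_infer k \<longleftrightarrow> (\<forall>\<Gamma> t T. infer k \<Gamma> t = Some T \<longrightarrow> wf \<Gamma> \<longrightarrow> has \<Gamma> t T \<and> isT \<Gamma> T)"
definition good_whnf where
  "good_whnf k \<longleftrightarrow> (\<forall>\<Gamma> T. wf \<Gamma> \<longrightarrow> isT \<Gamma> T \<longrightarrow> isT \<Gamma> (whnf k \<Gamma> T) \<and> teq \<Gamma> T (whnf k \<Gamma> T))"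
definition good_red where
  "good_red k \<longleftrightarrow> (\<forall>\<Gamma> t t' T. red k \<Gamma> t = Some (t', T) \<longrightarrow> wf \<Gamma> \<longrightarrow>
     has \<Gamma> t T \<and> has \<Gamma> t' T \<and> jeqs \<Gamma> t t' T \<and> isT \<Gamma> T)"
text \<open>Typing is claimed for the left term only. For the right term the binder cases would
  require replacing a type in the context by an equal one.\<close>

definition good_conv where
  "good_conv k \<longleftrightarrow> (\<forall>\<Gamma> t t' T. conv k \<Gamma> t t' = Some T \<longrightarrow> wf \<Gamma> \<longrightarrow> has \<Gamma> t T \<and> jeqs \<Gamma> t t' T \<and> isT \<Gamma> T)"
definition good where
  "good k \<longleftrightarrow> good_infer k \<and> good_whnf k \<and> good_red k \<and> good_conv k"

lemma teq_has_aux: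
  "(\<lambda>X Y. \<exists>i. S \<parallel> \<Gamma> \<turnstile> X \<simeq> Y \<Ztypecolon> Univ i)\<^sup>*\<^sup>* A B \<Longrightarrow> S \<parallel> \<Gamma> \<turnstile> t \<Ztypecolon> A \<Longrightarrow> S \<parallel> \<Gamma> \<turnstile> t \<Ztypecolon> B"
  "(\<lambda>X Y. \<exists>i. S \<parallel> \<Gamma> \<turnstile> X \<simeq> Y \<Ztypecolon> Univ i)\<^sup>*\<^sup>* A B \<Longrightarrow> S \<parallel> \<Gamma> \<turnstile> t \<simeq> t' \<Ztypecolon> A \<Longrightarrow> S \<parallel> \<Gamma> \<turnstile> t \<simeq> t' \<Ztypecolon> B"
  by (induction rule: rtranclp_induct) (blast intro: ty_conv eq_conv)+

lemma teq_has: "has \<Gamma> t T \<Longrightarrow> teq \<Gamma> T T' \<Longrightarrow> has \<Gamma> t T'"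
  unfolding teq_def by (rule teq_has_aux)

lemma teq_jeqs: "jeqs \<Gamma> t t' T \<Longrightarrow> teq \<Gamma> T T' \<Longrightarrow> jeqs \<Gamma> t t' T'"
  unfolding teq_def by (rule teq_has_aux)

lemma teq_refl: "teq \<Gamma> T T"
  by (simp add: teq_def)

lemma teq_step: "S \<parallel> map J \<Gamma> \<turnstile> J T \<simeq> J T' \<Ztypecolon> Univ i \<Longrightarrow> teq \<Gamma> T T'"
  unfolding teq_def by blast

lemma teq_trans: "teq \<Gamma> T T' \<Longrightarrow> teq \<Gamma> T' T'' \<Longrightarrow> teq \<Gamma> T T''"
  unfolding teq_def by (rule rtranclp_trans)

lemma asU_D: "asU K = Some l \<Longrightarrow> K = CU l"
  by (cases K) auto

lemma asPi_D: "asPi F = Some (A, B) \<Longrightarrow> F = CPi A B"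
  by (cases F) auto

lemma asSig_D: "asSig F = Some (A, B) \<Longrightarrow> F = CSig A B"
  by (cases F) auto

lemma asEq_D: "asEq F = Some (A, a, b) \<Longrightarrow> F = CEq A a b"
  by (cases F) auto

lemma grd_Some: "grd b x = Some y \<longleftrightarrow> b \<and> x = Some y"
  by (simp add: grd_def)

lemma isT_Pi: "isT \<Gamma> (CPi A B) \<Longrightarrow> \<exists>i j. S \<parallel> map J \<Gamma> \<turnstile> J A \<Ztypecolon> Univ i \<and> S \<parallel> J A # map J \<Gamma> \<turnstile> J B \<Ztypecolon> Univ j"
  unfolding isT_def by (auto dest: inv_Pi)

lemma isT_Sig: "isT \<Gamma> (CSig A B) \<Longrightarrow> \<exists>i j. S \<parallel> map J \<Gamma> \<turnstile> J A \<Ztypecolon> Univ i \<and> S \<parallel> J A # map J \<Gamma> \<turnstile> J B \<Ztypecolon> Univ j"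
  unfolding isT_def by (auto dest: inv_Sig)

lemma isT_Eq: "isT \<Gamma> (CEq A a b) \<Longrightarrow> isT \<Gamma> A \<and> has \<Gamma> a A \<and> has \<Gamma> b A"
  unfolding isT_def by (auto dest: inv_Eq)

context
  fixes k assumes k: "good k"
begin

lemma infer_D: "infer k \<Gamma> t = Some T \<Longrightarrow> wf \<Gamma> \<Longrightarrow> has \<Gamma> t T \<and> isT \<Gamma> T"
  using k unfolding good_def good_infer_def by blast

lemma whnf_D: "wf \<Gamma> \<Longrightarrow> isT \<Gamma> T \<Longrightarrow> isT \<Gamma> (whnf k \<Gamma> T) \<and> teq \<Gamma> T (whnf k \<Gamma> T)"
  using k unfolding good_def good_whnf_def by blast

lemma red_D: "red k \<Gamma> t = Some (t', T) \<Longrightarrow> wf \<Gamma> \<Longrightarrow> has \<Gamma> t T \<and> has \<Gamma> t' T \<and> jeqs \<Gamma> t t' T \<and> isT \<Gamma> T"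
  using k unfolding good_def good_red_def by blast

lemma conv_D: "conv k \<Gamma> t t' = Some T \<Longrightarrow> wf \<Gamma> \<Longrightarrow> has \<Gamma> t T \<and> jeqs \<Gamma> t t' T \<and> isT \<Gamma> T"
  using k unfolding good_def good_conv_def by blast

lemma same_D: "same k \<Gamma> T T' \<Longrightarrow> wf \<Gamma> \<Longrightarrow> teq \<Gamma> T T'"
  unfolding same_def
  by (auto split: if_splits bind_splits dest!: conv_D asU_D simp: teq_refl intro: teq_step)

lemma check_D: "check k \<Gamma> t T \<Longrightarrow> wf \<Gamma> \<Longrightarrow> has \<Gamma> t T"
  unfolding check_def
  by (auto split: bind_splits simp: grd_def dest!: infer_D same_D split: if_splits intro: teq_has)

lemma level_D: "level k \<Gamma> A = Some l \<Longrightarrow> wf \<Gamma> \<Longrightarrow> S \<parallel> map J \<Gamma> \<turnstile> J A \<Ztypecolon> Univ (lv u l)"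
  unfolding level_def
  by (auto split: bind_splits dest!: infer_D asU_D) (metis I.simps(2) teq_has whnf_D)

lemma level_wf: "level k \<Gamma> A = Some l \<Longrightarrow> wf \<Gamma> \<Longrightarrow> wf (A # \<Gamma>)"
  using level_D ctx_cons by fastforce


lemma sigOK_D:
  assumes "sigOK k \<Gamma> A B C c" "wf \<Gamma>" "isT \<Gamma> (CSig A B)"
  shows "\<exists>j. S \<parallel> Sig (J A) (J B) # map J \<Gamma> \<turnstile> J C \<Ztypecolon> Univ j"
    "S \<parallel> J B # J A # map J \<Gamma> \<turnstile> J c \<Ztypecolon> inst_wk 2 (Tup (ren (upr (\<lambda>n. n + 2)) (J B)) (Var 1) (Var 0)) (J C)"
proof -
  have 1: "wf (CSig A B # \<Gamma>)" using assms(2,3) unfolding isT_def by (auto intro: ctx_cons)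
  have 2: "wf (B # A # \<Gamma>)" using isT_Sig[OF assms(3)] by (auto intro: ctx_cons dest: typing_ctx)
  show "\<exists>j. S \<parallel> Sig (J A) (J B) # map J \<Gamma> \<turnstile> J C \<Ztypecolon> Univ j"
    using assms(1) level_D[OF _ 1] unfolding sigOK_def by auto
  show "S \<parallel> J B # J A # map J \<Gamma> \<turnstile> J c \<Ztypecolon> inst_wk 2 (Tup (ren (upr (\<lambda>n. n + 2)) (J B)) (Var 1) (Var 0)) (J C)"
    using assms(1) check_D[OF _ 2, of c "cs 0 [CTup (lift 1 2 B) (CV 1) (CV 0)] 2 C"] unfolding sigOK_def by (simp add: I_simps')
qed

lemma natOK_D:
  assumes "natOK k \<Gamma> C z s" "wf \<Gamma>"
  shows "\<exists>j. S \<parallel> NatT # map J \<Gamma> \<turnstile> J C \<Ztypecolon> Univ j" "S \<parallel> map J \<Gamma> \<turnstile> J z \<Ztypecolon> (J C)\<langle>Zero\<rangle>"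
    "S \<parallel> J C # NatT # map J \<Gamma> \<turnstile> J s \<Ztypecolon> inst_wk 2 (Succ (Var 1)) (J C)"
proof -
  have 1: "wf (CNat # \<Gamma>)" using assms(2) by (auto intro: ctx_cons ty_NatT)
  show C: "\<exists>j. S \<parallel> NatT # map J \<Gamma> \<turnstile> J C \<Ztypecolon> Univ j"
    using assms(1) level_D[OF _ 1] unfolding natOK_def by auto
  then have 2: "wf (C # CNat # \<Gamma>)" using 1 by (auto intro: ctx_cons)
  show "S \<parallel> map J \<Gamma> \<turnstile> J z \<Ztypecolon> (J C)\<langle>Zero\<rangle>"
    using assms(1) check_D[OF _ assms(2), of z "cs 0 [CZero] 0 C"] unfolding natOK_def by (simp add: I_simps')
  show "S \<parallel> J C # NatT # map J \<Gamma> \<turnstile> J s \<Ztypecolon> inst_wk 2 (Succ (Var 1)) (J C)"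
    using assms(1) check_D[OF _ 2, of s "cs 0 [CSucc (CV 1)] 2 C"] unfolding natOK_def by (simp add: I_simps')
qed

lemma eqOK_D:
  assumes "eqOK k \<Gamma> A C d" "wf \<Gamma>" "isT \<Gamma> A"
  shows "\<exists>j. S \<parallel> Eq (wk 2 (J A)) (Var 1) (Var 0) # wk 1 (J A) # J A # map J \<Gamma> \<turnstile> J C \<Ztypecolon> Univ j"
    "S \<parallel> J A # map J \<Gamma> \<turnstile> J d \<Ztypecolon> sub (Refl (Var 0) \<cdot> Var 0 \<cdot> Var 0 \<cdot> (\<lambda>n. Var (n + 1))) (J C)"
proof -
  obtain i where i: "S \<parallel> map J \<Gamma> \<turnstile> J A \<Ztypecolon> Univ i" using assms(3) isT_def by auto
  have 1: "wf (CEq (lift 0 2 A) (CV 1) (CV 0) # lift 0 1 A # A # \<Gamma>)" "wf (A # \<Gamma>)"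
    using eq_ctx[OF i] by (auto simp: I_lift0)
  show "\<exists>j. S \<parallel> Eq (wk 2 (J A)) (Var 1) (Var 0) # wk 1 (J A) # J A # map J \<Gamma> \<turnstile> J C \<Ztypecolon> Univ j"
    using assms(1) level_D[OF _ 1(1)] unfolding eqOK_def by (force simp: I_lift0)
  show "S \<parallel> J A # map J \<Gamma> \<turnstile> J d \<Ztypecolon> sub (Refl (Var 0) \<cdot> Var 0 \<cdot> Var 0 \<cdot> (\<lambda>n. Var (n + 1))) (J C)"
    using assms(1) check_D[OF _ 1(2), of d "cs 0 [CRefl (CV 0), CV 0, CV 0] 1 C"] unfolding eqOK_def by (simp add: I_simps')
qed

lemma eqAt_D:
  assumes "eqAt k \<Gamma> A a b a' b'" "wf \<Gamma>" "isT \<Gamma> (CEq A a' b')"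
  shows "has \<Gamma> a A" "has \<Gamma> b A" "teq \<Gamma> (CEq A a' b') (CEq A a b)" "isT \<Gamma> A"
  using assms isT_Eq[OF assms(3)] check_D same_D unfolding eqAt_def
  by (auto split: if_splits simp: teq_refl)

text \<open>When \<open>a = x\<close> nothing is checked, so the typing has to come from outside;
  reduction knows it for \<open>x\<close>, congruence for \<open>a\<close>.\<close>

lemma sameAt_D:
  assumes "sameAt k \<Gamma> a x A" "wf \<Gamma>" "has \<Gamma> x A \<or> has \<Gamma> a A"
  shows "has \<Gamma> a A" "jeqs \<Gamma> a x A"
  using assms unfolding sameAt_def
  by (auto split: if_splits bind_splits simp: grd_def intro: eq_refl dest!: conv_D same_D intro: teq_has teq_jeqs)

lemma isT_inst:
  assumes "S \<parallel> J A # map J \<Gamma> \<turnstile> J B \<Ztypecolon> Univ j" "has \<Gamma> a A"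
  shows "isT \<Gamma> (cs 0 [a] 0 B)"
  unfolding isT_def using inst_typing[OF assms] by (auto simp: I_inst inst_def)

lemma isT_U: "wf \<Gamma> \<Longrightarrow> isT \<Gamma> (CU l)"
  unfolding isT_def by (auto intro: ty_Univ)

lemma asPi_whnf:
  assumes "asPi (whnf k \<Gamma> F) = Some (A, B)" "isT \<Gamma> F" "wf \<Gamma>"
  shows "teq \<Gamma> F (CPi A B)" "isT \<Gamma> (CPi A B)"
  using assms whnf_D asPi_D by metis+

lemma asSig_whnf:
  assumes "asSig (whnf k \<Gamma> F) = Some (A, B)" "isT \<Gamma> F" "wf \<Gamma>"
  shows "teq \<Gamma> F (CSig A B)" "isT \<Gamma> (CSig A B)"
  using assms whnf_D asSig_D by metis+

lemma asEq_whnf: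
  assumes "asEq (whnf k \<Gamma> F) = Some (A, a, b)" "isT \<Gamma> F" "wf \<Gamma>"
  shows "teq \<Gamma> F (CEq A a b)" "isT \<Gamma> (CEq A a b)"
  using assms whnf_D asEq_D by metis+

section \<open>Typing of applications, eliminators and pairs\<close>

lemma has_App:
  assumes "has \<Gamma> f F" "isT \<Gamma> F" "asPi (whnf k \<Gamma> F) = Some (A, B)" "check k \<Gamma> a A" "wf \<Gamma>"
  shows "has \<Gamma> (CApp f a) (cs 0 [a] 0 B)" "isT \<Gamma> (cs 0 [a] 0 B)"
proof -
  note F = asPi_whnf[OF assms(3,2,5)]
  have a: "has \<Gamma> a A" using check_D[OF assms(4,5)] .
  have "has \<Gamma> f (CPi A B)" using teq_has[OF assms(1) F(1)] .
  then show "has \<Gamma> (CApp f a) (cs 0 [a] 0 B)" using ty_App a by (simp add: I_inst)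
  show "isT \<Gamma> (cs 0 [a] 0 B)" using isT_Pi[OF F(2)] a isT_inst by blast
qed

lemma has_SigE:
  assumes "has \<Gamma> p (CSig A B)" "isT \<Gamma> (CSig A B)" "sigOK k \<Gamma> A B C c" "wf \<Gamma>"
  shows "has \<Gamma> (CSigE C c p) (cs 0 [p] 0 C)" "isT \<Gamma> (cs 0 [p] 0 C)"
proof -
  note D = sigOK_D[OF assms(3,4,2)]
  show "has \<Gamma> (CSigE C c p) (cs 0 [p] 0 C)"
    using D ty_SigE assms(1) by (fastforce simp: I_inst)
  show "isT \<Gamma> (cs 0 [p] 0 C)"
    using D(1) assms(1) isT_inst[of "CSig A B"] by auto
qed

lemma has_NatE:
  assumes "natOK k \<Gamma> C z s" "has \<Gamma> n CNat" "wf \<Gamma>"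
  shows "has \<Gamma> (CNatE C z s n) (cs 0 [n] 0 C)" "isT \<Gamma> (cs 0 [n] 0 C)"
proof -
  note D = natOK_D[OF assms(1,3)]
  show "has \<Gamma> (CNatE C z s n) (cs 0 [n] 0 C)"
    using D ty_NatE assms(2) by (fastforce simp: I_inst)
  show "isT \<Gamma> (cs 0 [n] 0 C)"
    using D(1) assms(2) isT_inst[of CNat] by auto
qed

lemma has_EqE:
  assumes "eqOK k \<Gamma> A C d" "has \<Gamma> a A" "has \<Gamma> b A" "has \<Gamma> p (CEq A a b)" "isT \<Gamma> A" "wf \<Gamma>"
  shows "has \<Gamma> (CEqE C d a b p) (cs 0 [p, b, a] 0 C)" "isT \<Gamma> (cs 0 [p, b, a] 0 C)"
proof -
  note D = eqOK_D[OF assms(1,6,5)]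
  show "has \<Gamma> (CEqE C d a b p) (cs 0 [p, b, a] 0 C)"
    using D ty_EqE assms(2-4) by (fastforce simp: I_simps)
  show "isT \<Gamma> (cs 0 [p, b, a] 0 C)"
    using D(1) assms(2-4) inst3_typing unfolding isT_def by (fastforce simp: I_simps)
qed

lemma has_Tup:
  assumes "has \<Gamma> a A" "isT \<Gamma> A" "level k (A # \<Gamma>) B = Some j" "check k \<Gamma> b (cs 0 [a] 0 B)" "wf \<Gamma>"
  shows "has \<Gamma> (CTup B a b) (CSig A B)" "isT \<Gamma> (CSig A B)" "has \<Gamma> b (cs 0 [a] 0 B)"
    "S \<parallel> J A # map J \<Gamma> \<turnstile> J B \<Ztypecolon> Univ (lv u j)"
proof -
  obtain i where i: "S \<parallel> map J \<Gamma> \<turnstile> J A \<Ztypecolon> Univ i" using assms(2) isT_def by auto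
  have w: "wf (A # \<Gamma>)" using i assms(5) by (auto intro: ctx_cons)
  show B: "S \<parallel> J A # map J \<Gamma> \<turnstile> J B \<Ztypecolon> Univ (lv u j)" using level_D[OF assms(3) w] by simp
  show b: "has \<Gamma> b (cs 0 [a] 0 B)" using check_D[OF assms(4,5)] .
  show "has \<Gamma> (CTup B a b) (CSig A B)" using ty_Tup[OF B assms(1)] b by (simp add: I_inst)
  show "isT \<Gamma> (CSig A B)" unfolding isT_def using ty_Sig[OF i B] by auto
qed

lemma infer_step_good:
  assumes t: "infer_step L k \<Gamma> t = Some T" and w: "wf \<Gamma>"
  shows "has \<Gamma> t T \<and> isT \<Gamma> T"
proof (cases t)
  case (CV n)
  then have n: "n < length \<Gamma>" and T: "T = lift 0 (Suc n) (\<Gamma> ! n)"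
    using t vty_Some by (fastforce simp: infer_step_def)+
  then show ?thesis
    using ctx_lookup[OF w, of n] ty_Var[OF w, of n] CV by (simp add: I_lift0 isT_def)
next
  case (CU l)
  then show ?thesis using t w by (auto simp: infer_step_def split: lvl.splits intro: ty_Univ isT_U)
next
  case (CG g l)
  then have g: "g < length L" "T = shl l (L ! g)" using t gty_Some by (fastforce simp: infer_step_def)+
  obtain i where "S \<parallel> [] \<turnstile> I \<rho> (u + l) (L ! g) \<Ztypecolon> Univ i" using typed'[OF g(1)] by blast
  from weaken_closed[OF w this] weaken_closed[OF w typed[OF g(1)]] show ?thesis
    by (auto simp: I_shl isT_def CG g)
next
  case (CPi A B)
  then obtain i j where *: "level k \<Gamma> A = Some i" "level k (A # \<Gamma>) B = Some j" "T = CU (lmax i j)"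
    using t by (auto simp: infer_step_def bind_eq_Some_conv)
  with level_D[OF *(1) w] level_D[OF *(2) level_wf[OF *(1) w]] isT_U[OF w] CPi show ?thesis
    by (auto simp: lv_lmax intro: ty_Pi)
next
  case (CLam A b)
  then obtain i B where *: "level k \<Gamma> A = Some i" "infer k (A # \<Gamma>) b = Some B" "T = CPi A B"
    using t by (auto simp: infer_step_def bind_eq_Some_conv)
  with level_D[OF *(1) w] infer_D[OF *(2) level_wf[OF *(1) w]] CLam show ?thesis
    by (auto simp: isT_def intro: ty_Lam ty_Pi)
next
  case (CApp f a)
  then obtain F A B where "infer k \<Gamma> f = Some F" "asPi (whnf k \<Gamma> F) = Some (A, B)" "check k \<Gamma> a A"
      "T = cs 0 [a] 0 B"
    using t by (auto simp: infer_step_def bind_eq_Some_conv grd_Some)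
  then show ?thesis using has_App infer_D w CApp by blast
next
  case (CSig A B)
  then obtain i j where *: "level k \<Gamma> A = Some i" "level k (A # \<Gamma>) B = Some j" "T = CU (lmax i j)"
    using t by (auto simp: infer_step_def bind_eq_Some_conv)
  with level_D[OF *(1) w] level_D[OF *(2) level_wf[OF *(1) w]] isT_U[OF w] CSig show ?thesis
    by (auto simp: lv_lmax intro: ty_Sig)
next
  case (CTup B a b)
  then obtain A j where *: "infer k \<Gamma> a = Some A" "level k (A # \<Gamma>) B = Some j" "check k \<Gamma> b (cs 0 [a] 0 B)"
      "T = CSig A B"
    using t by (auto simp: infer_step_def bind_eq_Some_conv grd_Some)
  then show ?thesis using has_Tup infer_D[OF *(1) w] w CTup by blast
next
  case (CSigE C c p)
  then obtain P A B where P: "infer k \<Gamma> p = Some P" "asSig (whnf k \<Gamma> P) = Some (A, B)" "sigOK k \<Gamma> A B C c"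
      "T = cs 0 [p] 0 C"
    using t by (auto simp: infer_step_def bind_eq_Some_conv grd_Some)
  note P1 = infer_D[OF P(1) w]
  note E = asSig_whnf[OF P(2) conjunct2[OF P1] w]
  have "has \<Gamma> p (CSig A B)" using P1 E(1) teq_has by blast
  then show ?thesis using has_SigE[OF _ E(2) P(3) w] CSigE P(4) by blast
next
  case CNat
  then show ?thesis using t w isT_U by (auto simp: infer_step_def intro: ty_NatT)
next
  case CZero
  then show ?thesis using t w by (auto simp: infer_step_def isT_def intro: ty_NatT ty_Zero)
next
  case (CSucc n)
  then show ?thesis using t w check_D[of \<Gamma> n CNat]
    by (auto simp: infer_step_def isT_def grd_Some intro: ty_NatT ty_Succ)
next
  case (CNatE C z s n)
  then show ?thesis using t w has_NatE check_D[of \<Gamma> n CNat] by (auto simp: infer_step_def grd_Some)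
next
  case (CEq A a b)
  then show ?thesis using t w level_D check_D isT_U
    by (auto simp: infer_step_def bind_eq_Some_conv grd_Some intro!: ty_Eq)
next
  case (CRefl a)
  then obtain A where A: "infer k \<Gamma> a = Some A" "T = CEq A a a"
    using t by (auto simp: infer_step_def bind_eq_Some_conv)
  then show ?thesis using infer_D[OF A(1) w] CRefl by (auto simp: isT_def intro: ty_Eq ty_Refl)
next
  case (CEqE C d a b p)
  then obtain P A a' b' where P: "infer k \<Gamma> p = Some P" "asEq (whnf k \<Gamma> P) = Some (A, a', b')"
      "eqAt k \<Gamma> A a b a' b'" "eqOK k \<Gamma> A C d" "T = cs 0 [p, b, a] 0 C"
    using t by (auto simp: infer_step_def bind_eq_Some_conv grd_Some)
  note P1 = infer_D[OF P(1) w]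
  note E = asEq_whnf[OF P(2) conjunct2[OF P1] w]
  note E' = eqAt_D[OF P(3) w E(2)]
  have "has \<Gamma> p (CEq A a b)" using P1 E E' teq_has by blast
  then show ?thesis using has_EqE[OF P(4)] E' w CEqE P(5) by blast
qed

lemma whnf_step_good:
  assumes "wf \<Gamma>" "isT \<Gamma> T"
  shows "isT \<Gamma> (whnf_step k \<Gamma> T) \<and> teq \<Gamma> T (whnf_step k \<Gamma> T)"
proof (cases "red k \<Gamma> T")
  case None
  then show ?thesis using assms by (simp add: whnf_step_def teq_refl)
next
  case (Some x)
  then obtain T' K where r: "red k \<Gamma> T = Some (T', K)" by (cases x) auto
  show ?thesis
  proof (cases "asU K")
    case None
    then show ?thesis using assms r by (simp add: whnf_step_def teq_refl)
  next
    case (Some l)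
    note K = asU_D[OF Some]
    have T': "isT \<Gamma> T'" "S \<parallel> map J \<Gamma> \<turnstile> J T \<simeq> J T' \<Ztypecolon> Univ (lv u l)"
      using red_D[OF r assms(1)] K by (auto simp: isT_def)
    have W: "isT \<Gamma> (whnf k \<Gamma> T')" "teq \<Gamma> T' (whnf k \<Gamma> T')" using whnf_D assms(1) T' by auto
    have "teq \<Gamma> T (whnf k \<Gamma> T')" using teq_step[OF T'(2)] W(2) by (rule teq_trans)
    then show ?thesis using W r Some by (simp add: whnf_step_def)
  qed
qed

section \<open>Soundness of reduction\<close>

abbreviation red_ok where
  "red_ok \<Gamma> t t' T \<equiv> has \<Gamma> t T \<and> has \<Gamma> t' T \<and> jeqs \<Gamma> t t' T \<and> isT \<Gamma> T"

lemma red_app_good: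
  assumes "red_app k \<Gamma> f a = Some (t', T)" "wf \<Gamma>"
  shows "red_ok \<Gamma> (CApp f a) t' T"
proof -
  obtain f' F A B where *: "red k \<Gamma> f = Some (f', F)" "asPi (whnf k \<Gamma> F) = Some (A, B)" "check k \<Gamma> a A"
      "t' = CApp f' a" "T = cs 0 [a] 0 B"
    using assms(1) by (auto simp: red_app_def bind_eq_Some_conv grd_Some)
  note R = red_D[OF *(1) assms(2)]
  have a: "has \<Gamma> a A" using check_D[OF *(3) assms(2)] .
  have "jeqs \<Gamma> f f' (CPi A B)" using asPi_whnf[OF *(2) _ assms(2)] R teq_jeqs by blast
  then have "jeqs \<Gamma> (CApp f a) t' T" using cong_App eq_refl[OF a] by (simp add: * I_inst)
  then show ?thesis using has_App[OF _ _ *(2,3) assms(2)] R * by blast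
qed

lemma red_beta_good:
  assumes "level k \<Gamma> A = Some i" "infer k (A # \<Gamma>) b = Some B" "check k \<Gamma> a A" "wf \<Gamma>"
  shows "red_ok \<Gamma> (CApp (CLam A b) a) (cs 0 [a] 0 b) (cs 0 [a] 0 B)"
proof -
  note A = level_D[OF assms(1,4)]
  have w: "wf (A # \<Gamma>)" using level_wf[OF assms(1,4)] .
  note b = infer_D[OF assms(2) w]
  have a: "has \<Gamma> a A" using check_D[OF assms(3,4)] .
  obtain j where "S \<parallel> J A # map J \<Gamma> \<turnstile> J B \<Ztypecolon> Univ j" using b by (auto simp: isT_def)
  then have "isT \<Gamma> (cs 0 [a] 0 B)" using a isT_inst by blast
  moreover have "has \<Gamma> (CApp (CLam A b) a) (cs 0 [a] 0 B)"
    using ty_App[OF ty_Lam[OF A] a] b by (simp add: I_inst)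
  moreover have "has \<Gamma> (cs 0 [a] 0 b) (cs 0 [a] 0 B)"
    using inst_typing[OF _ a] b by (simp add: I_inst)
  moreover have "jeqs \<Gamma> (CApp (CLam A b) a) (cs 0 [a] 0 b) (cs 0 [a] 0 B)"
    using beta_Pi[OF _ a] b by (simp add: I_inst)
  ultimately show ?thesis by blast
qed

lemma red_sig_good:
  assumes "red_sig k \<Gamma> C c p = Some (t', T)" "wf \<Gamma>"
  shows "red_ok \<Gamma> (CSigE C c p) t' T"
proof -
  obtain p' P A B where *: "red k \<Gamma> p = Some (p', P)" "asSig (whnf k \<Gamma> P) = Some (A, B)"
      "sigOK k \<Gamma> A B C c" "t' = CSigE C c p'" "T = cs 0 [p] 0 C"
    using assms(1) by (auto simp: red_sig_def bind_eq_Some_conv grd_Some)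
  note R = red_D[OF *(1) assms(2)]
  note P = asSig_whnf[OF *(2) _ assms(2)]
  have E: "isT \<Gamma> (CSig A B)" using P R by blast
  have p: "has \<Gamma> p (CSig A B)" "has \<Gamma> p' (CSig A B)" "jeqs \<Gamma> p p' (CSig A B)"
    using P R teq_has teq_jeqs by blast+
  note D = sigOK_D[OF *(3) assms(2) E]
  obtain j where C: "S \<parallel> Sig (J A) (J B) # map J \<Gamma> \<turnstile> J C \<Ztypecolon> Univ j" using D(1) by blast
  have "jeqs \<Gamma> (CSigE C c p) t' T"
    using cong_SigE[OF eq_refl[OF C] eq_refl[OF D(2)]] p(3) by (simp add: * I_inst)
  \<comment> \<open>Reducing the scrutinee changes the type of the whole term from \<open>C\<close>
    at \<open>p\<close> to \<open>C\<close> at \<open>p'\<close>; \<open>functionality\<close> leads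
    back to the former.\<close>
  moreover have "S \<parallel> map J \<Gamma> \<turnstile> (J C)\<langle>J p'\<rangle> \<simeq> (J C)\<langle>J p\<rangle> \<Ztypecolon> Univ j"
    using functionality[OF C] p by (simp add: eq_sym)
  then have "has \<Gamma> t' T"
    using has_SigE(1)[OF p(2) E *(3) assms(2)] by (simp add: * I_inst) (rule ty_conv)
  ultimately show ?thesis using has_SigE[OF p(1) E *(3) assms(2)] * by blast
qed

lemma red_sig_beta_good:
  assumes "infer k \<Gamma> a = Some A" "level k (A # \<Gamma>) B = Some j" "check k \<Gamma> b (cs 0 [a] 0 B)"
    "sigOK k \<Gamma> A B C c" "wf \<Gamma>"
  shows "red_ok \<Gamma> (CSigE C c (CTup B a b)) (cs 0 [b, a] 0 c) (cs 0 [CTup B a b] 0 C)"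
proof -
  note A = infer_D[OF assms(1,5)]
  note T = has_Tup[OF conjunct1[OF A] conjunct2[OF A] assms(2,3,5)]
  note D = sigOK_D[OF assms(4,5) T(2)]
  obtain l where C: "S \<parallel> Sig (J A) (J B) # map J \<Gamma> \<turnstile> J C \<Ztypecolon> Univ l" using D(1) by blast
  have ab: "has \<Gamma> a A" "S \<parallel> map J \<Gamma> \<turnstile> J b \<Ztypecolon> (J B)\<langle>J a\<rangle>" using A T(3) by (auto simp: I_inst)
  have "wsub S (map J \<Gamma>) (J b \<cdot> J a \<cdot> Var) (J B # J A # map J \<Gamma>)"
    using ab by (intro wsub_Cons wsub_Var assms(5)) (auto simp: inst_def)
  from substitution[OF this assms(5) D(2)]
  have "S \<parallel> map J \<Gamma> \<turnstile> sub (J b \<cdot> J a \<cdot> Var) (J c) \<Ztypecolon>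
      sub (J b \<cdot> J a \<cdot> Var) (inst_wk 2 (Tup (ren (upr (\<lambda>n. n + 2)) (J B)) (Var 1) (Var 0)) (J C))" .
  moreover have "sub (J b \<cdot> J a \<cdot> Var) (inst_wk 2 (Tup (ren (upr (\<lambda>n. n + 2)) (J B)) (Var 1) (Var 0)) (J C))
      = (J C)\<langle>Tup (J B) (J a) (J b)\<rangle>"
  proof -
    have "sub (ups (J b \<cdot> J a \<cdot> Var) \<circ> upr (\<lambda>n. n + 2)) (J B) = sub Var (J B)"
      by (rule sub_cong, rename_tac v, case_tac v) auto
    then show ?thesis
      unfolding inst_wk_def inst_def sub_sub
      by (intro sub_cong, rename_tac v, case_tac v) (auto simp: sub_ren)
  qed
  ultimately have "has \<Gamma> (cs 0 [b, a] 0 c) (cs 0 [CTup B a b] 0 C)" by (simp add: I_simps')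
  moreover have "jeqs \<Gamma> (CSigE C c (CTup B a b)) (cs 0 [b, a] 0 c) (cs 0 [CTup B a b] 0 C)"
    using beta_Sig[OF C D(2) ab] by (simp add: I_simps')
  ultimately show ?thesis using has_SigE[OF T(1,2) assms(4,5)] by blast
qed

lemma red_nat_good:
  assumes "natOK k \<Gamma> C z s" "wf \<Gamma>"
  shows "red_ok \<Gamma> (CNatE C z s CZero) z (cs 0 [CZero] 0 C)"
    "has \<Gamma> n CNat \<Longrightarrow> red_ok \<Gamma> (CNatE C z s (CSucc n)) (cs 0 [CNatE C z s n, n] 0 s) (cs 0 [CSucc n] 0 C)"
proof -
  note D = natOK_D[OF assms]
  obtain j where C: "S \<parallel> NatT # map J \<Gamma> \<turnstile> J C \<Ztypecolon> Univ j" using D(1) by blast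
  have "has \<Gamma> CZero CNat" using assms(2) by (auto intro: ty_Zero)
  then show "red_ok \<Gamma> (CNatE C z s CZero) z (cs 0 [CZero] 0 C)"
    using has_NatE[OF assms(1) _ assms(2), of CZero] beta_Zero[OF C D(2,3)] D(2) by (simp add: I_simps')
  assume n: "has \<Gamma> n CNat"
  then have Sn: "has \<Gamma> (CSucc n) CNat" by (auto intro: ty_Succ)
  have r: "S \<parallel> map J \<Gamma> \<turnstile> NatE (J C) (J z) (J s) (J n) \<Ztypecolon> (J C)\<langle>J n\<rangle>"
    using has_NatE(1)[OF assms(1) n assms(2)] by (simp add: I_simps')
  have "wsub S (map J \<Gamma>) (NatE (J C) (J z) (J s) (J n) \<cdot> J n \<cdot> Var) (J C # NatT # map J \<Gamma>)"
    using n r by (intro wsub_Cons wsub_Var assms(2)) (auto simp: inst_def)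
  from substitution[OF this assms(2) D(3)]
  have "S \<parallel> map J \<Gamma> \<turnstile> sub (NatE (J C) (J z) (J s) (J n) \<cdot> J n \<cdot> Var) (J s) \<Ztypecolon>
      sub (NatE (J C) (J z) (J s) (J n) \<cdot> J n \<cdot> Var) (inst_wk 2 (Succ (Var 1)) (J C))" .
  moreover have "sub (NatE (J C) (J z) (J s) (J n) \<cdot> J n \<cdot> Var) (inst_wk 2 (Succ (Var 1)) (J C)) = (J C)\<langle>Succ (J n)\<rangle>"
    unfolding inst_wk_def inst_def sub_sub
    by (intro sub_cong, rename_tac v, case_tac v) auto
  ultimately have "has \<Gamma> (cs 0 [CNatE C z s n, n] 0 s) (cs 0 [CSucc n] 0 C)" by (simp add: I_simps')
  then show "red_ok \<Gamma> (CNatE C z s (CSucc n)) (cs 0 [CNatE C z s n, n] 0 s) (cs 0 [CSucc n] 0 C)"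
    using has_NatE[OF assms(1) Sn assms(2)] beta_Succ[OF C D(2,3)] n by (simp add: I_simps')
qed

lemma red_eq_good:
  assumes "red_eq k \<Gamma> C d a b p = Some (t', T)" "wf \<Gamma>"
  shows "red_ok \<Gamma> (CEqE C d a b p) t' T"
proof -
  obtain p' P A a' b' where *: "red k \<Gamma> p = Some (p', P)" "asEq (whnf k \<Gamma> P) = Some (A, a', b')"
      "eqAt k \<Gamma> A a b a' b'" "eqOK k \<Gamma> A C d" "t' = CEqE C d a b p'" "T = cs 0 [p, b, a] 0 C"
    using assms(1) by (auto simp: red_eq_def bind_eq_Some_conv grd_Some)
  note R = red_D[OF *(1) assms(2)]
  have P: "teq \<Gamma> P (CEq A a' b')" "isT \<Gamma> (CEq A a' b')" using asEq_whnf[OF *(2) _ assms(2)] R by blast+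
  note E = eqAt_D[OF *(3) assms(2) P(2)]
  have p: "has \<Gamma> p (CEq A a b)" "has \<Gamma> p' (CEq A a b)" "jeqs \<Gamma> p p' (CEq A a b)"
    using P(1) E(3) R teq_has teq_jeqs by blast+
  note D = eqOK_D[OF *(4) assms(2) E(4)]
  obtain j where C: "S \<parallel> Eq (wk 2 (J A)) (Var 1) (Var 0) # wk 1 (J A) # J A # map J \<Gamma> \<turnstile> J C \<Ztypecolon> Univ j"
    using D(1) by blast
  obtain i where A: "S \<parallel> map J \<Gamma> \<turnstile> J A \<Ztypecolon> Univ i" using E(4) by (auto simp: isT_def)
  have "jeqs \<Gamma> (CEqE C d a b p) t' T"
    using cong_EqE[OF eq_refl[OF C] eq_refl[OF D(2)] eq_refl[OF E(1)] eq_refl[OF E(2)]] p(3)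
    by (simp add: * I_simps')
  moreover have "S \<parallel> map J \<Gamma> \<turnstile> sub (J p' \<cdot> J b \<cdot> J a \<cdot> Var) (J C) \<simeq> sub (J p \<cdot> J b \<cdot> J a \<cdot> Var) (J C) \<Ztypecolon> Univ j"
    using functionality3[OF A C E(1,2) _ E(1,2) _ eq_refl[OF E(1)] eq_refl[OF E(2)]] p by (simp add: eq_sym)
  then have "has \<Gamma> t' T"
    using has_EqE(1)[OF *(4) E(1,2) p(2) E(4) assms(2)] by (simp add: * I_simps') (rule ty_conv)
  ultimately show ?thesis using has_EqE[OF *(4) E(1,2) p(1) E(4) assms(2)] * by blast
qed

text \<open>The end points \<open>a\<close> and \<open>b\<close> are only convertible to
  \<open>x\<close>, whereas \<open>beta_Eq\<close> wants \<open>x\<close> twice. Congruence first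
  replaces them by \<open>x\<close>, then beta applies, and \<open>functionality3\<close> transfers
  the result to the type over \<open>a\<close> and \<open>b\<close>.\<close>

lemma red_refl_good:
  assumes "infer k \<Gamma> x = Some A" "eqOK k \<Gamma> A C d" "sameAt k \<Gamma> a x A" "sameAt k \<Gamma> b x A" "wf \<Gamma>"
  shows "red_ok \<Gamma> (CEqE C d a b (CRefl x)) (cs 0 [x] 0 d) (cs 0 [CRefl x, b, a] 0 C)"
proof -
  note X = infer_D[OF assms(1,5)]
  have a: "has \<Gamma> a A" "jeqs \<Gamma> a x A" and b: "has \<Gamma> b A" "jeqs \<Gamma> b x A"
    using sameAt_D[OF assms(3,5)] sameAt_D[OF assms(4,5)] X by blast+
  obtain i where A: "S \<parallel> map J \<Gamma> \<turnstile> J A \<Ztypecolon> Univ i" using X by (auto simp: isT_def)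
  have x: "has \<Gamma> x A" using X by blast
  note D = eqOK_D[OF assms(2,5) conjunct2[OF X]]
  obtain j where C: "S \<parallel> Eq (wk 2 (J A)) (Var 1) (Var 0) # wk 1 (J A) # J A # map J \<Gamma> \<turnstile> J C \<Ztypecolon> Univ j"
    using D(1) by blast
  have q: "S \<parallel> map J \<Gamma> \<turnstile> Eq (J A) (J x) (J x) \<simeq> Eq (J A) (J a) (J b) \<Ztypecolon> Univ i"
    using cong_Eq[OF eq_refl[OF A] a(2) b(2)] by (rule eq_sym)
  have p: "S \<parallel> map J \<Gamma> \<turnstile> Refl (J x) \<Ztypecolon> Eq (J A) (J x) (J x)" using x by (rule ty_Refl)
  then have p': "S \<parallel> map J \<Gamma> \<turnstile> Refl (J x) \<Ztypecolon> Eq (J A) (J a) (J b)" using q by (rule ty_conv)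
  have F: "S \<parallel> map J \<Gamma> \<turnstile> sub (Refl (J x) \<cdot> J x \<cdot> J x \<cdot> Var) (J C) \<simeq> sub (Refl (J x) \<cdot> J b \<cdot> J a \<cdot> Var) (J C) \<Ztypecolon> Univ j"
    using functionality3[OF A C a(1) b(1) p' x x p a(2) b(2) eq_refl[OF p']] by (rule eq_sym)
  have "S \<parallel> map J \<Gamma> \<turnstile> (J d)\<langle>J x\<rangle> \<Ztypecolon>
      (sub (Refl (Var 0) \<cdot> Var 0 \<cdot> Var 0 \<cdot> (\<lambda>n. Var (n + 1))) (J C))\<langle>J x\<rangle>"
    using inst_typing[OF D(2) x] .
  moreover have "(sub (Refl (Var 0) \<cdot> Var 0 \<cdot> Var 0 \<cdot> (\<lambda>n. Var (n + 1))) (J C))\<langle>J x\<rangle> =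
      sub (Refl (J x) \<cdot> J x \<cdot> J x \<cdot> Var) (J C)"
    unfolding inst_def sub_sub
    by (rule sub_cong, rename_tac v, case_tac v; case_tac "v - 1"; case_tac "v - 2") auto
  ultimately have d: "S \<parallel> map J \<Gamma> \<turnstile> (J d)\<langle>J x\<rangle> \<Ztypecolon> sub (Refl (J x) \<cdot> J b \<cdot> J a \<cdot> Var) (J C)"
    using F ty_conv by metis
  have "S \<parallel> map J \<Gamma> \<turnstile> EqE (J C) (J d) (J a) (J b) (Refl (J x)) \<simeq> EqE (J C) (J d) (J x) (J x) (Refl (J x))
      \<Ztypecolon> sub (Refl (J x) \<cdot> J b \<cdot> J a \<cdot> Var) (J C)"
    using cong_EqE[OF eq_refl[OF C] eq_refl[OF D(2)] a(2) b(2) eq_refl[OF p']] .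
  moreover have "S \<parallel> map J \<Gamma> \<turnstile> EqE (J C) (J d) (J x) (J x) (Refl (J x)) \<simeq> (J d)\<langle>J x\<rangle>
      \<Ztypecolon> sub (Refl (J x) \<cdot> J b \<cdot> J a \<cdot> Var) (J C)"
    using beta_Eq[OF C D(2) x] F by (rule eq_conv)
  ultimately have "jeqs \<Gamma> (CEqE C d a b (CRefl x)) (cs 0 [x] 0 d) (cs 0 [CRefl x, b, a] 0 C)"
    by (simp add: I_simps') (rule eq_trans)
  moreover have "has \<Gamma> (CRefl x) (CEq A a b)" using p' by simp
  note has_EqE[OF assms(2) a(1) b(1) this conjunct2[OF X] assms(5)]
  ultimately show ?thesis
    using d by (simp add: I_simps')
qed

lemma red_step_good:
  assumes t: "red_step k \<Gamma> t = Some (t', T)" and w: "wf \<Gamma>"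
  shows "red_ok \<Gamma> t t' T"
proof (cases t)
  case (CApp f a)
  consider A b where "f = CLam A b" | "red_app k \<Gamma> f a = Some (t', T)"
    using t CApp by (cases f) (auto simp: red_step_def)
  then show ?thesis
  proof cases
    case 1
    then show ?thesis using t CApp red_beta_good[OF _ _ _ w]
      by (fastforce simp: red_step_def bind_eq_Some_conv grd_Some)
  next
    case 2
    then show ?thesis using red_app_good w CApp by blast
  qed
next
  case (CSigE C c p)
  consider B a b where "p = CTup B a b" | "red_sig k \<Gamma> C c p = Some (t', T)"
    using t CSigE by (cases p) (auto simp: red_step_def)
  then show ?thesis
  proof cases
    case 1
    then obtain A j where "infer k \<Gamma> a = Some A" "level k (A # \<Gamma>) B = Some j" "check k \<Gamma> b (cs 0 [a] 0 B)"
        "sigOK k \<Gamma> A B C c" "t' = cs 0 [b, a] 0 c" "T = cs 0 [p] 0 C"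
      using t CSigE by (auto simp: red_step_def bind_eq_Some_conv grd_Some)
    then show ?thesis using red_sig_beta_good[OF _ _ _ _ w] CSigE 1 by simp
  next
    case 2
    then show ?thesis using red_sig_good w CSigE by blast
  qed
next
  case (CNatE C z s n)
  consider "n = CZero" | m where "n = CSucc m"
    using t CNatE by (cases n) (auto simp: red_step_def)
  then show ?thesis
  proof cases
    case 1
    then show ?thesis using t CNatE red_nat_good(1)[OF _ w] by (auto simp: red_step_def grd_Some)
  next
    case 2
    then have N: "natOK k \<Gamma> C z s" "check k \<Gamma> m CNat" "t' = cs 0 [CNatE C z s m, m] 0 s" "T = cs 0 [n] 0 C"
      using t CNatE by (auto simp: red_step_def grd_Some)
    from red_nat_good(2)[OF N(1) w check_D[OF N(2) w]] show ?thesis using CNatE 2 N(3,4) by simp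
  qed
next
  case (CEqE C d a b p)
  consider x where "p = CRefl x" | "red_eq k \<Gamma> C d a b p = Some (t', T)"
    using t CEqE by (cases p) (auto simp: red_step_def)
  then show ?thesis
  proof cases
    case 1
    then obtain A where "infer k \<Gamma> x = Some A" "eqOK k \<Gamma> A C d" "sameAt k \<Gamma> a x A" "sameAt k \<Gamma> b x A"
        "t' = cs 0 [x] 0 d" "T = cs 0 [p, b, a] 0 C"
      using t CEqE by (auto simp: red_step_def bind_eq_Some_conv grd_Some)
    then show ?thesis using red_refl_good[OF _ _ _ _ w] CEqE 1 by simp
  next
    case 2
    then show ?thesis using red_eq_good w CEqE by blast
  qed
qed (use t in \<open>auto simp: red_step_def\<close>)

section \<open>Soundness of conversion\<close>

abbreviation conv_ok where
  "conv_ok \<Gamma> t t' T \<equiv> has \<Gamma> t T \<and> jeqs \<Gamma> t t' T \<and> isT \<Gamma> T"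

lemma conv_U: "conv k \<Gamma> A A' = Some K \<Longrightarrow> asU K = Some l \<Longrightarrow> wf \<Gamma> \<Longrightarrow>
    S \<parallel> map J \<Gamma> \<turnstile> J A \<Ztypecolon> Univ (lv u l) \<and> S \<parallel> map J \<Gamma> \<turnstile> J A \<simeq> J A' \<Ztypecolon> Univ (lv u l) \<and> wf (A # \<Gamma>)"
  using conv_D[of \<Gamma> A A' K] asU_D[of K l] by (auto intro: ctx_cons)

lemma eta_good:
  assumes "eta k \<Gamma> t t' = Some T" "wf \<Gamma>"
  shows "conv_ok \<Gamma> t t' T"
proof -
  obtain F A B where *: "infer k \<Gamma> t' = Some F" "asPi F = Some (A, B)"
      "conv k \<Gamma> t (CLam A (CApp (lift 0 1 t') (CV 0))) = Some T" "same k \<Gamma> F T"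
    using assms(1) by (auto simp: eta_def bind_eq_Some_conv grd_Some)
  note F = infer_D[OF *(1) assms(2)] and c = conv_D[OF *(3) assms(2)]
  have "jeqs \<Gamma> t' (CLam A (CApp (lift 0 1 t') (CV 0))) F"
    using eta_Pi F asPi_D[OF *(2)] by (simp add: I_lift0)
  then have "jeqs \<Gamma> t' (CLam A (CApp (lift 0 1 t') (CV 0))) T"
    using teq_jeqs same_D[OF *(4) assms(2)] by blast
  then show ?thesis using c by (meson eq_sym eq_trans)
qed

lemma eta'_good:
  assumes "eta' k \<Gamma> t t' = Some T" "wf \<Gamma>"
  shows "conv_ok \<Gamma> t t' T"
proof -
  obtain A B T' where *: "infer k \<Gamma> t = Some T" "asPi T = Some (A, B)"
      "conv k \<Gamma> (CLam A (CApp (lift 0 1 t) (CV 0))) t' = Some T'" "same k \<Gamma> T' T"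
    using assms(1) by (auto simp: eta'_def bind_eq_Some_conv grd_Some)
  note F = infer_D[OF *(1) assms(2)] and c = conv_D[OF *(3) assms(2)]
  have "jeqs \<Gamma> t (CLam A (CApp (lift 0 1 t) (CV 0))) T"
    using eta_Pi F asPi_D[OF *(2)] by (simp add: I_lift0)
  moreover have "jeqs \<Gamma> (CLam A (CApp (lift 0 1 t) (CV 0))) t' T"
    using teq_jeqs same_D[OF *(4) assms(2)] c by blast
  ultimately show ?thesis using F by (meson eq_trans)
qed

lemma cong_App_good:
  assumes "conv k \<Gamma> f f' = Some F" "asPi (whnf k \<Gamma> F) = Some (A, B)" "conv k \<Gamma> a a' = Some A'"
    "same k \<Gamma> A' A" "wf \<Gamma>"
  shows "conv_ok \<Gamma> (CApp f a) (CApp f' a') (cs 0 [a] 0 B)"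
proof -
  note F = conv_D[OF assms(1,5)] and a = conv_D[OF assms(3,5)]
  have P: "teq \<Gamma> F (CPi A B)" "isT \<Gamma> (CPi A B)" using asPi_whnf[OF assms(2) _ assms(5)] F by blast+
  have f: "has \<Gamma> f (CPi A B)" "jeqs \<Gamma> f f' (CPi A B)" using F P teq_has teq_jeqs by blast+
  have a': "has \<Gamma> a A" "jeqs \<Gamma> a a' A" using a same_D[OF assms(4,5)] teq_has teq_jeqs by blast+
  show ?thesis
    using ty_App cong_App f a' isT_Pi[OF P(2)] isT_inst by (fastforce simp: I_inst)
qed

lemma cong_Tup_good:
  assumes "conv k \<Gamma> a a' = Some A" "conv k (A # \<Gamma>) B B' = Some K" "asU K = Some j"
    "conv k \<Gamma> b b' = Some T" "same k \<Gamma> T (cs 0 [a] 0 B)" "wf \<Gamma>"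
  shows "conv_ok \<Gamma> (CTup B a b) (CTup B' a' b') (CSig A B)"
proof -
  note A = conv_D[OF assms(1,6)]
  obtain i where i: "S \<parallel> map J \<Gamma> \<turnstile> J A \<Ztypecolon> Univ i" using A by (auto simp: isT_def)
  then have w: "wf (A # \<Gamma>)" using assms(6) by (auto intro: ctx_cons)
  note B = conv_U[OF assms(2,3) w, simplified]
  have b: "has \<Gamma> b (cs 0 [a] 0 B)" "jeqs \<Gamma> b b' (cs 0 [a] 0 B)"
    using conv_D[OF assms(4,6)] same_D[OF assms(5,6)] teq_has teq_jeqs by blast+
  have "isT \<Gamma> (CSig A B)" unfolding isT_def using ty_Sig[OF i] B by auto
  then show ?thesis using ty_Tup cong_Tup A B b by (fastforce simp: I_inst)
qed

lemma cong_SigE_good: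
  assumes "conv k \<Gamma> p p' = Some P" "asSig (whnf k \<Gamma> P) = Some (A, B)"
    "conv k (CSig A B # \<Gamma>) C C' = Some K" "asU K = Some j" "conv k (B # A # \<Gamma>) c c' = Some T"
    "same k (B # A # \<Gamma>) T (cs 0 [CTup (lift 1 2 B) (CV 1) (CV 0)] 2 C)" "wf \<Gamma>"
  shows "conv_ok \<Gamma> (CSigE C c p) (CSigE C' c' p') (cs 0 [p] 0 C)"
proof -
  note P = conv_D[OF assms(1,7)]
  have E: "teq \<Gamma> P (CSig A B)" "isT \<Gamma> (CSig A B)" using asSig_whnf[OF assms(2) _ assms(7)] P by blast+
  have p: "has \<Gamma> p (CSig A B)" "jeqs \<Gamma> p p' (CSig A B)" using P E teq_has teq_jeqs by blast+
  have 1: "wf (CSig A B # \<Gamma>)" using assms(7) E(2) unfolding isT_def by (auto intro: ctx_cons)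
  have 2: "wf (B # A # \<Gamma>)" using isT_Sig[OF E(2)] by (auto intro: ctx_cons dest: typing_ctx)
  note C = conv_U[OF assms(3,4) 1, simplified]
  have c: "has (B # A # \<Gamma>) c (cs 0 [CTup (lift 1 2 B) (CV 1) (CV 0)] 2 C)"
     "jeqs (B # A # \<Gamma>) c c' (cs 0 [CTup (lift 1 2 B) (CV 1) (CV 0)] 2 C)"
    using conv_D[OF assms(5) 2] same_D[OF assms(6) 2] teq_has teq_jeqs by blast+
  have "isT \<Gamma> (cs 0 [p] 0 C)" using isT_inst[of "CSig A B"] C p(1) by auto
  then show ?thesis
    using ty_SigE[OF conjunct1[OF C]] cong_SigE[OF conjunct1[OF conjunct2[OF C]]] c p by (simp add: I_simps')
qed

lemma cong_EqE_good:
  assumes "conv k \<Gamma> p p' = Some P" "asEq (whnf k \<Gamma> P) = Some (A, x, y)" "eqAt k \<Gamma> A a b x y"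
    "sameAt k \<Gamma> a a' A" "sameAt k \<Gamma> b b' A"
    "conv k (CEq (lift 0 2 A) (CV 1) (CV 0) # lift 0 1 A # A # \<Gamma>) C C' = Some K" "asU K = Some j"
    "conv k (A # \<Gamma>) d d' = Some T" "same k (A # \<Gamma>) T (cs 0 [CRefl (CV 0), CV 0, CV 0] 1 C)" "wf \<Gamma>"
  shows "conv_ok \<Gamma> (CEqE C d a b p) (CEqE C' d' a' b' p') (cs 0 [p, b, a] 0 C)"
proof -
  note P = conv_D[OF assms(1,10)]
  have E: "teq \<Gamma> P (CEq A x y)" "isT \<Gamma> (CEq A x y)" using asEq_whnf[OF assms(2) _ assms(10)] P by blast+
  note X = eqAt_D[OF assms(3,10) E(2)]
  have p: "has \<Gamma> p (CEq A a b)" "jeqs \<Gamma> p p' (CEq A a b)" using P E X(3) teq_has teq_jeqs by blast+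
  have a: "jeqs \<Gamma> a a' A" and b: "jeqs \<Gamma> b b' A" using sameAt_D assms(4,5,10) X by blast+
  obtain i where i: "S \<parallel> map J \<Gamma> \<turnstile> J A \<Ztypecolon> Univ i" using X(4) by (auto simp: isT_def)
  have 1: "wf (CEq (lift 0 2 A) (CV 1) (CV 0) # lift 0 1 A # A # \<Gamma>)" and 2: "wf (A # \<Gamma>)"
    using eq_ctx[OF i] by (auto simp: I_lift0)
  have C: "S \<parallel> Eq (wk 2 (J A)) (Var 1) (Var 0) # wk 1 (J A) # J A # map J \<Gamma> \<turnstile> J C \<Ztypecolon> Univ (lv u j)"
    "S \<parallel> Eq (wk 2 (J A)) (Var 1) (Var 0) # wk 1 (J A) # J A # map J \<Gamma> \<turnstile> J C \<simeq> J C' \<Ztypecolon> Univ (lv u j)"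
    using conv_U[OF assms(6,7) 1] by (auto simp: I_lift0)
  have d: "has (A # \<Gamma>) d (cs 0 [CRefl (CV 0), CV 0, CV 0] 1 C)"
     "jeqs (A # \<Gamma>) d d' (cs 0 [CRefl (CV 0), CV 0, CV 0] 1 C)"
    using conv_D[OF assms(8) 2] same_D[OF assms(9) 2] teq_has teq_jeqs by blast+
  have "isT \<Gamma> (cs 0 [p, b, a] 0 C)"
    unfolding isT_def using inst3_typing[OF C(1)] X p by (auto simp: I_simps')
  then show ?thesis
    using ty_EqE[OF C(1)] cong_EqE[OF C(2)] d X a b p by (simp add: I_simps')
qed

lemma cong1_good:
  assumes t: "cong1 k \<Gamma> t t' = Some T" and w: "wf \<Gamma>"
  shows "conv_ok \<Gamma> t t' T"
proof (cases t)
  case (CPi A B)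
  then obtain A' B' K i K' j where *: "t' = CPi A' B'" "conv k \<Gamma> A A' = Some K" "asU K = Some i"
      "conv k (A # \<Gamma>) B B' = Some K'" "asU K' = Some j" "T = CU (lmax i j)"
    using t by (auto simp: cong1_def bind_eq_Some_conv split: ctm.splits)
  note A = conv_U[OF *(2,3) w]
  note B = conv_U[OF *(4,5)]
  show ?thesis using A B CPi * isT_U[OF w] by (auto simp: lv_lmax intro: ty_Pi cong_Pi)
next
  case (CSig A B)
  then obtain A' B' K i K' j where *: "t' = CSig A' B'" "conv k \<Gamma> A A' = Some K" "asU K = Some i"
      "conv k (A # \<Gamma>) B B' = Some K'" "asU K' = Some j" "T = CU (lmax i j)"
    using t by (auto simp: cong1_def bind_eq_Some_conv split: ctm.splits)
  note A = conv_U[OF *(2,3) w]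
  note B = conv_U[OF *(4,5)]
  show ?thesis using A B CSig * isT_U[OF w] by (auto simp: lv_lmax intro: ty_Sig cong_Sig)
next
  case (CLam A b)
  consider A' b' where "t' = CLam A' b'" | "eta k \<Gamma> t t' = Some T"
    using t CLam by (cases t') (auto simp: cong1_def)
  then show ?thesis
  proof cases
    case 1
    then obtain K i B where *: "conv k \<Gamma> A A' = Some K" "asU K = Some i"
        "conv k (A # \<Gamma>) b b' = Some B" "T = CPi A B"
      using t CLam by (auto simp: cong1_def bind_eq_Some_conv)
    note A = conv_U[OF *(1,2) w]
    have wA: "wf (A # \<Gamma>)" using A by blast
    note B = conv_D[OF *(3) wA]
    obtain j where "S \<parallel> J A # map J \<Gamma> \<turnstile> J B \<Ztypecolon> Univ j" using B by (auto simp: isT_def)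
    then have "isT \<Gamma> T" using A ty_Pi by (fastforce simp: isT_def *)
    then show ?thesis using A B CLam 1 * by (auto intro: ty_Lam cong_Lam)
  next
    case 2
    then show ?thesis using eta_good w by blast
  qed
next
  case (CApp f a)
  then show ?thesis using t cong_App_good[OF _ _ _ _ w]
    by (cases t') (auto simp: cong1_def bind_eq_Some_conv grd_Some)
next
  case (CTup B a b)
  then show ?thesis using t cong_Tup_good[OF _ _ _ _ _ w]
    by (cases t') (auto simp: cong1_def bind_eq_Some_conv grd_Some simp del: I.simps)
next
  case (CSigE C c p)
  then show ?thesis using t cong_SigE_good[OF _ _ _ _ _ _ w]
    by (cases t') (auto simp: cong1_def bind_eq_Some_conv grd_Some simp del: I.simps)
next
  case (CEq A a b)
  then obtain A' a' b' K i T1 T2 where *: "t' = CEq A' a' b'" "conv k \<Gamma> A A' = Some K" "asU K = Some i"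
      "conv k \<Gamma> a a' = Some T1" "conv k \<Gamma> b b' = Some T2" "same k \<Gamma> T1 A" "same k \<Gamma> T2 A" "T = CU i"
    using t by (auto simp: cong1_def bind_eq_Some_conv grd_Some split: ctm.splits)
  have "has \<Gamma> a A" "jeqs \<Gamma> a a' A" "has \<Gamma> b A" "jeqs \<Gamma> b b' A"
    using conv_D[OF *(4) w] conv_D[OF *(5) w] same_D[OF *(6) w] same_D[OF *(7) w] teq_has teq_jeqs by blast+
  then show ?thesis using conv_U[OF *(2,3) w] CEq * isT_U[OF w] by (auto intro: ty_Eq cong_Eq)
next
  case (CRefl a)
  then obtain a' A where *: "t' = CRefl a'" "conv k \<Gamma> a a' = Some A" "T = CEq A a a"
    using t by (auto simp: cong1_def bind_eq_Some_conv split: ctm.splits)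
  from conv_D[OF *(2) w] show ?thesis using CRefl *
    by (auto simp: isT_def intro: ty_Refl cong_Refl ty_Eq)
next
  case (CEqE C d a b p)
  then show ?thesis using t cong_EqE_good[OF _ _ _ _ _ _ _ _ _ w]
    by (cases t') (auto simp: cong1_def bind_eq_Some_conv grd_Some simp del: I.simps One_nat_def)
qed (use t in \<open>auto simp: cong1_def\<close>)

lemma cong_good:
  assumes t: "cong k \<Gamma> t t' = Some T" and w: "wf \<Gamma>"
  shows "conv_ok \<Gamma> t t' T"
proof -
  consider "cong1 k \<Gamma> t t' = Some T" | "eta' k \<Gamma> t t' = Some T"
    using t by (cases t'; cases t) (auto simp: cong_def)
  then show ?thesis using cong1_good eta'_good w by cases blast+
qed

lemma conv_step_good:
  assumes t: "conv_step k \<Gamma> t t' = Some T" and w: "wf \<Gamma>"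
  shows "conv_ok \<Gamma> t t' T"
proof -
  consider (eq) "t = t'" "infer k \<Gamma> t = Some T"
    | (left) t1 T1 where "red k \<Gamma> t = Some (t1, T)" "conv k \<Gamma> t1 t' = Some T1" "same k \<Gamma> T1 T"
    | (right) t1 T1 where "red k \<Gamma> t' = Some (t1, T1)" "conv k \<Gamma> t t1 = Some T" "same k \<Gamma> T1 T"
    | (cong) "cong k \<Gamma> t t' = Some T"
    using t by (fastforce simp: conv_step_def bind_eq_Some_conv grd_Some split: if_splits option.splits)
  then show ?thesis
  proof cases
    case eq
    then show ?thesis using infer_D[OF eq(2) w] by (auto intro: eq_refl)
  next
    case left
    from red_D[OF left(1) w] conv_D[OF left(2) w] same_D[OF left(3) w] teq_jeqs
    show ?thesis by (meson eq_trans)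
  next
    case right
    from red_D[OF right(1) w] conv_D[OF right(2) w] same_D[OF right(3) w] teq_jeqs
    show ?thesis by (meson eq_trans eq_sym)
  next
    case cong
    then show ?thesis using cong_good w by blast
  qed
qed

end

lemma good_iter: "good (iter L n)"
proof (induction n)
  case 0
  show ?case
    by (simp add: good_def good_infer_def good_whnf_def good_red_def good_conv_def teq_refl)
next
  case (Suc n)
  then show ?case
    unfolding good_def good_infer_def good_whnf_def good_red_def good_conv_def
    using infer_step_good[OF Suc] whnf_step_good[OF Suc] red_step_good[OF Suc] conv_step_good[OF Suc]
    by (simp add: Let_def)
qed

lemma check_sound:
  assumes "check (iter L n) [] t T"
  shows "S \<parallel> [] \<turnstile> I \<rho> u t \<Ztypecolon> I \<rho> u T"
  using check_D[OF good_iter assms] ctx_nil by simp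

lemma level_sound:
  assumes "level (iter L n) [] T = Some l"
  shows "S \<parallel> [] \<turnstile> I \<rho> u T \<Ztypecolon> Univ (lv u l)"
  using level_D[OF good_iter assms] ctx_nil by simp

end

section \<open>Evaluation\<close>

text \<open>Fuel stays a binary numeral; each call takes off one unit and leaves the rest of
  \<open>iter\<close> folded.\<close>

lemma infer_numeral:
  "infer (iter L (numeral n)) \<Gamma> t = infer_step L (iter L (pred_numeral n)) \<Gamma> t"
  "whnf (iter L (numeral n)) \<Gamma> t = whnf_step (iter L (pred_numeral n)) \<Gamma> t"
  "red (iter L (numeral n)) \<Gamma> t = red_step (iter L (pred_numeral n)) \<Gamma> t"
  "conv (iter L (numeral n)) \<Gamma> t t' = conv_step (iter L (pred_numeral n)) \<Gamma> t t'"
  by (simp_all add: Let_def numeral_eq_Suc)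

text \<open>Separate equations for the constructors spare the simplifier the full case distinction
  at every call.\<close>

lemma infer_steps:
  "infer_step L k \<Gamma> (CV g) = vty \<Gamma> g (Suc 0)"
  "infer_step L k \<Gamma> (CU (LU l)) = Some (CU (LU (Suc l)))"
  "infer_step L k \<Gamma> (CU L0) = None"
  "infer_step L k \<Gamma> (CG g h) = gty L g h"
  "infer_step L k \<Gamma> (CPi A B) = do {i \<leftarrow> level k \<Gamma> A; j \<leftarrow> level k (A # \<Gamma>) B; Some (CU (lmax i j))}"
  "infer_step L k \<Gamma> (CLam A b) = do {i \<leftarrow> level k \<Gamma> A; B \<leftarrow> infer k (A # \<Gamma>) b; Some (CPi A B)}"
  "infer_step L k \<Gamma> (CApp f a) = do {F \<leftarrow> infer k \<Gamma> f; (A, B) \<leftarrow> asPi (whnf k \<Gamma> F);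
        grd (check k \<Gamma> a A) (Some (cs 0 [a] 0 B))}"
  "infer_step L k \<Gamma> (CSig A B) = do {i \<leftarrow> level k \<Gamma> A; j \<leftarrow> level k (A # \<Gamma>) B; Some (CU (lmax i j))}"
  "infer_step L k \<Gamma> (CTup B a b) = do {A \<leftarrow> infer k \<Gamma> a; j \<leftarrow> level k (A # \<Gamma>) B;
        grd (check k \<Gamma> b (cs 0 [a] 0 B)) (Some (CSig A B))}"
  "infer_step L k \<Gamma> (CSigE C c p) = do {P \<leftarrow> infer k \<Gamma> p; (A, B) \<leftarrow> asSig (whnf k \<Gamma> P);
        grd (sigOK k \<Gamma> A B C c) (Some (cs 0 [p] 0 C))}"
  "infer_step L k \<Gamma> CNat = Some (CU L0)"
  "infer_step L k \<Gamma> CZero = Some CNat"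
  "infer_step L k \<Gamma> (CSucc m) = grd (check k \<Gamma> m CNat) (Some CNat)"
  "infer_step L k \<Gamma> (CNatE C z s m) =
     grd (natOK k \<Gamma> C z s) (grd (check k \<Gamma> m CNat) (Some (cs 0 [m] 0 C)))"
  "infer_step L k \<Gamma> (CEq A a b) = do {i \<leftarrow> level k \<Gamma> A;
     grd (check k \<Gamma> a A) (grd (check k \<Gamma> b A) (Some (CU i)))}"
  "infer_step L k \<Gamma> (CRefl a) = do {A \<leftarrow> infer k \<Gamma> a; Some (CEq A a a)}"
  "infer_step L k \<Gamma> (CEqE C d a b p) = do {P \<leftarrow> infer k \<Gamma> p; (A, a', b') \<leftarrow> asEq (whnf k \<Gamma> P);
        grd (eqAt k \<Gamma> A a b a' b')
         (grd (eqOK k \<Gamma> A C d) (Some (cs 0 [p, b, a] 0 C)))}"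
  by (simp_all add: infer_step_def)

lemma red_steps:
  "red_step k \<Gamma> (CV g) = None"
  "red_step k \<Gamma> (CU l) = None"
  "red_step k \<Gamma> (CG g h) = None"
  "red_step k \<Gamma> (CPi A B) = None"
  "red_step k \<Gamma> (CLam A b) = None"
  "red_step k \<Gamma> (CSig A B) = None"
  "red_step k \<Gamma> (CTup B a b) = None"
  "red_step k \<Gamma> CNat = None"
  "red_step k \<Gamma> CZero = None"
  "red_step k \<Gamma> (CSucc m) = None"
  "red_step k \<Gamma> (CEq A a b) = None"
  "red_step k \<Gamma> (CRefl a) = None"
  "red_step k \<Gamma> (CApp f a) = (case f of
          CLam A b \<Rightarrow> do {i \<leftarrow> level k \<Gamma> A; B \<leftarrow> infer k (A # \<Gamma>) b;
            grd (check k \<Gamma> a A) (Some (cs 0 [a] 0 b, cs 0 [a] 0 B))}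
        | _ \<Rightarrow> red_app k \<Gamma> f a)"
  "red_step k \<Gamma> (CSigE C c p) = (case p of
          CTup B a b \<Rightarrow> do {A \<leftarrow> infer k \<Gamma> a; j \<leftarrow> level k (A # \<Gamma>) B;
            grd (check k \<Gamma> b (cs 0 [a] 0 B)) (grd (sigOK k \<Gamma> A B C c)
              (Some (cs 0 [b, a] 0 c, cs 0 [p] 0 C)))}
        | _ \<Rightarrow> red_sig k \<Gamma> C c p)"
  "red_step k \<Gamma> (CNatE C z s m) = (case m of
          CZero \<Rightarrow> grd (natOK k \<Gamma> C z s) (Some (z, cs 0 [m] 0 C))
        | CSucc m' \<Rightarrow> grd (natOK k \<Gamma> C z s) (grd (check k \<Gamma> m' CNat)
            (Some (cs 0 [CNatE C z s m', m'] 0 s, cs 0 [m] 0 C)))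
        | _ \<Rightarrow> None)"
  "red_step k \<Gamma> (CEqE C d a b p) = (case p of
          CRefl x \<Rightarrow> do {A \<leftarrow> infer k \<Gamma> x; grd (eqOK k \<Gamma> A C d) (grd (sameAt k \<Gamma> a x A) (grd (sameAt k \<Gamma> b x A)
            (Some (cs 0 [x] 0 d, cs 0 [p, b, a] 0 C))))}
        | _ \<Rightarrow> red_eq k \<Gamma> C d a b p)"
  by (simp_all add: red_step_def)

text \<open>Used as congruence rules, these confine rewriting to the scrutinee. A continuation is
  entered only once its argument is known, so evaluation is call by value and failed or untaken
  branches are never explored.\<close>

lemma bind_weak_cong: "x = y \<Longrightarrow> Option.bind x f = Option.bind y f" by simp
lemma grd_weak_cong: "b = c \<Longrightarrow> grd b x = grd c x" by simp
lemma grd_simps: "grd True x = x" "grd False x = None" by (simp_all add: grd_def)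

lemmas eval_cong = bind_weak_cong grd_weak_cong if_weak_cong option.case_cong_weak ctm.case_cong_weak prod.case_cong_weak

lemmas eval = infer_numeral pred_numeral_simps BitM.simps infer_steps red_steps conv_step_def cong_def cong1_def eta_def eta'_def red_app_def red_sig_def red_eq_def eqAt_def sameAt_def whnf_step_def
  same_def check_def level_def sigOK_def natOK_def eqOK_def grd_simps option.case Option.bind.simps
  ctm.case ctm.inject ctm.distinct option.inject option.distinct prod.case fst_conv snd_conv if_True if_False
  lift.simps cs.simps pick.simps vty.simps gty.simps shl.simps lup.simps asU.simps asPi.simps asSig.simps asEq.simps lmax.simps lvl.inject lvl.distinct
  max_0L max_0R max_Suc_Suc nat.inject nat.distinct One_nat_def numeral_2_eq_2 less_nat_zero_code zero_less_Suc Suc_less_eq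
  diff_0_eq_0 diff_Suc_Suc minus_nat.diff_0 add_0 add_0_right add_Suc add_Suc_right simp_thms

section \<open>Provable types\<close>

text \<open>Demanded of statements but not of proofs: without citations and free variables, the
  meaning of a statement depends on neither \<open>\<rho>\<close> nor a substitution.\<close>

primrec pure_closed :: "nat \<Rightarrow> ctm \<Rightarrow> bool" where
  "pure_closed n (CV m) = (m < n)"
| "pure_closed n (CU l) = True"
| "pure_closed n (CG g l) = False"
| "pure_closed n (CPi A B) = (pure_closed n A \<and> pure_closed (Suc n) B)"
| "pure_closed n (CLam A b) = (pure_closed n A \<and> pure_closed (Suc n) b)"
| "pure_closed n (CApp f a) = (pure_closed n f \<and> pure_closed n a)"
| "pure_closed n (CSig A B) = (pure_closed n A \<and> pure_closed (Suc n) B)"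
| "pure_closed n (CTup B a b) = (pure_closed (Suc n) B \<and> pure_closed n a \<and> pure_closed n b)"
| "pure_closed n (CSigE C c p) = (pure_closed (Suc n) C \<and> pure_closed (Suc (Suc n)) c \<and> pure_closed n p)"
| "pure_closed n CNat = True"
| "pure_closed n CZero = True"
| "pure_closed n (CSucc m) = pure_closed n m"
| "pure_closed n (CNatE C z s m) =
     (pure_closed (Suc n) C \<and> pure_closed n z \<and> pure_closed (Suc (Suc n)) s \<and> pure_closed n m)"
| "pure_closed n (CEq A a b) = (pure_closed n A \<and> pure_closed n a \<and> pure_closed n b)"
| "pure_closed n (CRefl a) = pure_closed n a"
| "pure_closed n (CEqE C d a b p) = (pure_closed (Suc (Suc (Suc n))) C \<and> pure_closed (Suc n) d \<and>
     pure_closed n a \<and> pure_closed n b \<and> pure_closed n p)"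

lemma ups_fixes: "(\<And>m. m < n \<Longrightarrow> s m = Var m) \<Longrightarrow> m < Suc n \<Longrightarrow> ups s m = Var m"
  by (cases m) auto

lemma pure_closed_sub:
  "pure_closed n t \<Longrightarrow> (\<And>m. m < n \<Longrightarrow> s m = Var m) \<Longrightarrow> sub s (I \<rho> u t) = I \<rho> u t"
proof (induction t arbitrary: n s)
  case (CPi A B)
  then show ?case using CPi.IH(2)[of "Suc n" "ups s"] ups_fixes[of n s] by auto
next
  case (CLam A B)
  then show ?case using CLam.IH(2)[of "Suc n" "ups s"] ups_fixes[of n s] by auto
next
  case (CSig A B)
  then show ?case using CSig.IH(2)[of "Suc n" "ups s"] ups_fixes[of n s] by auto
next
  case (CTup B a b)
  then show ?case using CTup.IH(1)[of "Suc n" "ups s"] ups_fixes[of n s] by auto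
next
  case (CSigE C c p)
  then show ?case
    using CSigE.IH(1)[of "Suc n" "ups s"] CSigE.IH(2)[of "Suc (Suc n)" "ups (ups s)"]
      ups_fixes[of n s] ups_fixes[of "Suc n" "ups s"] by auto
next
  case (CNatE C z t m)
  then show ?case
    using CNatE.IH(1)[of "Suc n" "ups s"] CNatE.IH(3)[of "Suc (Suc n)" "ups (ups s)"]
      ups_fixes[of n s] ups_fixes[of "Suc n" "ups s"] by auto
next
  case (CEqE C d a b p)
  then show ?case
    using CEqE.IH(1)[of "Suc (Suc (Suc n))" "ups (ups (ups s))"] CEqE.IH(2)[of "Suc n" "ups s"]
      ups_fixes[of n s] ups_fixes[of "Suc n" "ups s"] ups_fixes[of "Suc (Suc n)" "ups (ups s)"] by auto
qed auto

lemma pure_closed_I: "pure_closed n t \<Longrightarrow> I \<rho> u t = I \<rho>' u t"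
  by (induction t arbitrary: n) auto

text \<open>The valuation is a dummy, as \<open>I0\<close> is meant for terms without
  citations.\<close>

definition I0 :: "nat \<Rightarrow> ctm \<Rightarrow> tm" where
  "I0 = I (\<lambda>_ _. Star)"

lemma I0_eq: "pure_closed 0 T \<Longrightarrow> I \<rho> u T = I0 u T"
  unfolding I0_def by (rule pure_closed_I)

definition inhabits :: "const set \<Rightarrow> tm \<Rightarrow> tm \<Rightarrow> bool" where
  "inhabits S t T \<longleftrightarrow> (\<forall>s. sub s t = t) \<and> S \<parallel> [] \<turnstile> t \<Ztypecolon> T"

text \<open>Quantifying over all \<open>u\<close> is what permits a later proof to cite the
  statement at a raised level.\<close>

definition provable :: "const set \<Rightarrow> ctm \<Rightarrow> bool" where
  "provable S T \<longleftrightarrow> pure_closed 0 T \<and>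
     (\<forall>u. (\<exists>t. inhabits S t (I0 u T)) \<and> (\<exists>i. S \<parallel> [] \<turnstile> I0 u T \<Ztypecolon> Univ i))"

text \<open>
  Substituting anything for the variables of a term typed in the empty context gives a term of the
  same type that is literally closed.
\<close>

lemma inhabitsI:
  assumes "S \<parallel> [] \<turnstile> t \<Ztypecolon> I0 u T" "pure_closed 0 T"
  shows "\<exists>t. inhabits S t (I0 u T)"
proof -
  have "S \<parallel> [] \<turnstile> sub (\<lambda>_. Star) t \<Ztypecolon> I0 u T"
    using substitution[OF wsub_Nil ctx_nil assms(1), of "\<lambda>_. Star"] pure_closed_sub[OF assms(2), of "\<lambda>_. Star"]
    by (simp add: I0_def)
  then show ?thesis
    unfolding inhabits_def by (intro exI[of _ "sub (\<lambda>_. Star) t"]) (simp add: sub_sub comp_def)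
qed

lemma provable_step:
  assumes L: "\<And>g. g < length L \<Longrightarrow> provable S (L ! g)" and T: "pure_closed 0 T"
    and l: "level (iter L n) [] T \<noteq> None" and c: "check (iter L n) [] t T"
  shows "provable S T"
proof -
  \<comment> \<open>Choice fixes one closed proof for each cited statement and each base level;
    \<open>Star\<close> outside the list is what \<open>default\<close> asks for.\<close>
  define \<rho> where "\<rho> g v = (if g < length L then SOME t. inhabits S t (I0 v (L ! g)) else Star)" for g v
  have \<rho>: "inhabits S (\<rho> g v) (I0 v (L ! g))" if "g < length L" for g v
    using L[OF that] that unfolding \<rho>_def provable_def by (auto intro: someI_ex)
  have I0: "I \<rho> v (L ! g) = I0 v (L ! g)" if "g < length L" for g v
    using L[OF that] I0_eq by (simp add: provable_def)
  have model: "model S L \<rho>"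
  proof
    show "g < length L \<Longrightarrow> sub s (\<rho> g v) = \<rho> g v" for g s v
      using \<rho> by (simp add: inhabits_def)
    show "g \<ge> length L \<Longrightarrow> \<rho> g v = Star" for g v by (simp add: \<rho>_def)
    show "g < length L \<Longrightarrow> S \<parallel> [] \<turnstile> \<rho> g v \<Ztypecolon> I \<rho> v (L ! g)" for g v
      using \<rho> I0 by (simp add: inhabits_def)
    show "g < length L \<Longrightarrow> \<exists>i. S \<parallel> [] \<turnstile> I \<rho> v (L ! g) \<Ztypecolon> Univ i" for g v
      using L I0 by (simp add: provable_def)
  qed
  have "(\<exists>t. inhabits S t (I0 u T)) \<and> (\<exists>i. S \<parallel> [] \<turnstile> I0 u T \<Ztypecolon> Univ i)" for u
  proof -
    interpret model_at S L \<rho> u using model by (simp add: model_at_def)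
    from l obtain k where "level (iter L n) [] T = Some k" by blast
    then show ?thesis using level_sound check_sound[OF c] inhabitsI[OF _ T] I0_eq[OF T] by metis
  qed
  then show ?thesis using T by (simp add: provable_def)
qed

section \<open>Named variables\<close>

text \<open>
  A term is a function of the number of variables in scope.  Binders hand their body a variable that knows
  its distance from the root of the context, and turns it into a de Bruijn index where it is used.
\<close>

type_synonym term_at = "nat \<Rightarrow> ctm"

definition vr :: "nat \<Rightarrow> term_at" where "vr k n = CV (n - Suc k)"
definition univ :: "nat \<Rightarrow> term_at" where "univ k n = CU (LU k)"

text \<open>
  \<open>glob g l\<close> refers to entry \<open>g\<close> of the list \<open>lib\<close> below, with all universe levels raised by \<open>l\<close>.
\<close>

definition glob :: "nat \<Rightarrow> nat \<Rightarrow> term_at" where "glob g l n = CG g l"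
definition pi :: "term_at \<Rightarrow> (term_at \<Rightarrow> term_at) \<Rightarrow> term_at" where "pi A B n = CPi (A n) (B (vr n) (Suc n))"
definition lam :: "term_at \<Rightarrow> (term_at \<Rightarrow> term_at) \<Rightarrow> term_at" where "lam A b n = CLam (A n) (b (vr n) (Suc n))"
definition app :: "term_at \<Rightarrow> term_at \<Rightarrow> term_at" (infixl \<open>\<bullet>\<close> 85) where "(f \<bullet> a) n = CApp (f n) (a n)"
definition sig :: "term_at \<Rightarrow> (term_at \<Rightarrow> term_at) \<Rightarrow> term_at" where "sig A B n = CSig (A n) (B (vr n) (Suc n))"
definition tup :: "(term_at \<Rightarrow> term_at) \<Rightarrow> term_at \<Rightarrow> term_at \<Rightarrow> term_at" where
  "tup B a b n = CTup (B (vr n) (Suc n)) (a n) (b n)"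
definition sigE :: "(term_at \<Rightarrow> term_at) \<Rightarrow> (term_at \<Rightarrow> term_at \<Rightarrow> term_at) \<Rightarrow> term_at \<Rightarrow> term_at" where
  "sigE C c p n = CSigE (C (vr n) (Suc n)) (c (vr n) (vr (Suc n)) (Suc (Suc n))) (p n)"
definition nat' :: term_at where "nat' n = CNat"
definition zero :: term_at where "zero n = CZero"
definition succ :: "term_at \<Rightarrow> term_at" where "succ m n = CSucc (m n)"
definition natE :: "(term_at \<Rightarrow> term_at) \<Rightarrow> term_at \<Rightarrow> (term_at \<Rightarrow> term_at \<Rightarrow> term_at) \<Rightarrow> term_at \<Rightarrow> term_at" where
  "natE C z s m n = CNatE (C (vr n) (Suc n)) (z n) (s (vr n) (vr (Suc n)) (Suc (Suc n))) (m n)"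
definition eq :: "term_at \<Rightarrow> term_at \<Rightarrow> term_at \<Rightarrow> term_at" where "eq A a b n = CEq (A n) (a n) (b n)"
definition rfl :: "term_at \<Rightarrow> term_at" where "rfl a n = CRefl (a n)"
definition eqE :: "(term_at \<Rightarrow> term_at \<Rightarrow> term_at \<Rightarrow> term_at) \<Rightarrow> (term_at \<Rightarrow> term_at) \<Rightarrow>
    term_at \<Rightarrow> term_at \<Rightarrow> term_at \<Rightarrow> term_at" where
  "eqE C d a b p n = CEqE (C (vr n) (vr (Suc n)) (vr (Suc (Suc n))) (Suc (Suc (Suc n))))
     (d (vr n) (Suc n)) (a n) (b n) (p n)"

syntax
  "_pi" :: "[pttrn, term_at, term_at] \<Rightarrow> term_at" (\<open>(3\<Pi> _ : _./ _)\<close> [0, 0, 10] 10)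
  "_lam" :: "[pttrn, term_at, term_at] \<Rightarrow> term_at" (\<open>(3\<Lambda> _ : _./ _)\<close> [0, 0, 10] 10)
  "_sig" :: "[pttrn, term_at, term_at] \<Rightarrow> term_at" (\<open>(3\<Sigma> _ : _./ _)\<close> [0, 0, 10] 10)
translations
  "\<Pi> x : A. B" == "CONST pi A (\<lambda>x. B)"
  "\<Lambda> x : A. b" == "CONST lam A (\<lambda>x. b)"
  "\<Sigma> x : A. B" == "CONST sig A (\<lambda>x. B)"

definition arr :: "term_at \<Rightarrow> term_at \<Rightarrow> term_at" (infixr \<open>\<rightarrow>\<close> 60) where "A \<rightarrow> B = (\<Pi> _ : A. B)"

text \<open>\<open>ho\<close> unfolds named syntax into first-order terms; \<open>nf\<close>
  collects the results, so that checking starts from explicit terms.\<close>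

named_theorems ho
named_theorems nf

lemmas [ho] = vr_def univ_def glob_def pi_def lam_def app_def sig_def tup_def sigE_def nat'_def zero_def succ_def natE_def
  eq_def rfl_def eqE_def arr_def

lemmas nat_simps = nat.inject nat.distinct One_nat_def numeral_2_eq_2 diff_0_eq_0 diff_Suc_Suc
  minus_nat.diff_0 add_0 add_0_right add_Suc add_Suc_right

section \<open>The object proofs\<close>

text \<open>
  Primed names are the counterparts of the vocabulary of the statement.  For each lemma \<open>x\<close> of the object theory,
  \<open>xT\<close> is its statement, \<open>x_t\<close> its proof term, and \<open>x\<close> itself the reference that later proofs use.
\<close>

definition [ho]: "isContr' A = (\<Sigma> x : A. \<Pi> y : A. eq A x y)"
definition [ho]: "isProp' A = (\<Pi> x : A. \<Pi> y : A. eq A x y)"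
definition [ho]: "fib' X Y f y = (\<Sigma> x : X. eq Y (f \<bullet> x) y)"
definition [ho]: "isEquiv' X Y f = (\<Pi> y : Y. isContr' (fib' X Y f y))"
definition [ho]: "Equiv' X Y = (\<Sigma> f : X \<rightarrow> Y. isEquiv' X Y f)"
definition [ho]: "isEmb' X Y f = (\<Pi> y : Y. isProp' (fib' X Y f y))"
definition [ho]: "Emb' X Y = (\<Sigma> f : X \<rightarrow> Y. isEmb' X Y f)"
definition [ho]: "idfun' X = (\<Lambda> x : X. x)"
definition [ho]: "cmp' X g f = (\<Lambda> x : X. g \<bullet> (f \<bullet> x))"
definition [ho]: "Htpy' X Y f g = (\<Pi> x : X. eq Y (f \<bullet> x) (g \<bullet> x))"
definition [ho]: "pair Y f y x p = tup (\<lambda>x. eq Y (f \<bullet> x) y) x p"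
definition [ho]: "idEquiv' X = tup (\<lambda>f. isEquiv' X X f) (idfun' X)
  (\<Lambda> y : X. tup (\<lambda>c. \<Pi> z : fib' X X (idfun' X) y. eq (fib' X X (idfun' X) y) c z)
    (pair X (idfun' X) y y (rfl y))
    (\<Lambda> z : fib' X X (idfun' X) y.
      sigE (\<lambda>z. eq (fib' X X (idfun' X) y) (pair X (idfun' X) y y (rfl y)) z)
        (\<lambda>x p. eqE (\<lambda>x y p. eq (fib' X X (idfun' X) y) (pair X (idfun' X) y y (rfl y))
          (pair X (idfun' X) y x p))
          (\<lambda>x. rfl (pair X (idfun' X) x x (rfl x))) x y p) z))"
definition [ho]: "idtoequiv' l X Y = (\<Lambda> p : eq (univ l) X Y. eqE (\<lambda>X Y p. Equiv' X Y)
    (\<lambda>X. idEquiv' X) X Y p)"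
definition [ho]: "isTrunc' l m X = natE (\<lambda>_. univ l \<rightarrow> univ l) (\<Lambda> X : univ l. isContr' X)
   (\<lambda>_ r. \<Lambda> X : univ l. \<Pi> x : X. \<Pi> y : X. r \<bullet> eq X x y) m \<bullet> X"
definition [ho]: "TTypes l m = (\<Sigma> X : univ l. isTrunc' l m X)"
definition [ho]: "Retract' A B = (\<Sigma> s : A \<rightarrow> B. \<Sigma> r : B \<rightarrow> A. Htpy' A A (cmp' A r s) (idfun' A))"

definition [ho]: "fst' A p = sigE (\<lambda>_. A) (\<lambda>x _. x) p"
definition [ho]: "snd' A B p = sigE (\<lambda>z. B (fst' A z)) (\<lambda>_ y. y) p"
definition [ho]: "AInj' i j D = (\<Pi> X : univ i. \<Pi> Y : univ j. \<Pi> e : Emb' X Y. \<Pi> f : X \<rightarrow> D.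
   \<Sigma> g : Y \<rightarrow> D. Htpy' X D (cmp' X g (fst' (X \<rightarrow> Y) e)) f)"

subsection \<open>Paths and contractible types\<close>

definition [ho]: "symm A x y p = eqE (\<lambda>x y _. eq A y x) rfl x y p"
text \<open>Induction on the first path lets concatenation after reflexivity reduce to
  \<open>q\<close>. Several later proofs hold by reflexivity in their base case because of this
  choice.\<close>

definition [ho]: "trns A x y z p q = eqE (\<lambda>x y _. eq A y z \<rightarrow> eq A x z)
    (\<lambda>x. \<Lambda> q : eq A x z. q) x y p \<bullet> q"
definition [ho]: "ap B f x y p = eqE (\<lambda>x y _. eq B (f x) (f y)) (\<lambda>x. rfl (f x)) x y p"
definition [ho]: "tr B x y p u = eqE (\<lambda>x y _. B x \<rightarrow> B y) (\<lambda>x. \<Lambda> u : B x. u) x y p \<bullet> u"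
definition [ho]: "happ B f g p x = ap (B x) (\<lambda>h. h \<bullet> x) f g p"
definition [ho]: "ctr A c = fst' A c"
definition [ho]: "ctrp A c y = snd' A (\<lambda>x. \<Pi> y : A. eq A x y) c \<bullet> y"

text \<open>Entry 0 of the library has no proof term; the constants \<open>UA u\<close> inhabit
  it.\<close>

definition [ho]: "uaT = (\<Pi> X : univ 0. \<Pi> Y : univ 0. isEquiv' (eq (univ 0) X Y) (Equiv' X Y)
    (idtoequiv' 0 X Y))"

\<comment> \<open>The schematic variable is instantiated with the result of unfolding in the empty
  scope. Every later \<open>_nf\<close> goal does the same for a statement and its proof term, so
  the conversion is computed once.\<close>
schematic_goal ua_nf [nf]: "uaT 0 = ?T"
  by (simp only: ho nat_simps)

definition [ho]: "ua l X Y = glob 0 l \<bullet> X \<bullet> Y"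

definition [ho]: "trans_symT = (\<Pi> A : univ 0. \<Pi> x : A. \<Pi> y : A. \<Pi> p : eq A x y. eq (eq A x x)
    (trns A x y x p (symm A x y p)) (rfl x))"
definition [ho]: "trans_sym_t = (\<Lambda> A : univ 0. \<Lambda> x : A. \<Lambda> y : A. \<Lambda> p : eq A x y.
   eqE (\<lambda>x y p. eq (eq A x x) (trns A x y x p (symm A x y p)) (rfl x)) (\<lambda>x. rfl (rfl x)) x y p)"

schematic_goal trans_sym_nf [nf]: "trans_symT 0 = ?T" "trans_sym_t 0 = ?t"
  by (simp_all only: ho nat_simps)

definition [ho]: "trans_sym l A x y p = glob 1 l \<bullet> A \<bullet> x \<bullet> y \<bullet> p"

definition [ho]: "sym_transT = (\<Pi> A : univ 0. \<Pi> x : A. \<Pi> y : A. \<Pi> p : eq A x y. eq (eq A y y)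
    (trns A y x y (symm A x y p) p) (rfl y))"
definition [ho]: "sym_trans_t = (\<Lambda> A : univ 0. \<Lambda> x : A. \<Lambda> y : A. \<Lambda> p : eq A x y.
   eqE (\<lambda>x y p. eq (eq A y y) (trns A y x y (symm A x y p) p) (rfl y)) (\<lambda>x. rfl (rfl x)) x y p)"

schematic_goal sym_trans_nf [nf]: "sym_transT 0 = ?T" "sym_trans_t 0 = ?t"
  by (simp_all only: ho nat_simps)

definition [ho]: "sym_trans l A x y p = glob 2 l \<bullet> A \<bullet> x \<bullet> y \<bullet> p"

definition [ho]: "singleton_fromT = (\<Pi> A : univ 0. \<Pi> a : A. isContr' (\<Sigma> x : A. eq A a x))"
definition [ho]: "singleton_from_t = (\<Lambda> A : univ 0. \<Lambda> a : A.
  tup (\<lambda>c. \<Pi> z : (\<Sigma> x : A. eq A a x). eq (\<Sigma> x : A. eq A a x) c z) (tup (\<lambda>x. eq A a x) a (rfl a))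
   (\<Lambda> z : (\<Sigma> x : A. eq A a x). sigE (\<lambda>z. eq (\<Sigma> x : A. eq A a x) (tup (\<lambda>x. eq A a x) a (rfl a)) z)
     (\<lambda>x p. eqE (\<lambda>a x p. eq (\<Sigma> x : A. eq A a x) (tup (\<lambda>x. eq A a x) a (rfl a))
       (tup (\<lambda>x. eq A a x) x p))
       (\<lambda>a. rfl (tup (\<lambda>x. eq A a x) a (rfl a))) a x p) z))"

schematic_goal singleton_from_nf [nf]: "singleton_fromT 0 = ?T" "singleton_from_t 0 = ?t"
  by (simp_all only: ho nat_simps)

definition [ho]: "singleton_from l A a = glob 3 l \<bullet> A \<bullet> a"

definition [ho]: "singleton_toT = (\<Pi> A : univ 0. \<Pi> a : A. isContr' (\<Sigma> x : A. eq A x a))"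
definition [ho]: "singleton_to_t = (\<Lambda> A : univ 0. \<Lambda> a : A.
  tup (\<lambda>c. \<Pi> z : (\<Sigma> x : A. eq A x a). eq (\<Sigma> x : A. eq A x a) c z) (tup (\<lambda>x. eq A x a) a (rfl a))
   (\<Lambda> z : (\<Sigma> x : A. eq A x a). sigE (\<lambda>z. eq (\<Sigma> x : A. eq A x a) (tup (\<lambda>x. eq A x a) a (rfl a)) z)
     (\<lambda>x p. eqE (\<lambda>x a p. eq (\<Sigma> x : A. eq A x a) (tup (\<lambda>x. eq A x a) a (rfl a))
       (tup (\<lambda>x. eq A x a) x p))
       (\<lambda>a. rfl (tup (\<lambda>x. eq A x a) a (rfl a))) x a p) z))"

schematic_goal singleton_to_nf [nf]: "singleton_toT 0 = ?T" "singleton_to_t 0 = ?t"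
  by (simp_all only: ho nat_simps)

definition [ho]: "singleton_to l A a = glob 4 l \<bullet> A \<bullet> a"

definition [ho]: "retract_contrT = (\<Pi> A : univ 0. \<Pi> B : univ 0. \<Pi> s : B \<rightarrow> A. \<Pi> r : A \<rightarrow> B.
    \<Pi> h : (\<Pi> b : B. eq B (r \<bullet> (s \<bullet> b)) b).
   isContr' A \<rightarrow> isContr' B)"
definition [ho]: "retract_contr_t = (\<Lambda> A : univ 0. \<Lambda> B : univ 0. \<Lambda> s : B \<rightarrow> A. \<Lambda> r : A \<rightarrow> B.
    \<Lambda> h : (\<Pi> b : B. eq B (r \<bullet> (s \<bullet> b)) b).
   \<Lambda> c : isContr' A. tup (\<lambda>x. \<Pi> b : B. eq B x b) (r \<bullet> ctr A c)
    (\<Lambda> b : B. trns B (r \<bullet> ctr A c) (r \<bullet> (s \<bullet> b)) b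
      (ap B (\<lambda>a. r \<bullet> a) (ctr A c) (s \<bullet> b) (ctrp A c (s \<bullet> b))) (h \<bullet> b)))"

schematic_goal retract_contr_nf [nf]: "retract_contrT 0 = ?T" "retract_contr_t 0 = ?t"
  by (simp_all only: ho nat_simps)

definition [ho]: "retract_contr l A B s r h c = glob 5 l \<bullet> A \<bullet> B \<bullet> s \<bullet> r \<bullet> h \<bullet> c"

definition [ho]: "contr_propT = (\<Pi> A : univ 0. isContr' A \<rightarrow> isProp' A)"
definition [ho]: "contr_prop_t = (\<Lambda> A : univ 0. \<Lambda> c : isContr' A. \<Lambda> x : A. \<Lambda> y : A.
   trns A x (ctr A c) y (symm A (ctr A c) x (ctrp A c x)) (ctrp A c y))"

schematic_goal contr_prop_nf [nf]: "contr_propT 0 = ?T" "contr_prop_t 0 = ?t"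
  by (simp_all only: ho nat_simps)

definition [ho]: "contr_prop l A c = glob 6 l \<bullet> A \<bullet> c"

definition [ho]: "fib_shiftF X Y f x1 x (e :: term_at) = (\<Sigma> q : eq Y (f \<bullet> x) (f \<bullet> x).
  eq (fib' X Y f (f \<bullet> x)) (pair Y f (f \<bullet> x) x1 (trns Y (f \<bullet> x1) (f \<bullet> x) (f \<bullet> x) e q))
    (pair Y f (f \<bullet> x) x (rfl (f \<bullet> x))))"
definition [ho]: "fib_shiftT = (\<Pi> X : univ 0. \<Pi> Y : univ 0. \<Pi> f : X \<rightarrow> Y. \<Pi> x1 : X. \<Pi> x : X.
    \<Pi> p : eq X x1 x.
   \<Pi> e : eq Y (f \<bullet> x1) (f \<bullet> x). fib_shiftF X Y f x1 x e)"
text \<open>After path induction \<open>x1\<close> is \<open>x\<close> and \<open>e\<close> is a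
  loop; its inverse serves as \<open>q\<close>, since then the concatenation of \<open>e\<close> and
  \<open>q\<close> is trivial.\<close>

definition [ho]: "fib_shift_t = (\<Lambda> X : univ 0. \<Lambda> Y : univ 0. \<Lambda> f : X \<rightarrow> Y. \<Lambda> x1 : X. \<Lambda> x : X.
    \<Lambda> p : eq X x1 x.
   eqE (\<lambda>x1 x p. \<Pi> e : eq Y (f \<bullet> x1) (f \<bullet> x). fib_shiftF X Y f x1 x e)
    (\<lambda>x. \<Lambda> e : eq Y (f \<bullet> x) (f \<bullet> x). tup (\<lambda>q. eq (fib' X Y f (f \<bullet> x))
      (pair Y f (f \<bullet> x) x (trns Y (f \<bullet> x) (f \<bullet> x) (f \<bullet> x) e q)) (pair Y f (f \<bullet> x) x (rfl (f \<bullet> x))))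
      (symm Y (f \<bullet> x) (f \<bullet> x) e)
      (ap (fib' X Y f (f \<bullet> x)) (\<lambda>k. pair Y f (f \<bullet> x) x k)
        (trns Y (f \<bullet> x) (f \<bullet> x) (f \<bullet> x) e (symm Y (f \<bullet> x) (f \<bullet> x) e)) (rfl (f \<bullet> x))
        (trans_sym 0 Y (f \<bullet> x) (f \<bullet> x) e)))
    x1 x p)"

schematic_goal fib_shift_nf [nf]: "fib_shiftT 0 = ?T" "fib_shift_t 0 = ?t"
  by (simp_all only: ho nat_simps)

definition [ho]: "fib_shift l X Y f x1 x p e = glob 7 l \<bullet> X \<bullet> Y \<bullet> f \<bullet> x1 \<bullet> x \<bullet> p \<bullet> e"

text \<open>The retraction sends \<open>(y1, r)\<close> to \<open>g y1\<close> with the path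
  \<open>ep y1\<close> followed by \<open>r\<close>; the equation says that it recovers
  \<open>(x, p)\<close> from \<open>(f x, q)\<close>. Allowing \<open>q\<close> to differ from
  \<open>p\<close> absorbs the missing coherence between \<open>et\<close> and
  \<open>ep\<close>.\<close>

definition [ho]: "fib_sectionF X Y f g (ep :: term_at) y x p q = eq (fib' X Y f y)
    (pair Y f y (g \<bullet> (f \<bullet> x)) (trns Y (f \<bullet> (g \<bullet> (f \<bullet> x))) (f \<bullet> x) y (ep \<bullet> (f \<bullet> x)) q))
    (pair Y f y x p)"
definition [ho]: "fib_sectionT = (\<Pi> X : univ 0. \<Pi> Y : univ 0. \<Pi> f : X \<rightarrow> Y. \<Pi> g : Y \<rightarrow> X.
   \<Pi> et : (\<Pi> x : X. eq X (g \<bullet> (f \<bullet> x)) x). \<Pi> ep : (\<Pi> y : Y. eq Y (f \<bullet> (g \<bullet> y)) y).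
   \<Pi> y : Y. \<Pi> x : X. \<Pi> p : eq Y (f \<bullet> x) y. \<Sigma> q : eq Y (f \<bullet> x) y. fib_sectionF X Y f g ep y x p q)"

definition [ho]: "singleton A a = (\<Sigma> y : A. eq A a y)"

text \<open>
  Induction on a path with one fixed end, from contractibility of the type of such paths.
\<close>

definition [ho]: "based_J l A a P y p d = tr (\<lambda>z. P (fst' A z) (snd' A (\<lambda>y. eq A a y) z))
    (tup (\<lambda>y. eq A a y) a (rfl a)) (tup (\<lambda>y. eq A a y) y p)
   (contr_prop l (singleton A a) (singleton_from l A a) \<bullet> tup (\<lambda>y. eq A a y) a (rfl a) \<bullet> tup
     (\<lambda>y. eq A a y) y p) d"
text \<open>Based path induction reduces to \<open>p\<close> being reflexivity at
  \<open>f x\<close>. What remains is \<open>fib_shift\<close> for the path \<open>et x\<close> with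
  \<open>e\<close> equal to \<open>ep (f x)\<close>.\<close>

definition [ho]: "fib_section_t = (\<Lambda> X : univ 0. \<Lambda> Y : univ 0. \<Lambda> f : X \<rightarrow> Y. \<Lambda> g : Y \<rightarrow> X.
   \<Lambda> et : (\<Pi> x : X. eq X (g \<bullet> (f \<bullet> x)) x). \<Lambda> ep : (\<Pi> y : Y. eq Y (f \<bullet> (g \<bullet> y)) y).
   \<Lambda> y : Y. \<Lambda> x : X. \<Lambda> p : eq Y (f \<bullet> x) y.
   based_J 0 Y (f \<bullet> x) (\<lambda>y p. \<Sigma> q : eq Y (f \<bullet> x) y. fib_sectionF X Y f g ep y x p q) y p
     (fib_shift 0 X Y f (g \<bullet> (f \<bullet> x)) x (et \<bullet> x) (ep \<bullet> (f \<bullet> x))))"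

schematic_goal fib_section_nf [nf]: "fib_sectionT 0 = ?T" "fib_section_t 0 = ?t"
  by (simp_all only: ho nat_simps)

definition [ho]: "fib_section l X Y f g et ep y x p = glob 8 l \<bullet> X \<bullet> Y \<bullet> f \<bullet> g \<bullet> et \<bullet> ep \<bullet> y \<bullet> x \<bullet> p"

text \<open>
  The fiber of \<open>f\<close> over \<open>y\<close> is a retract of \<open>\<Sigma> y1. y1 = y\<close>, so no adjustment of the homotopies is needed.
\<close>

definition [ho]: "quasi_inverseT = (\<Pi> X : univ 0. \<Pi> Y : univ 0. \<Pi> f : X \<rightarrow> Y. \<Pi> g : Y \<rightarrow> X.
   \<Pi> et : (\<Pi> x : X. eq X (g \<bullet> (f \<bullet> x)) x). \<Pi> ep : (\<Pi> y : Y. eq Y (f \<bullet> (g \<bullet> y)) y). isEquiv' X Y f)"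
definition [ho]: "quasi_inverse_t = (\<Lambda> X : univ 0. \<Lambda> Y : univ 0. \<Lambda> f : X \<rightarrow> Y. \<Lambda> g : Y \<rightarrow> X.
   \<Lambda> et : (\<Pi> x : X. eq X (g \<bullet> (f \<bullet> x)) x). \<Lambda> ep : (\<Pi> y : Y. eq Y (f \<bullet> (g \<bullet> y)) y).
   \<Lambda> y : Y. retract_contr 0 (\<Sigma> y1 : Y. eq Y y1 y) (fib' X Y f y)
     (\<Lambda> w : fib' X Y f y. tup (\<lambda>y1. eq Y y1 y) (f \<bullet> fst' X w)
        (fst' (eq Y (f \<bullet> fst' X w) y) (fib_section 0 X Y f g et ep y (fst' X w)
          (snd' X (\<lambda>x. eq Y (f \<bullet> x) y) w))))
     (\<Lambda> z : (\<Sigma> y1 : Y. eq Y y1 y). pair Y f y (g \<bullet> fst' Y z)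
       (trns Y (f \<bullet> (g \<bullet> fst' Y z)) (fst' Y z) y (ep \<bullet> fst' Y z) (snd' Y (\<lambda>y1. eq Y y1 y) z)))
     (\<Lambda> w : fib' X Y f y. sigE (\<lambda>w. eq (fib' X Y f y)
       (pair Y f y (g \<bullet> (f \<bullet> fst' X w)) (trns Y (f \<bullet> (g \<bullet> (f \<bullet> fst' X w))) (f \<bullet> fst' X w) y
       (ep \<bullet> (f \<bullet> fst' X w))
          (fst' (eq Y (f \<bullet> fst' X w) y) (fib_section 0 X Y f g et ep y (fst' X w)
            (snd' X (\<lambda>x. eq Y (f \<bullet> x) y) w))))) w)
        (\<lambda>x p. snd' (eq Y (f \<bullet> x) y) (\<lambda>q. fib_sectionF X Y f g ep y x p q)
          (fib_section 0 X Y f g et ep y x p)) w)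
     (singleton_to 0 Y y))"

schematic_goal quasi_inverse_nf [nf]: "quasi_inverseT 0 = ?T" "quasi_inverse_t 0 = ?t"
  by (simp_all only: ho nat_simps)

definition [ho]: "quasi_inverse l X Y f g et ep = glob 9 l \<bullet> X \<bullet> Y \<bullet> f \<bullet> g \<bullet> et \<bullet> ep"

subsection \<open>Function extensionality\<close>

definition [ho]: "ua_pathT = (\<Pi> X : univ 0. \<Pi> Y : univ 0. \<Pi> e : Equiv' X Y. fib' (eq (univ 0) X Y)
    (Equiv' X Y) (idtoequiv' 0 X Y) e)"
definition [ho]: "ua_path_t = (\<Lambda> X : univ 0. \<Lambda> Y : univ 0. \<Lambda> e : Equiv' X Y. ctr
    (fib' (eq (univ 0) X Y) (Equiv' X Y) (idtoequiv' 0 X Y) e) (ua 0 X Y \<bullet> e))"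

schematic_goal ua_path_nf [nf]: "ua_pathT 0 = ?T" "ua_path_t 0 = ?t"
  by (simp_all only: ho nat_simps)

definition [ho]: "ua_path l X Y e = glob 10 l \<bullet> X \<bullet> Y \<bullet> e"

text \<open>
  Unlike \<open>idtoequiv\<close>, the map \<open>coe\<close> has a small normal form.
\<close>

definition [ho]: "coe X Y p = eqE (\<lambda>X Y _. X \<rightarrow> Y) (\<lambda>X. \<Lambda> x : X. x) X Y p"
definition [ho]: "coe_idT = (\<Pi> X : univ 0. \<Pi> Y : univ 0. \<Pi> p : eq (univ 0) X Y. eq (X \<rightarrow> Y)
    (coe X Y p) (fst' (X \<rightarrow> Y) (idtoequiv' 0 X Y \<bullet> p)))"
definition [ho]: "coe_id_t = (\<Lambda> X : univ 0. \<Lambda> Y : univ 0. \<Lambda> p : eq (univ 0) X Y.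
   eqE (\<lambda>X Y p. eq (X \<rightarrow> Y) (coe X Y p) (fst' (X \<rightarrow> Y) (idtoequiv' 0 X Y \<bullet> p)))
     (\<lambda>X. rfl (\<Lambda> x : X. x)) X Y p)"

schematic_goal coe_id_nf [nf]: "coe_idT 0 = ?T" "coe_id_t 0 = ?t"
  by (simp_all only: ho nat_simps)

definition [ho]: "coe_id l X Y p = glob 11 l \<bullet> X \<bullet> Y \<bullet> p"

text \<open>Every equivalence is \<open>coe\<close> along some path, so a property of all
  equivalences can be proved by path induction.\<close>

definition [ho]: "ua_coeT = (\<Pi> X : univ 0. \<Pi> Y : univ 0. \<Pi> f : X \<rightarrow> Y. \<Pi> h : isEquiv' X Y f.
    \<Sigma> p : eq (univ 0) X Y. eq (X \<rightarrow> Y) (coe X Y p) f)"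
definition [ho]: "ua_coe_equiv X Y f h = tup (\<lambda>f. isEquiv' X Y f) f h"
definition [ho]: "ua_coe_t = (\<Lambda> X : univ 0. \<Lambda> Y : univ 0. \<Lambda> f : X \<rightarrow> Y. \<Lambda> h : isEquiv' X Y f.
   sigE (\<lambda>_. \<Sigma> p : eq (univ 0) X Y. eq (X \<rightarrow> Y) (coe X Y p) f)
    (\<lambda>p q. tup (\<lambda>p. eq (X \<rightarrow> Y) (coe X Y p) f) p
       (trns (X \<rightarrow> Y) (coe X Y p) (fst' (X \<rightarrow> Y) (idtoequiv' 0 X Y \<bullet> p)) f (coe_id 0 X Y p)
         (ap (X \<rightarrow> Y) (\<lambda>e. fst' (X \<rightarrow> Y) e) (idtoequiv' 0 X Y \<bullet> p) (ua_coe_equiv X Y f h) q)))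
    (ua_path 0 X Y (ua_coe_equiv X Y f h)))"

schematic_goal ua_coe_nf [nf]: "ua_coeT 0 = ?T" "ua_coe_t 0 = ?t"
  by (simp_all only: ho nat_simps)

definition [ho]: "ua_coe l X Y f h = glob 12 l \<bullet> X \<bullet> Y \<bullet> f \<bullet> h"

definition [ho]: "postcomp_fib A X Y f t = (\<Sigma> k : A \<rightarrow> X. eq (A \<rightarrow> Y) (\<Lambda> a : A. f \<bullet> (k \<bullet> a)) t)"
definition [ho]: "postcomp_prop A X Y f = (\<Pi> t : A \<rightarrow> Y. isProp' (postcomp_fib A X Y f t))"
definition [ho]: "postcomp_coeT = (\<Pi> A : univ 0. \<Pi> X : univ 0. \<Pi> Y : univ 0. \<Pi> p : eq
    (univ 0) X Y. postcomp_prop A X Y (coe X Y p))"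
text \<open>At reflexivity \<open>coe\<close> is the identity, and by eta the fiber over
  \<open>t\<close> becomes the type of functions equal to \<open>t\<close>, a singleton.\<close>

definition [ho]: "postcomp_coe_t = (\<Lambda> A : univ 0. \<Lambda> X : univ 0. \<Lambda> Y : univ 0. \<Lambda> p : eq (univ 0) X Y.
      eqE (\<lambda>X Y p. postcomp_prop A X Y (coe X Y p))
        (\<lambda>X. \<Lambda> t : A \<rightarrow> X. contr_prop 0 (\<Sigma> k : A \<rightarrow> X. eq (A \<rightarrow> X) k t)
          (singleton_to 0 (A \<rightarrow> X) t)) X Y p)"

schematic_goal postcomp_coe_nf [nf]: "postcomp_coeT 0 = ?T" "postcomp_coe_t 0 = ?t"
  by (simp_all only: ho nat_simps)

definition [ho]: "postcomp_coe l A X Y p = glob 13 l \<bullet> A \<bullet> X \<bullet> Y \<bullet> p"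
definition [ho]: "postcompT = (\<Pi> A : univ 0. \<Pi> X : univ 0. \<Pi> Y : univ 0. \<Pi> f : X \<rightarrow> Y.
    \<Pi> h : isEquiv' X Y f. postcomp_prop A X Y f)"
definition [ho]: "postcomp_t = (\<Lambda> A : univ 0. \<Lambda> X : univ 0. \<Lambda> Y : univ 0. \<Lambda> f : X \<rightarrow> Y.
    \<Lambda> h : isEquiv' X Y f.
    sigE (\<lambda>_. postcomp_prop A X Y f) (\<lambda>p q. tr (\<lambda>f. postcomp_prop A X Y f) (coe X Y p) f q
      (postcomp_coe 0 A X Y p)) (ua_coe 0 X Y f h))"

schematic_goal postcomp_nf [nf]: "postcompT 0 = ?T" "postcomp_t 0 = ?t"
  by (simp_all only: ho nat_simps)

definition [ho]: "postcomp l A X Y f h t = glob 14 l \<bullet> A \<bullet> X \<bullet> Y \<bullet> f \<bullet> h \<bullet> t"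

text \<open>
  The product of a family of contractible types is a retract of the fiber over the identity of
  post-composition with the projection, and post-composition with an equivalence has propositional fibers.
\<close>

definition [ho]: "total_space A P = (\<Sigma> x : A. P \<bullet> x)"
definition [ho]: "proj A P = (\<Lambda> z : total_space A P. fst' A z)"
definition [ho]: "proj_equivT = (\<Pi> A : univ 0. \<Pi> P : A \<rightarrow> univ 0.
    \<Pi> c : (\<Pi> x : A. isContr' (P \<bullet> x)). isEquiv' (total_space A P) A (proj A P))"
definition [ho]: "proj_equiv_t = (\<Lambda> A : univ 0. \<Lambda> P : A \<rightarrow> univ 0. \<Lambda> c : (\<Pi> x : A. isContr' (P \<bullet> x)).
   quasi_inverse 0 (total_space A P) A (proj A P) (\<Lambda> a : A. tup (\<lambda>x. P \<bullet> x) a (ctr (P \<bullet> a) (c \<bullet> a)))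
     (\<Lambda> z : total_space A P. sigE (\<lambda>z. eq (total_space A P)
       (tup (\<lambda>x. P \<bullet> x) (fst' A z) (ctr (P \<bullet> fst' A z) (c \<bullet> fst' A z))) z)
        (\<lambda>x w. ap (total_space A P) (\<lambda>w. tup (\<lambda>x. P \<bullet> x) x w) (ctr (P \<bullet> x) (c \<bullet> x)) w
          (ctrp (P \<bullet> x) (c \<bullet> x) w)) z)
     (\<Lambda> a : A. rfl a))"

schematic_goal proj_equiv_nf [nf]: "proj_equivT 0 = ?T" "proj_equiv_t 0 = ?t"
  by (simp_all only: ho nat_simps)

definition [ho]: "proj_equiv l A P c = glob 15 l \<bullet> A \<bullet> P \<bullet> c"
definition [ho]: "weak_funextT = (\<Pi> A : univ 0. \<Pi> P : A \<rightarrow> univ 0.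
    \<Pi> c : (\<Pi> x : A. isContr' (P \<bullet> x)). isProp' (\<Pi> x : A. P \<bullet> x))"
definition [ho]: "wf_comp A P k = (\<Lambda> a : A. proj A P \<bullet> (k \<bullet> a))"
definition [ho]: "wf_over A P k = eq (A \<rightarrow> A) (wf_comp A P k) (idfun' A)"
definition [ho]: "wf_graph A P phi = (\<Lambda> a : A. tup (\<lambda>x. P \<bullet> x) a (phi \<bullet> a))"
definition [ho]: "wf_point A P phi = tup (\<lambda>k. wf_over A P k) (wf_graph A P phi) (rfl (idfun' A))"
definition [ho]: "wf_section A P w = (\<Lambda> x : A. eqE (\<lambda>h h' q. P \<bullet> (h \<bullet> x) \<rightarrow> P \<bullet> (h' \<bullet> x))
    (\<lambda>h. \<Lambda> u : P \<bullet> (h \<bullet> x). u)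
     (wf_comp A P (fst' (A \<rightarrow> total_space A P) w)) (idfun' A)
       (snd' (A \<rightarrow> total_space A P) (\<lambda>k. wf_over A P k) w)
     \<bullet> snd' A (\<lambda>x. P \<bullet> x) (fst' (A \<rightarrow> total_space A P) w \<bullet> x))"
text \<open>\<open>wf_section\<close> undoes \<open>wf_point\<close> judgementally, because the path
  stored in \<open>wf_point\<close> is reflexivity. So an equality of two such points becomes
  \<open>f = g\<close> under \<open>ap\<close>. Propositionality of the product, rather than
  contractibility, is all that \<open>funext\<close> uses.\<close>

definition [ho]: "weak_funext_t = (\<Lambda> A : univ 0. \<Lambda> P : A \<rightarrow> univ 0.
    \<Lambda> c : (\<Pi> x : A. isContr' (P \<bullet> x)).
   \<Lambda> f : (\<Pi> x : A. P \<bullet> x). \<Lambda> g : (\<Pi> x : A. P \<bullet> x).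
   ap (\<Pi> x : A. P \<bullet> x) (\<lambda>w. wf_section A P w) (wf_point A P f) (wf_point A P g)
    (postcomp 0 A (total_space A P) A (proj A P) (proj_equiv 0 A P c)
      (idfun' A) \<bullet> wf_point A P f \<bullet> wf_point A P g))"

schematic_goal weak_funext_nf [nf]: "weak_funextT 0 = ?T" "weak_funext_t 0 = ?t"
  by (simp_all only: ho nat_simps)

definition [ho]: "weak_funext l A P c = glob 16 l \<bullet> A \<bullet> P \<bullet> c"

definition [ho]: "funextT = (\<Pi> A : univ 0. \<Pi> B : A \<rightarrow> univ 0. \<Pi> f : (\<Pi> x : A. B \<bullet> x).
    \<Pi> g : (\<Pi> x : A. B \<bullet> x).
   \<Pi> h : (\<Pi> x : A. eq (B \<bullet> x) (f \<bullet> x) (g \<bullet> x)). eq (\<Pi> x : A. B \<bullet> x) f g)"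
text \<open>The pairs of \<open>f\<close> with reflexivity and of \<open>g\<close> with
  \<open>h\<close> are two sections of the family of singletons at \<open>f x\<close>. Weak
  extensionality equates them, and first projections give \<open>f = g\<close>.\<close>

definition [ho]: "funext_t = (\<Lambda> A : univ 0. \<Lambda> B : A \<rightarrow> univ 0. \<Lambda> f : (\<Pi> x : A. B \<bullet> x).
    \<Lambda> g : (\<Pi> x : A. B \<bullet> x).
   \<Lambda> h : (\<Pi> x : A. eq (B \<bullet> x) (f \<bullet> x) (g \<bullet> x)).
   ap (\<Pi> x : A. B \<bullet> x) (\<lambda>t. \<Lambda> x : A. fst' (B \<bullet> x) (t \<bullet> x))
    (\<Lambda> x : A. tup (\<lambda>y. eq (B \<bullet> x) (f \<bullet> x) y) (f \<bullet> x) (rfl (f \<bullet> x)))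
      (\<Lambda> x : A. tup (\<lambda>y. eq (B \<bullet> x) (f \<bullet> x) y) (g \<bullet> x) (h \<bullet> x))
    (weak_funext 0 A (\<Lambda> x : A. singleton (B \<bullet> x) (f \<bullet> x))
      (\<Lambda> x : A. singleton_from 0 (B \<bullet> x) (f \<bullet> x))
       \<bullet> (\<Lambda> x : A. tup (\<lambda>y. eq (B \<bullet> x) (f \<bullet> x) y) (f \<bullet> x) (rfl (f \<bullet> x))) \<bullet> (\<Lambda> x : A. tup
         (\<lambda>y. eq (B \<bullet> x) (f \<bullet> x) y) (g \<bullet> x) (h \<bullet> x))))"

schematic_goal funext_nf [nf]: "funextT 0 = ?T" "funext_t 0 = ?t"
  by (simp_all only: ho nat_simps)

definition [ho]: "funext l A B f g h = glob 17 l \<bullet> A \<bullet> B \<bullet> f \<bullet> g \<bullet> h"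

text \<open>
  Corrects \<open>funext\<close> so that it inverts \<open>happ\<close> on the left: it suffices to know this at reflexivity.
\<close>

definition [ho]: "ext_section A B f g (fe :: term_at) = (\<Pi> p : eq (\<Pi> x : A. B \<bullet> x) f g. eq
    (eq (\<Pi> x : A. B \<bullet> x) f g) (fe \<bullet> (\<Lambda> x : A. happ (\<lambda>x. B \<bullet> x) f g p x)) p)"
definition [ho]: "ext_ty A B f g = (\<Sigma> fe : (\<Pi> x : A. eq (B \<bullet> x) (f \<bullet> x) (g \<bullet> x)) \<rightarrow> eq
    (\<Pi> x : A. B \<bullet> x) f g. ext_section A B f g fe)"
definition [ho]: "strong_funextT = (\<Pi> A : univ 0. \<Pi> B : A \<rightarrow> univ 0. \<Pi> f : (\<Pi> x : A. B \<bullet> x).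
    \<Pi> g : (\<Pi> x : A. B \<bullet> x). ext_ty A B f g)"
definition [ho]: "ext_map A B f g h = trns (\<Pi> x : A. B \<bullet> x) f f g
    (symm (\<Pi> x : A. B \<bullet> x) f f (funext 0 A B f f (\<Lambda> x : A. rfl (f \<bullet> x)))) (funext 0 A B f g h)"
definition [ho]: "strong_funext_t = (\<Lambda> A : univ 0. \<Lambda> B : A \<rightarrow> univ 0. \<Lambda> f : (\<Pi> x : A. B \<bullet> x).
    \<Lambda> g : (\<Pi> x : A. B \<bullet> x).
   tup (\<lambda>fe. ext_section A B f g fe) (\<Lambda> h : (\<Pi> x : A. eq (B \<bullet> x) (f \<bullet> x)
     (g \<bullet> x)). ext_map A B f g h)
    (\<Lambda> p : eq (\<Pi> x : A. B \<bullet> x) f g.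
      eqE (\<lambda>f g p. eq (eq (\<Pi> x : A. B \<bullet> x) f g)
        (ext_map A B f g (\<Lambda> x : A. happ (\<lambda>x. B \<bullet> x) f g p x)) p)
        (\<lambda>f. sym_trans 0 (\<Pi> x : A. B \<bullet> x) f f (funext 0 A B f f (\<Lambda> x : A. rfl (f \<bullet> x)))) f g p))"

schematic_goal strong_funext_nf [nf]: "strong_funextT 0 = ?T" "strong_funext_t 0 = ?t"
  by (simp_all only: ho nat_simps)

definition [ho]: "strong_funext l A B f g = glob 18 l \<bullet> A \<bullet> B \<bullet> f \<bullet> g"

subsection \<open>Propositions\<close>

definition [ho]: "prop_setT = (\<Pi> A : univ 0. \<Pi> h : isProp' A. \<Pi> x : A. \<Pi> y : A. isProp' (eq A x y))"
text \<open>Correcting \<open>h x y\<close> by \<open>h x x\<close> makes the path trivial when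
  \<open>y\<close> is \<open>x\<close>, so path induction identifies it with every path from
  \<open>x\<close> to \<open>y\<close>.\<close>

definition [ho]: "prop_path A h x y = trns A x x y (symm A x x (h \<bullet> x \<bullet> x)) (h \<bullet> x \<bullet> y)"
definition [ho]: "prop_path_eq A h x y p = eqE (\<lambda>x y p. eq (eq A x y) (prop_path A h x y) p)
    (\<lambda>x. sym_trans 0 A x x (h \<bullet> x \<bullet> x)) x y p"
definition [ho]: "prop_set_t = (\<Lambda> A : univ 0. \<Lambda> h : isProp' A. \<Lambda> x : A. \<Lambda> y : A. \<Lambda> p : eq A x y.
    \<Lambda> q : eq A x y.
   trns (eq A x y) p (prop_path A h x y) q (symm (eq A x y) (prop_path A h x y) p
     (prop_path_eq A h x y p)) (prop_path_eq A h x y q))"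

schematic_goal prop_set_nf [nf]: "prop_setT 0 = ?T" "prop_set_t 0 = ?t"
  by (simp_all only: ho nat_simps)

definition [ho]: "prop_set l A h x y = glob 19 l \<bullet> A \<bullet> h \<bullet> x \<bullet> y"

definition [ho]: "prop_PiT = (\<Pi> A : univ 0. \<Pi> B : A \<rightarrow> univ 0.
    \<Pi> b : (\<Pi> x : A. isProp' (B \<bullet> x)). isProp' (\<Pi> x : A. B \<bullet> x))"
definition [ho]: "prop_Pi_t = (\<Lambda> A : univ 0. \<Lambda> B : A \<rightarrow> univ 0. \<Lambda> b : (\<Pi> x : A. isProp' (B \<bullet> x)).
   \<Lambda> f : (\<Pi> x : A. B \<bullet> x). \<Lambda> g : (\<Pi> x : A. B \<bullet> x). funext 0 A B f g
     (\<Lambda> x : A. b \<bullet> x \<bullet> (f \<bullet> x) \<bullet> (g \<bullet> x)))"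

schematic_goal prop_Pi_nf [nf]: "prop_PiT 0 = ?T" "prop_Pi_t 0 = ?t"
  by (simp_all only: ho nat_simps)

definition [ho]: "prop_Pi l A B b = glob 20 l \<bullet> A \<bullet> B \<bullet> b"

text \<open>A citation raises all levels together, so one entry cannot serve both a base in the
  universe of the fibers and a base one universe higher. Both are needed: \<open>i = 1\<close> is
  for pairs of a type and a truncation proof.\<close>

definition [ho]: "subpair_ty i = (\<Pi> A : univ i. \<Pi> B : A \<rightarrow> univ 0.
    \<Pi> hB : (\<Pi> x : A. isProp' (B \<bullet> x)). \<Pi> x : A. \<Pi> y : A. \<Pi> p : eq A x y.
   \<Pi> u : B \<bullet> x. \<Pi> v : B \<bullet> y. eq (\<Sigma> x : A. B \<bullet> x) (tup (\<lambda>x. B \<bullet> x) x u) (tup (\<lambda>x. B \<bullet> x) y v))"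
definition [ho]: "subpair_tm i = (\<Lambda> A : univ i. \<Lambda> B : A \<rightarrow> univ 0.
    \<Lambda> hB : (\<Pi> x : A. isProp' (B \<bullet> x)). \<Lambda> x : A. \<Lambda> y : A. \<Lambda> p : eq A x y.
   eqE (\<lambda>x y p. \<Pi> u : B \<bullet> x. \<Pi> v : B \<bullet> y. eq (\<Sigma> x : A. B \<bullet> x) (tup (\<lambda>x. B \<bullet> x) x u)
     (tup (\<lambda>x. B \<bullet> x) y v))
     (\<lambda>x. \<Lambda> u : B \<bullet> x. \<Lambda> v : B \<bullet> x. ap (\<Sigma> x : A. B \<bullet> x) (\<lambda>u. tup (\<lambda>x. B \<bullet> x) x u) u v
       (hB \<bullet> x \<bullet> u \<bullet> v)) x y p)"
definition [ho]: "subpairT = subpair_ty 0"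
definition [ho]: "subpair_t = subpair_tm 0"

schematic_goal subpair_nf [nf]: "subpairT 0 = ?T" "subpair_t 0 = ?t"
  by (simp_all only: ho nat_simps)

definition [ho]: "subpair A B hB x y p u v = glob 21 0 \<bullet> A \<bullet> B \<bullet> hB \<bullet> x \<bullet> y \<bullet> p \<bullet> u \<bullet> v"
definition [ho]: "subpair_largeT = subpair_ty 1"
definition [ho]: "subpair_large_t = subpair_tm 1"

schematic_goal subpair_large_nf [nf]: "subpair_largeT 0 = ?T" "subpair_large_t 0 = ?t"
  by (simp_all only: ho nat_simps)

definition [ho]: "subpair_large A B hB x y p u v = glob 22 0 \<bullet> A \<bullet> B \<bullet> hB \<bullet> x \<bullet> y \<bullet> p \<bullet> u \<bullet> v"

definition [ho]: "prop_SigT = (\<Pi> A : univ 0. \<Pi> B : A \<rightarrow> univ 0. \<Pi> hA : isProp' A.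
    \<Pi> hB : (\<Pi> x : A. isProp' (B \<bullet> x)). isProp' (\<Sigma> x : A. B \<bullet> x))"
definition [ho]: "prop_Sig_t = (\<Lambda> A : univ 0. \<Lambda> B : A \<rightarrow> univ 0. \<Lambda> hA : isProp' A.
    \<Lambda> hB : (\<Pi> x : A. isProp' (B \<bullet> x)).
   \<Lambda> z : (\<Sigma> x : A. B \<bullet> x). \<Lambda> w : (\<Sigma> x : A. B \<bullet> x).
   sigE (\<lambda>z. eq (\<Sigma> x : A. B \<bullet> x) z w) (\<lambda>x u. sigE (\<lambda>w. eq (\<Sigma> x : A. B \<bullet> x) (tup (\<lambda>x. B \<bullet> x) x u) w)
     (\<lambda>y v. subpair A B hB x y (hA \<bullet> x \<bullet> y) u v) w) z)"

schematic_goal prop_Sig_nf [nf]: "prop_SigT 0 = ?T" "prop_Sig_t 0 = ?t"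
  by (simp_all only: ho nat_simps)

definition [ho]: "prop_Sig l A B hA hB = glob 23 l \<bullet> A \<bullet> B \<bullet> hA \<bullet> hB"

definition [ho]: "prop_contrT = (\<Pi> A : univ 0. isProp' (isContr' A))"
text \<open>The first of the two elements to be compared, \<open>c\<close>, already makes
  \<open>A\<close> a proposition. Then its path types are propositions too, and
  \<open>prop_Sig\<close> applies.\<close>

definition [ho]: "prop_contr_t = (\<Lambda> A : univ 0. \<Lambda> c : isContr' A.
    prop_Sig 0 A (\<Lambda> x : A. \<Pi> y : A. eq A x y) (contr_prop 0 A c)
      (\<Lambda> x : A. prop_Pi 0 A (\<Lambda> y : A. eq A x y)
        (\<Lambda> y : A. prop_set 0 A (contr_prop 0 A c) x y)) \<bullet> c)"

schematic_goal prop_contr_nf [nf]: "prop_contrT 0 = ?T" "prop_contr_t 0 = ?t"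
  by (simp_all only: ho nat_simps)

definition [ho]: "prop_contr l A = glob 24 l \<bullet> A"

subsection \<open>Truncated types\<close>

definition [ho]: "prop_truncT = (\<Pi> m : nat'. \<Pi> X : univ 0. isProp' (isTrunc' 0 m X))"
definition [ho]: "prop_trunc_t = (\<Lambda> m : nat'. natE (\<lambda>m. \<Pi> X : univ 0. isProp' (isTrunc' 0 m X))
   (\<Lambda> X : univ 0. prop_contr 0 X)
   (\<lambda>m r. \<Lambda> X : univ 0. prop_Pi 0 X (\<Lambda> x : X. \<Pi> y : X. isTrunc' 0 m (eq X x y))
      (\<Lambda> x : X. prop_Pi 0 X (\<Lambda> y : X. isTrunc' 0 m (eq X x y)) (\<Lambda> y : X. r \<bullet> eq X x y))) m)"

schematic_goal prop_trunc_nf [nf]: "prop_truncT 0 = ?T" "prop_trunc_t 0 = ?t"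
  by (simp_all only: ho nat_simps)

definition [ho]: "prop_trunc l m X = glob 25 l \<bullet> m \<bullet> X"

text \<open>A path type of a retract is a retract of a path type: the way back applies
  \<open>r\<close> and conjugates by \<open>h\<close>. On reflexivity the equation is
  \<open>sym_trans\<close>.\<close>

definition [ho]: "path_retractF A B s r h x y p = eq (eq B x y)
    (trns B x (r \<bullet> (s \<bullet> x)) y (symm B (r \<bullet> (s \<bullet> x)) x (h \<bullet> x))
      (trns B (r \<bullet> (s \<bullet> x)) (r \<bullet> (s \<bullet> y)) y (ap B (\<lambda>a. r \<bullet> a) (s \<bullet> x) (s \<bullet> y)
        (ap A (\<lambda>b. s \<bullet> b) x y p)) (h \<bullet> y))) p"
text \<open>The types and maps are quantified inside the induction, whose step uses the hypothesis
  for path types.\<close>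

definition [ho]: "retract_truncF m = (\<Pi> A : univ 0. \<Pi> B : univ 0. \<Pi> s : B \<rightarrow> A. \<Pi> r : A \<rightarrow> B.
    \<Pi> h : (\<Pi> b : B. eq B (r \<bullet> (s \<bullet> b)) b).
   isTrunc' 0 m A \<rightarrow> isTrunc' 0 m B)"
definition [ho]: "retract_truncT = (\<Pi> m : nat'. retract_truncF m)"
definition [ho]: "retract_trunc_t = (\<Lambda> m : nat'. natE retract_truncF
   (\<Lambda> A : univ 0. \<Lambda> B : univ 0. \<Lambda> s : B \<rightarrow> A. \<Lambda> r : A \<rightarrow> B. \<Lambda> h : (\<Pi> b : B. eq B (r \<bullet> (s \<bullet> b)) b).
     \<Lambda> c : isContr' A. retract_contr 0 A B s r h c)
   (\<lambda>m ih. \<Lambda> A : univ 0. \<Lambda> B : univ 0. \<Lambda> s : B \<rightarrow> A. \<Lambda> r : A \<rightarrow> B.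
     \<Lambda> h : (\<Pi> b : B. eq B (r \<bullet> (s \<bullet> b)) b). \<Lambda> t : isTrunc' 0 (succ m) A.
     \<Lambda> x : B. \<Lambda> y : B. ih \<bullet> eq A (s \<bullet> x) (s \<bullet> y) \<bullet> eq B x y \<bullet> (\<Lambda> p : eq B x y. ap A
       (\<lambda>b. s \<bullet> b) x y p)
      \<bullet> (\<Lambda> q : eq A (s \<bullet> x) (s \<bullet> y). trns B x (r \<bullet> (s \<bullet> x)) y (symm B (r \<bullet> (s \<bullet> x)) x (h \<bullet> x))
          (trns B (r \<bullet> (s \<bullet> x)) (r \<bullet> (s \<bullet> y)) y (ap B (\<lambda>a. r \<bullet> a) (s \<bullet> x) (s \<bullet> y) q) (h \<bullet> y)))
      \<bullet> (\<Lambda> p : eq B x y. eqE (path_retractF A B s r h)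
        (\<lambda>x. sym_trans 0 B (r \<bullet> (s \<bullet> x)) x (h \<bullet> x)) x y p)
      \<bullet> (t \<bullet> (s \<bullet> x) \<bullet> (s \<bullet> y))) m)"

schematic_goal retract_trunc_nf [nf]: "retract_truncT 0 = ?T" "retract_trunc_t 0 = ?t"
  by (simp_all only: ho nat_simps)

definition [ho]: "retract_trunc l m A B s r h t = glob 26 l \<bullet> m \<bullet> A \<bullet> B \<bullet> s \<bullet> r \<bullet> h \<bullet> t"

definition [ho]: "trunc_PiF m = (\<Pi> A : univ 0. \<Pi> B : A \<rightarrow> univ 0.
    \<Pi> t : (\<Pi> x : A. isTrunc' 0 m (B \<bullet> x)). isTrunc' 0 m (\<Pi> x : A. B \<bullet> x))"
definition [ho]: "trunc_PiT = (\<Pi> m : nat'. trunc_PiF m)"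
text \<open>In the step, \<open>strong_funext\<close> presents the paths from \<open>f\<close> to
  \<open>g\<close> as a retract of the pointwise equalities. Retracts inherit truncatedness, so a
  one-sided inverse of \<open>happ\<close> is enough.\<close>

definition [ho]: "trunc_Pi_t = (\<Lambda> m : nat'. natE trunc_PiF
   (\<Lambda> A : univ 0. \<Lambda> B : A \<rightarrow> univ 0. \<Lambda> c : (\<Pi> x : A. isContr' (B \<bullet> x)).
      tup (\<lambda>f. \<Pi> g : (\<Pi> x : A. B \<bullet> x). eq (\<Pi> x : A. B \<bullet> x) f g) (\<Lambda> x : A. ctr (B \<bullet> x) (c \<bullet> x))
       (\<Lambda> g : (\<Pi> x : A. B \<bullet> x). funext 0 A B (\<Lambda> x : A. ctr (B \<bullet> x) (c \<bullet> x)) g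
         (\<Lambda> x : A. ctrp (B \<bullet> x) (c \<bullet> x) (g \<bullet> x))))
   (\<lambda>m ih. \<Lambda> A : univ 0. \<Lambda> B : A \<rightarrow> univ 0. \<Lambda> t : (\<Pi> x : A. isTrunc' 0 (succ m) (B \<bullet> x)).
      \<Lambda> f : (\<Pi> x : A. B \<bullet> x). \<Lambda> g : (\<Pi> x : A. B \<bullet> x).
      retract_trunc 0 m (\<Pi> x : A. eq (B \<bullet> x) (f \<bullet> x) (g \<bullet> x)) (eq (\<Pi> x : A. B \<bullet> x) f g)
        (\<Lambda> p : eq (\<Pi> x : A. B \<bullet> x) f g. \<Lambda> x : A. happ (\<lambda>x. B \<bullet> x) f g p x)
        (fst' ((\<Pi> x : A. eq (B \<bullet> x) (f \<bullet> x) (g \<bullet> x)) \<rightarrow> eq (\<Pi> x : A. B \<bullet> x) f g)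
          (strong_funext 0 A B f g))
        (snd' ((\<Pi> x : A. eq (B \<bullet> x) (f \<bullet> x) (g \<bullet> x)) \<rightarrow> eq (\<Pi> x : A. B \<bullet> x) f g)
          (\<lambda>fe. ext_section A B f g fe) (strong_funext 0 A B f g))
        (ih \<bullet> A \<bullet> (\<Lambda> x : A. eq (B \<bullet> x) (f \<bullet> x) (g \<bullet> x)) \<bullet> (\<Lambda> x : A. t \<bullet> x \<bullet> (f \<bullet> x) \<bullet> (g \<bullet> x)))) m)"

schematic_goal trunc_Pi_nf [nf]: "trunc_PiT 0 = ?T" "trunc_Pi_t 0 = ?t"
  by (simp_all only: ho nat_simps)

definition [ho]: "trunc_Pi l m A B t = glob 27 l \<bullet> m \<bullet> A \<bullet> B \<bullet> t"

definition [ho]: "Pi_prop_eqT = (\<Pi> K : univ 0. \<Pi> kp : isProp' K. \<Pi> w0 : K. \<Pi> P : K \<rightarrow> univ 0. eq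
    (univ 0) (\<Pi> w : K. P \<bullet> w) (P \<bullet> w0))"
definition [ho]: "const_section K kp w0 P y = (\<Lambda> w : K. tr (\<lambda>w. P \<bullet> w) w0 w (kp \<bullet> w0 \<bullet> w) y)"
text \<open>Evaluation at \<open>w0\<close> is inverted by transport from \<open>w0\<close>. One
  round trip is a path induction along \<open>kp w0 w\<close>; the other needs the loop
  \<open>kp w0 w0\<close> to be reflexivity, which holds because a proposition is a set.\<close>

definition [ho]: "Pi_prop_eq_t = (\<Lambda> K : univ 0. \<Lambda> kp : isProp' K. \<Lambda> w0 : K. \<Lambda> P : K \<rightarrow> univ 0.
   fst' (eq (univ 0) (\<Pi> w : K. P \<bullet> w) (P \<bullet> w0)) (ua_path 0 (\<Pi> w : K. P \<bullet> w) (P \<bullet> w0)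
     (tup (\<lambda>f. isEquiv' (\<Pi> w : K. P \<bullet> w) (P \<bullet> w0) f) (\<Lambda> f : (\<Pi> w : K. P \<bullet> w). f \<bullet> w0)
       (quasi_inverse 0 (\<Pi> w : K. P \<bullet> w) (P \<bullet> w0) (\<Lambda> f : (\<Pi> w : K. P \<bullet> w). f \<bullet> w0)
         (\<Lambda> y : P \<bullet> w0. const_section K kp w0 P y)
         (\<Lambda> f : (\<Pi> w : K. P \<bullet> w). funext 0 K P (const_section K kp w0 P (f \<bullet> w0)) f
            (\<Lambda> w : K. eqE (\<lambda>v w p. eq (P \<bullet> w) (tr (\<lambda>w. P \<bullet> w) v w p (f \<bullet> v)) (f \<bullet> w))
              (\<lambda>w. rfl (f \<bullet> w)) w0 w (kp \<bullet> w0 \<bullet> w)))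
         (\<Lambda> y : P \<bullet> w0. ap (P \<bullet> w0) (\<lambda>q. tr (\<lambda>w. P \<bullet> w) w0 w0 q y) (kp \<bullet> w0 \<bullet> w0) (rfl w0)
            (prop_set 0 K kp w0 w0 \<bullet> (kp \<bullet> w0 \<bullet> w0) \<bullet> rfl w0))))))"

schematic_goal Pi_prop_eq_nf [nf]: "Pi_prop_eqT 0 = ?T" "Pi_prop_eq_t 0 = ?t"
  by (simp_all only: ho nat_simps)

definition [ho]: "Pi_prop_eq l K kp w0 P = glob 28 l \<bullet> K \<bullet> kp \<bullet> w0 \<bullet> P"

definition [ho]: "TTypes_eqT = (\<Pi> m : nat'. \<Pi> z : TTypes 0 m. \<Pi> w : TTypes 0 m. \<Pi> p : eq (univ 0)
    (fst' (univ 0) z) (fst' (univ 0) w). eq (TTypes 0 m) z w)"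
definition [ho]: "TTypes_eq_t = (\<Lambda> m : nat'. \<Lambda> z : TTypes 0 m. \<Lambda> w : TTypes 0 m.
   sigE (\<lambda>z. \<Pi> p : eq (univ 0) (fst' (univ 0) z) (fst' (univ 0) w). eq (TTypes 0 m) z w)
     (\<lambda>x u. sigE (\<lambda>w. \<Pi> p : eq (univ 0) x (fst' (univ 0) w). eq (TTypes 0 m)
       (tup (\<lambda>X. isTrunc' 0 m X) x u) w)
       (\<lambda>y v. \<Lambda> p : eq (univ 0) x y. subpair_large (univ 0) (\<Lambda> X : univ 0. isTrunc' 0 m X)
         (\<Lambda> X : univ 0. prop_trunc 0 m X) x y p u v) w) z)"

schematic_goal TTypes_eq_nf [nf]: "TTypes_eqT 0 = ?T" "TTypes_eq_t 0 = ?t"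
  by (simp_all only: ho nat_simps)

definition [ho]: "TTypes_eq l m z w p = glob 29 l \<bullet> m \<bullet> z \<bullet> w \<bullet> p"

subsection \<open>Injectivity\<close>

text \<open>
  The domain \<open>X\<close> is raised to the next universe by pairing it with a universe.
\<close>

definition [ho]: "funext_largeT = (\<Pi> X : univ 0. \<Pi> C : univ 1. \<Pi> f : X \<rightarrow> C. \<Pi> g : X \<rightarrow> C.
    \<Pi> h : (\<Pi> x : X. eq C (f \<bullet> x) (g \<bullet> x)). eq (X \<rightarrow> C) f g)"
definition [ho]: "funext_large_t = (\<Lambda> X : univ 0. \<Lambda> C : univ 1. \<Lambda> f : X \<rightarrow> C. \<Lambda> g : X \<rightarrow> C.
    \<Lambda> h : (\<Pi> x : X. eq C (f \<bullet> x) (g \<bullet> x)).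
   ap (X \<rightarrow> C) (\<lambda>F. \<Lambda> x : X. F \<bullet> tup (\<lambda>_. univ 0) x X)
     (\<Lambda> z : (\<Sigma> _ : X. univ 0). f \<bullet> fst' X z) (\<Lambda> z : (\<Sigma> _ : X. univ 0). g \<bullet> fst' X z)
     (funext 1 (\<Sigma> _ : X. univ 0) (\<Lambda> z : (\<Sigma> _ : X. univ 0). C)
       (\<Lambda> z : (\<Sigma> _ : X. univ 0). f \<bullet> fst' X z) (\<Lambda> z : (\<Sigma> _ : X. univ 0). g \<bullet> fst' X z)
       (\<Lambda> z : (\<Sigma> _ : X. univ 0). h \<bullet> fst' X z)))"

schematic_goal funext_large_nf [nf]: "funext_largeT 0 = ?T" "funext_large_t 0 = ?t"
  by (simp_all only: ho nat_simps)

definition [ho]: "funext_large l X C f g h = glob 30 l \<bullet> X \<bullet> C \<bullet> f \<bullet> g \<bullet> h"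

definition [ho]: "extensionF m A B j F G = (\<Pi> a : A. eq (TTypes 0 m) (G \<bullet> (j \<bullet> a)) (F \<bullet> a))"
definition [ho]: "extensionT = (\<Pi> m : nat'. \<Pi> A : univ 0. \<Pi> B : univ 0. \<Pi> j : A \<rightarrow> B.
    \<Pi> e : isEmb' A B j. \<Pi> F : A \<rightarrow> TTypes 0 m.
   \<Sigma> G : B \<rightarrow> TTypes 0 m. extensionF m A B j F G)"
definition [ho]: "extensionP A F = (\<lambda>w. fst' (univ 0) (F \<bullet> fst' A w))"
definition [ho]: "extensionG m A B j F b = tup (\<lambda>X. isTrunc' 0 m X)
    (\<Pi> w : fib' A B j b. extensionP A F w)
    (trunc_Pi 0 m (fib' A B j b) (\<Lambda> w : fib' A B j b. extensionP A F w)
      (\<Lambda> w : fib' A B j b. snd' (univ 0) (\<lambda>X. isTrunc' 0 m X) (F \<bullet> fst' A w)))"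
definition [ho]: "extension_t = (\<Lambda> m : nat'. \<Lambda> A : univ 0. \<Lambda> B : univ 0. \<Lambda> j : A \<rightarrow> B.
    \<Lambda> e : isEmb' A B j. \<Lambda> F : A \<rightarrow> TTypes 0 m.
   tup (\<lambda>G. extensionF m A B j F G) (\<Lambda> b : B. extensionG m A B j F b)
     (\<Lambda> a : A. TTypes_eq 0 m (extensionG m A B j F (j \<bullet> a)) (F \<bullet> a)
        (Pi_prop_eq 0 (fib' A B j (j \<bullet> a)) (e \<bullet> (j \<bullet> a)) (pair B j (j \<bullet> a) a (rfl (j \<bullet> a)))
          (\<Lambda> w : fib' A B j (j \<bullet> a). extensionP A F w))))"

schematic_goal extension_nf [nf]: "extensionT 0 = ?T" "extension_t 0 = ?t"
  by (simp_all only: ho nat_simps)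

definition [ho]: "extension l m A B j e F = glob 31 l \<bullet> m \<bullet> A \<bullet> B \<bullet> j \<bullet> e \<bullet> F"

definition [ho]: "retF D X m = Retract' D (X \<rightarrow> TTypes 0 m)"
definition [ho]: "retract_injT = (\<Pi> m : nat'. \<Pi> D : univ 0.
    (\<Sigma> X : univ 0. retF D X m) \<rightarrow> AInj' 0 0 D)"
definition [ho]: "inj_ext m D X s A B e f x = extension 0 m A B (fst' (A \<rightarrow> B) e)
    (snd' (A \<rightarrow> B) (\<lambda>j. isEmb' A B j) e) (\<Lambda> a : A. s \<bullet> (f \<bullet> a) \<bullet> x)"
definition [ho]: "inj_fst m D X s A B e f x = fst' (B \<rightarrow> TTypes 0 m) (inj_ext m D X s A B e f x)"
definition [ho]: "inj_snd m D X s A B e f x = snd' (B \<rightarrow> TTypes 0 m)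
   (\<lambda>G. extensionF m A B (fst' (A \<rightarrow> B) e) (\<Lambda> a : A. s \<bullet> (f \<bullet> a) \<bullet> x) G) (inj_ext m D X s A B e f x)"
text \<open>The extension is formed separately for each exponent \<open>x\<close>, from the family
  of all \<open>s (f a) x\<close>, and \<open>r\<close> is applied to the collected result.
  \<open>funext_large\<close> joins the pointwise equalities before \<open>r\<close> is
  applied.\<close>

definition [ho]: "retract_inj_t = (\<Lambda> m : nat'. \<Lambda> D : univ 0. \<Lambda> w : (\<Sigma> X : univ 0. retF D X m).
   sigE (\<lambda>_. AInj' 0 0 D) (\<lambda>X w. sigE (\<lambda>_. AInj' 0 0 D) (\<lambda>s w. sigE (\<lambda>_. AInj' 0 0 D) (\<lambda>r h.
     \<Lambda> A : univ 0. \<Lambda> B : univ 0. \<Lambda> e : Emb' A B. \<Lambda> f : A \<rightarrow> D.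
      tup (\<lambda>g. Htpy' A D (cmp' A g (fst' (A \<rightarrow> B) e)) f)
       (\<Lambda> b : B. r \<bullet> (\<Lambda> x : X. inj_fst m D X s A B e f x \<bullet> b))
       (\<Lambda> a : A. trns D (r \<bullet> (\<Lambda> x : X. inj_fst m D X s A B e f x \<bullet> (fst' (A \<rightarrow> B) e \<bullet> a)))
         (r \<bullet> (s \<bullet> (f \<bullet> a))) (f \<bullet> a)
         (ap D (\<lambda>F. r \<bullet> F) (\<Lambda> x : X. inj_fst m D X s A B e f x \<bullet> (fst' (A \<rightarrow> B) e \<bullet> a)) (s \<bullet> (f \<bullet> a))
           (funext_large 0 X (TTypes 0 m) (\<Lambda> x : X. inj_fst m D X s A B e f x \<bullet> (fst'
             (A \<rightarrow> B) e \<bullet> a)) (s \<bullet> (f \<bullet> a))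
             (\<Lambda> x : X. inj_snd m D X s A B e f x \<bullet> a)))
         (h \<bullet> (f \<bullet> a)))) w) w) w)"

schematic_goal retract_inj_nf [nf]: "retract_injT 0 = ?T" "retract_inj_t 0 = ?t"
  by (simp_all only: ho nat_simps)

definition [ho]: "retract_inj l m D w = glob 32 l \<bullet> m \<bullet> D \<bullet> w"

text \<open>
  The unit type is available only in the lowest universe, so \<open>Q \<rightarrow> Q\<close> serves as the contractible codomain.
\<close>

definition [ho]: "const_id Q = (\<Lambda> _ : Q. \<Lambda> q : Q. q)"
definition [ho]: "const_embT = (\<Pi> Q : univ 0. \<Pi> h : isProp' Q. isEmb' Q (Q \<rightarrow> Q) (const_id Q))"
definition [ho]: "const_emb_t = (\<Lambda> Q : univ 0. \<Lambda> h : isProp' Q. \<Lambda> y : Q \<rightarrow> Q.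
   prop_Sig 0 Q (\<Lambda> q : Q. eq (Q \<rightarrow> Q) (const_id Q \<bullet> q) y) h
    (\<Lambda> q : Q. prop_set 0 (Q \<rightarrow> Q) (prop_Pi 0 Q (\<Lambda> _ : Q. Q) (\<Lambda> _ : Q. h)) (const_id Q \<bullet> q) y))"

schematic_goal const_emb_nf [nf]: "const_embT 0 = ?T" "const_emb_t 0 = ?t"
  by (simp_all only: ho nat_simps)

definition [ho]: "const_emb l Q h = glob 33 l \<bullet> Q \<bullet> h"

text \<open>Algebraic flabbiness: partial elements defined on a proposition extend to total ones.
  Since \<open>const_id Q\<close> sends every \<open>q\<close> to the identity judgementally, the
  homotopy of the extension is already the required family of equalities.\<close>

definition [ho]: "flabbyT = (\<Pi> D : univ 0. \<Pi> i : AInj' 0 0 D. \<Pi> Q : univ 0. \<Pi> h : isProp' Q.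
    \<Pi> f : Q \<rightarrow> D.
   \<Sigma> d : D. \<Pi> q : Q. eq D d (f \<bullet> q))"
definition [ho]: "flabby_emb Q h = tup (\<lambda>j. isEmb' Q (Q \<rightarrow> Q) j) (const_id Q) (const_emb 0 Q h)"
definition [ho]: "flabby_ext i Q h f = i \<bullet> Q \<bullet> (Q \<rightarrow> Q) \<bullet> flabby_emb Q h \<bullet> f"
definition [ho]: "flabby_t = (\<Lambda> D : univ 0. \<Lambda> i : AInj' 0 0 D. \<Lambda> Q : univ 0. \<Lambda> h : isProp' Q.
    \<Lambda> f : Q \<rightarrow> D.
   tup (\<lambda>d. \<Pi> q : Q. eq D d (f \<bullet> q)) (fst' ((Q \<rightarrow> Q) \<rightarrow> D) (flabby_ext i Q h f) \<bullet> (\<Lambda> q : Q. q))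
     (snd' ((Q \<rightarrow> Q) \<rightarrow> D) (\<lambda>g. Htpy' Q D (cmp' Q g (fst' (Q \<rightarrow> Q \<rightarrow> Q) (flabby_emb Q h))) f)
       (flabby_ext i Q h f)))"

schematic_goal flabby_nf [nf]: "flabbyT 0 = ?T" "flabby_t 0 = ?t"
  by (simp_all only: ho nat_simps)

definition [ho]: "flabby l D i Q h f = glob 34 l \<bullet> D \<bullet> i \<bullet> Q \<bullet> h \<bullet> f"

definition [ho]: "inj_retractT = (\<Pi> m : nat'. \<Pi> D : univ 0. \<Pi> t : isTrunc' 0
    (succ m) D. AInj' 0 0 D \<rightarrow> (\<Sigma> X : univ 0. retF D X m))"
definition [ho]: "family_total D phi = (\<Sigma> x : D. fst' (univ 0) (phi \<bullet> x))"
definition [ho]: "centre D phi = (\<Lambda> q : isContr' (family_total D phi). fst' D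
    (ctr (family_total D phi) q))"
definition [ho]: "centre_ext D i phi = flabby 0 D i (isContr' (family_total D phi))
    (prop_contr 0 (family_total D phi)) (centre D phi)"
definition [ho]: "path_family D m t = (\<Lambda> d : D. \<Lambda> x : D. tup (\<lambda>X. isTrunc' 0 m X) (eq D d x)
    (t \<bullet> d \<bullet> x))"
definition [ho]: "family_retract D m i = (\<Lambda> phi : D \<rightarrow> TTypes 0 m. fst' D (centre_ext D i phi))"
text \<open>Contractibility of the singleton is restated because the citation
  \<open>singleton_from\<close> is opaque: here the centre is visibly \<open>d\<close> with
  reflexivity, so \<open>centre\<close> computes to \<open>d\<close> in
  \<open>family_retract_eq\<close>.\<close>

definition [ho]: "path_centre D d = tup (\<lambda>c. \<Pi> y : singleton D d. eq (singleton D d) c y)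
    (tup (\<lambda>x. eq D d x) d (rfl d))
   (\<Lambda> z : singleton D d. contr_prop 0 (singleton D d) (singleton_from 0 D d) \<bullet> tup
     (\<lambda>x. eq D d x) d (rfl d) \<bullet> z)"
definition [ho]: "family_retract_eq D m t i = (\<Lambda> d : D. snd' D
    (\<lambda>e. \<Pi> q : isContr' (family_total D (path_family D m t \<bullet> d)). eq D e
    (centre D (path_family D m t \<bullet> d) \<bullet> q))
    (centre_ext D i (path_family D m t \<bullet> d)) \<bullet> path_centre D d)"
definition [ho]: "inj_retract_t = (\<Lambda> m : nat'. \<Lambda> D : univ 0. \<Lambda> t : isTrunc' 0 (succ m) D.
    \<Lambda> i : AInj' 0 0 D.
   tup (\<lambda>X. retF D X m) D (tup (\<lambda>s. \<Sigma> r : (D \<rightarrow> TTypes 0 m) \<rightarrow> D. Htpy' D D (cmp' D r s) (idfun' D))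
     (path_family D m t)
     (tup (\<lambda>r. Htpy' D D (cmp' D r (path_family D m t)) (idfun' D)) (family_retract D m i)
       (family_retract_eq D m t i))))"

schematic_goal inj_retract_nf [nf]: "inj_retractT 0 = ?T" "inj_retract_t 0 = ?t"
  by (simp_all only: ho nat_simps)

definition [ho]: "inj_retract l m D t i = glob 35 l \<bullet> m \<bullet> D \<bullet> t \<bullet> i"

definition [ho]: "mainT = (\<Pi> m : nat'. \<Pi> D : univ 0. isTrunc' 0 (succ m) D \<rightarrow>
   (\<Sigma> _ : AInj' 0 0 D \<rightarrow> (\<Sigma> X : univ 0. retF D X m). (\<Sigma> X : univ 0. retF D X m) \<rightarrow> AInj' 0 0 D))"
definition [ho]: "main_t = (\<Lambda> m : nat'. \<Lambda> D : univ 0. \<Lambda> t : isTrunc' 0 (succ m) D.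
   tup (\<lambda>_. (\<Sigma> X : univ 0. retF D X m) \<rightarrow> AInj' 0 0 D) (\<Lambda> i : AInj' 0 0 D. inj_retract 0 m D t i)
     (\<Lambda> w : (\<Sigma> X : univ 0. retF D X m). retract_inj 0 m D w))"

schematic_goal main_nf [nf]: "mainT 0 = ?T" "main_t 0 = ?t"
  by (simp_all only: ho nat_simps)



section \<open>Checking the terms\<close>

text \<open>Positions are the numbers used by \<open>glob\<close>. Entry \<open>k\<close> is checked
  against \<open>take k lib\<close>, so a proof can cite earlier entries only.\<close>

definition lib :: "ctm list" where
  "lib = [uaT 0, trans_symT 0, sym_transT 0, singleton_fromT 0, singleton_toT 0, retract_contrT 0, contr_propT 0, fib_shiftT 0, fib_sectionT 0, quasi_inverseT 0, ua_pathT 0, coe_idT 0, ua_coeT 0, postcomp_coeT 0, postcompT 0, proj_equivT 0, weak_funextT 0, funextT 0, strong_funextT 0, prop_setT 0, prop_PiT 0, subpairT 0, subpair_largeT 0, prop_SigT 0, prop_contrT 0, prop_truncT 0, retract_truncT 0, trunc_PiT 0, Pi_prop_eqT 0, TTypes_eqT 0, funext_largeT 0, extensionT 0, retract_injT 0, const_embT 0, flabbyT 0, inj_retractT 0]"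

lemma gty_lib:
  "gty lib 0 l = Some (shl l (uaT 0))"
  "gty lib 1 l = Some (shl l (trans_symT 0))"
  "gty lib 2 l = Some (shl l (sym_transT 0))"
  "gty lib 3 l = Some (shl l (singleton_fromT 0))"
  "gty lib 4 l = Some (shl l (singleton_toT 0))"
  "gty lib 5 l = Some (shl l (retract_contrT 0))"
  "gty lib 6 l = Some (shl l (contr_propT 0))"
  "gty lib 7 l = Some (shl l (fib_shiftT 0))"
  "gty lib 8 l = Some (shl l (fib_sectionT 0))"
  "gty lib 9 l = Some (shl l (quasi_inverseT 0))"
  "gty lib 10 l = Some (shl l (ua_pathT 0))"
  "gty lib 11 l = Some (shl l (coe_idT 0))"
  "gty lib 12 l = Some (shl l (ua_coeT 0))"
  "gty lib 13 l = Some (shl l (postcomp_coeT 0))"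
  "gty lib 14 l = Some (shl l (postcompT 0))"
  "gty lib 15 l = Some (shl l (proj_equivT 0))"
  "gty lib 16 l = Some (shl l (weak_funextT 0))"
  "gty lib 17 l = Some (shl l (funextT 0))"
  "gty lib 18 l = Some (shl l (strong_funextT 0))"
  "gty lib 19 l = Some (shl l (prop_setT 0))"
  "gty lib 20 l = Some (shl l (prop_PiT 0))"
  "gty lib 21 l = Some (shl l (subpairT 0))"
  "gty lib 22 l = Some (shl l (subpair_largeT 0))"
  "gty lib 23 l = Some (shl l (prop_SigT 0))"
  "gty lib 24 l = Some (shl l (prop_contrT 0))"
  "gty lib 25 l = Some (shl l (prop_truncT 0))"
  "gty lib 26 l = Some (shl l (retract_truncT 0))"
  "gty lib 27 l = Some (shl l (trunc_PiT 0))"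
  "gty lib 28 l = Some (shl l (Pi_prop_eqT 0))"
  "gty lib 29 l = Some (shl l (TTypes_eqT 0))"
  "gty lib 30 l = Some (shl l (funext_largeT 0))"
  "gty lib 31 l = Some (shl l (extensionT 0))"
  "gty lib 32 l = Some (shl l (retract_injT 0))"
  "gty lib 33 l = Some (shl l (const_embT 0))"
  "gty lib 34 l = Some (shl l (flabbyT 0))"
  "gty lib 35 l = Some (shl l (inj_retractT 0))"
  by (simp_all add: lib_def numeral_eq_Suc)

lemmas gty_lib_nf = gty_lib[unfolded One_nat_def numeral_2_eq_2 nf]

lemma gty_take: "gty (take k L) g l = (if g < k then gty L g l else None)"
proof (induction L g l arbitrary: k rule: gty.induct)
  case (1 n l)
  then show ?case by simp
next
  case (2 A L l)
  then show ?case by (cases k) auto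
next
  case (3 A L n l)
  then show ?case by (cases k) auto
qed

lemma shl_0: "shl 0 t = t"
proof (induction t)
  case (CU l)
  then show ?case by (cases l) auto
qed auto

definition upto :: "const set \<Rightarrow> nat \<Rightarrow> bool" where
  "upto S k \<longleftrightarrow> (\<forall>g < k. g < length lib \<and> provable S (lib ! g))"

text \<open>The number 100 is fuel, a bound on recursion depth that suffices for every
  entry.\<close>

lemma upto_step:
  assumes "upto S k" "gty lib k 0 = Some T" "pure_closed 0 T"
    "level (iter (take k lib) 100) [] T \<noteq> None" "check (iter (take k lib) 100) [] t T" "k' = Suc k"
  shows "upto S k'"
proof -
  have k: "k < length lib" "lib ! k = T" using gty_Some[OF assms(2)] by (auto simp: shl_0)
  have "provable S T"
    using assms(1) k by (intro provable_step[OF _ assms(3-5)]) (auto simp: upto_def)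
  then show ?thesis using assms(1,6) k by (auto simp: upto_def less_Suc_eq)
qed

lemmas eval_lib = eval gty_lib_nf gty_take nf pure_closed.simps less_num_simps le_num_simps numeral_less_iff zero_less_numeral less_Suc_numeral
  eq_numeral_Suc numeral_eq_iff num.inject num.distinct

lemma const_type_UA: "const_type (UA u) = I0 u (uaT 0)"
  by (simp add: I0_def ho numeral_eq_Suc isProp_def isEquiv_def isContr_def fib_def fibTup_def Equiv_def Arr_def
    idtoequiv_def idEquiv_def idfun_def Let_def wk_def)

context
  fixes S :: "const set"
  assumes univalent: "univalence \<subseteq> S"
begin

lemma ua_provable: "upto S 1"
proof -
  have T: "pure_closed 0 (uaT 0)" and l: "level (iter [] 100) [] (uaT 0) \<noteq> None"
    by (simp_all only: eval_lib cong: eval_cong)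
  interpret model S "[]" "\<lambda>_ _. Star" by standard auto
  have i: "\<exists>i. S \<parallel> [] \<turnstile> I0 u (uaT 0) \<Ztypecolon> Univ i" for u
  proof -
    interpret model_at S "[]" "\<lambda>_ _. Star" u by standard
    show ?thesis using l level_sound I0_eq[OF T] by force
  qed
  \<comment> \<open>\<open>ty_Const\<close> requires the assumed type to be a type; this is what the
    level check over the empty library provides.\<close>
  have "S \<parallel> [] \<turnstile> Const (UA u) \<Ztypecolon> I0 u (uaT 0)" for u
    using i[of u] univalent ty_Const[of "UA u" S "[]"] unfolding const_type_UA univalence_def by blast
  then have "inhabits S (Const (UA u)) (I0 u (uaT 0))" for u
    by (simp add: inhabits_def)
  then have "provable S (uaT 0)" using T i by (auto simp: provable_def)
  then show ?thesis by (simp add: upto_def lib_def)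
qed

lemma trans_sym_provable: "upto S 2"
  by (rule upto_step[OF ua_provable, where T = "trans_symT 0" and t = "trans_sym_t 0"])
    (simp_all only: eval_lib cong: eval_cong)

lemma sym_trans_provable: "upto S 3"
  by (rule upto_step[OF trans_sym_provable, where T = "sym_transT 0" and t = "sym_trans_t 0"])
    (simp_all only: eval_lib cong: eval_cong)

lemma singleton_from_provable: "upto S 4"
  by (rule upto_step[OF sym_trans_provable, where T = "singleton_fromT 0" and t = "singleton_from_t 0"])
    (simp_all only: eval_lib cong: eval_cong)

lemma singleton_to_provable: "upto S 5"
  by (rule upto_step[OF singleton_from_provable, where T = "singleton_toT 0" and t = "singleton_to_t 0"])
    (simp_all only: eval_lib cong: eval_cong)

lemma retract_contr_provable: "upto S 6"
  by (rule upto_step[OF singleton_to_provable, where T = "retract_contrT 0" and t = "retract_contr_t 0"])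
    (simp_all only: eval_lib cong: eval_cong)

lemma contr_prop_provable: "upto S 7"
  by (rule upto_step[OF retract_contr_provable, where T = "contr_propT 0" and t = "contr_prop_t 0"])
    (simp_all only: eval_lib cong: eval_cong)

lemma fib_shift_provable: "upto S 8"
  by (rule upto_step[OF contr_prop_provable, where T = "fib_shiftT 0" and t = "fib_shift_t 0"])
    (simp_all only: eval_lib cong: eval_cong)

lemma fib_section_provable: "upto S 9"
  by (rule upto_step[OF fib_shift_provable, where T = "fib_sectionT 0" and t = "fib_section_t 0"])
    (simp_all only: eval_lib cong: eval_cong)

lemma quasi_inverse_provable: "upto S 10"
  by (rule upto_step[OF fib_section_provable, where T = "quasi_inverseT 0" and t = "quasi_inverse_t 0"])
    (simp_all only: eval_lib cong: eval_cong)

lemma ua_path_provable: "upto S 11"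
  by (rule upto_step[OF quasi_inverse_provable, where T = "ua_pathT 0" and t = "ua_path_t 0"])
    (simp_all only: eval_lib cong: eval_cong)

lemma coe_id_provable: "upto S 12"
  by (rule upto_step[OF ua_path_provable, where T = "coe_idT 0" and t = "coe_id_t 0"])
    (simp_all only: eval_lib cong: eval_cong)

lemma ua_coe_provable: "upto S 13"
  by (rule upto_step[OF coe_id_provable, where T = "ua_coeT 0" and t = "ua_coe_t 0"])
    (simp_all only: eval_lib cong: eval_cong)

lemma postcomp_coe_provable: "upto S 14"
  by (rule upto_step[OF ua_coe_provable, where T = "postcomp_coeT 0" and t = "postcomp_coe_t 0"])
    (simp_all only: eval_lib cong: eval_cong)

lemma postcomp_provable: "upto S 15"
  by (rule upto_step[OF postcomp_coe_provable, where T = "postcompT 0" and t = "postcomp_t 0"])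
    (simp_all only: eval_lib cong: eval_cong)

lemma proj_equiv_provable: "upto S 16"
  by (rule upto_step[OF postcomp_provable, where T = "proj_equivT 0" and t = "proj_equiv_t 0"])
    (simp_all only: eval_lib cong: eval_cong)

lemma weak_funext_provable: "upto S 17"
  by (rule upto_step[OF proj_equiv_provable, where T = "weak_funextT 0" and t = "weak_funext_t 0"])
    (simp_all only: eval_lib cong: eval_cong)

lemma funext_provable: "upto S 18"
  by (rule upto_step[OF weak_funext_provable, where T = "funextT 0" and t = "funext_t 0"])
    (simp_all only: eval_lib cong: eval_cong)

lemma strong_funext_provable: "upto S 19"
  by (rule upto_step[OF funext_provable, where T = "strong_funextT 0" and t = "strong_funext_t 0"])
    (simp_all only: eval_lib cong: eval_cong)

lemma prop_set_provable: "upto S 20"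
  by (rule upto_step[OF strong_funext_provable, where T = "prop_setT 0" and t = "prop_set_t 0"])
    (simp_all only: eval_lib cong: eval_cong)

lemma prop_Pi_provable: "upto S 21"
  by (rule upto_step[OF prop_set_provable, where T = "prop_PiT 0" and t = "prop_Pi_t 0"])
    (simp_all only: eval_lib cong: eval_cong)

lemma subpair_provable: "upto S 22"
  by (rule upto_step[OF prop_Pi_provable, where T = "subpairT 0" and t = "subpair_t 0"])
    (simp_all only: eval_lib cong: eval_cong)

lemma subpair_large_provable: "upto S 23"
  by (rule upto_step[OF subpair_provable, where T = "subpair_largeT 0" and t = "subpair_large_t 0"])
    (simp_all only: eval_lib cong: eval_cong)

lemma prop_Sig_provable: "upto S 24"
  by (rule upto_step[OF subpair_large_provable, where T = "prop_SigT 0" and t = "prop_Sig_t 0"])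
    (simp_all only: eval_lib cong: eval_cong)

lemma prop_contr_provable: "upto S 25"
  by (rule upto_step[OF prop_Sig_provable, where T = "prop_contrT 0" and t = "prop_contr_t 0"])
    (simp_all only: eval_lib cong: eval_cong)

lemma prop_trunc_provable: "upto S 26"
  by (rule upto_step[OF prop_contr_provable, where T = "prop_truncT 0" and t = "prop_trunc_t 0"])
    (simp_all only: eval_lib cong: eval_cong)

lemma retract_trunc_provable: "upto S 27"
  by (rule upto_step[OF prop_trunc_provable, where T = "retract_truncT 0" and t = "retract_trunc_t 0"])
    (simp_all only: eval_lib cong: eval_cong)

lemma trunc_Pi_provable: "upto S 28"
  by (rule upto_step[OF retract_trunc_provable, where T = "trunc_PiT 0" and t = "trunc_Pi_t 0"])
    (simp_all only: eval_lib cong: eval_cong)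

lemma Pi_prop_eq_provable: "upto S 29"
  by (rule upto_step[OF trunc_Pi_provable, where T = "Pi_prop_eqT 0" and t = "Pi_prop_eq_t 0"])
    (simp_all only: eval_lib cong: eval_cong)

lemma TTypes_eq_provable: "upto S 30"
  by (rule upto_step[OF Pi_prop_eq_provable, where T = "TTypes_eqT 0" and t = "TTypes_eq_t 0"])
    (simp_all only: eval_lib cong: eval_cong)

lemma funext_large_provable: "upto S 31"
  by (rule upto_step[OF TTypes_eq_provable, where T = "funext_largeT 0" and t = "funext_large_t 0"])
    (simp_all only: eval_lib cong: eval_cong)

lemma extension_provable: "upto S 32"
  by (rule upto_step[OF funext_large_provable, where T = "extensionT 0" and t = "extension_t 0"])
    (simp_all only: eval_lib cong: eval_cong)

lemma retract_inj_provable: "upto S 33"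
  by (rule upto_step[OF extension_provable, where T = "retract_injT 0" and t = "retract_inj_t 0"])
    (simp_all only: eval_lib cong: eval_cong)

lemma const_emb_provable: "upto S 34"
  by (rule upto_step[OF retract_inj_provable, where T = "const_embT 0" and t = "const_emb_t 0"])
    (simp_all only: eval_lib cong: eval_cong)

lemma flabby_provable: "upto S 35"
  by (rule upto_step[OF const_emb_provable, where T = "flabbyT 0" and t = "flabby_t 0"])
    (simp_all only: eval_lib cong: eval_cong)

lemma inj_retract_provable: "upto S 36"
  by (rule upto_step[OF flabby_provable, where T = "inj_retractT 0" and t = "inj_retract_t 0"])
    (simp_all only: eval_lib cong: eval_cong)

lemma main_provable: "provable S (mainT 0)"
proof (rule provable_step[where L = lib and n = 100 and t = "main_t 0"])
  show "provable S (lib ! g)" if "g < length lib" for g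
    using inj_retract_provable that by (simp add: upto_def lib_def)
qed (simp_all only: eval_lib cong: eval_cong)

end

theorem theorem32:
  fixes u :: nat
  shows "\<exists>t. univalence \<union> propositional_truncations \<union> propositional_resizing \<parallel> [] \<turnstile> t \<Ztypecolon>
    Pi NatT (Pi (Univ u) (Arr (isTrunc u (Succ (Var 1)) (Var 0))
      (Iff (AInj u u (Var 0))
           (Sig (Univ u) (Retract (Var 1) (Arr (Var 0) (TruncatedTypes u (Var 2))))))))"
proof -
  \<comment> \<open>Unfolding both vocabularies yields the same de Bruijn term, so the goal is
    reached without any judgemental conversion.\<close>
  have "I0 u (mainT 0) = Pi NatT (Pi (Univ u) (Arr (isTrunc u (Succ (Var 1)) (Var 0))
      (Iff (AInj u u (Var 0))
           (Sig (Univ u) (Retract (Var 1) (Arr (Var 0) (TruncatedTypes u (Var 2))))))))"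
    by (simp add: I0_def ho numeral_eq_Suc Arr_def Times_def Iff_def pr1_def idfun_def cmp_def Htpy_def isContr_def
      isProp_def fib_def isEmb_def Emb_def isTrunc_def TruncatedTypes_def Retract_def AInj_def wk_def)
  moreover have "provable (univalence \<union> propositional_truncations \<union> propositional_resizing) (mainT 0)"
    by (rule main_provable) blast
  ultimately show ?thesis
    unfolding provable_def inhabits_def by metis
qed

end
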